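(* Let $a$ and $\psi$ satisfy the assumptions of the context, and let $\vec y\in\mathbb Z^{\bar n}$ satisfy $y_j-y_{j+1}\ge\kappa$ for each $j=1,\dots,\bar n-1$. For $1\le n\le\bar n$ define $$\mathcal S_{-n}(z_1,z_2)=(\mathcal RQ^{-n}A)^*(z_1,z_2)=\frac{\alpha^{-n+1}}{2\pi \mathrm i}\oint_{\gamma_r}dw\,\frac{\theta^{z_2-z_1}}{w^{z_2-z_1+n+1}}\frac{(1-w)^n}{a(w)^{n-1}}\psi(w),$$ $$\bar{\mathcal S}_n(z_1,z_2)=\bar Q^{(n)}\mathcal R^{-1}A^{-1}(z_1,z_2)=\frac{\alpha^{n-1}}{2\pi \mathrm i}\oint_{\gamma_\delta}dw\,\frac{(1-w)^{z_2-z_1+n-1}}{\theta^{z_2-z_1}w^n}\frac{a(1-w)^{n-1}}{\psi(1-w)},$$ where $\delta\in(0,1)$ is such that $a(1-w)$ and $\psi(1-w)^{-1}$ are analytic inside $\gamma_\delta$. Then the kernel $K$ of the context can be expressed, for any $n_i,n_j\in\{1,\dots,\bar n\}$ and $x_i,x_j\in\mathbb Z$, as $$K(n_i,x_i;n_j,x_j)=-Q^{n_j-n_i}(x_i,x_j)\mathbf 1_{n_i<n_j}+(\mathcal S_{-n_i})^*\,\bar{\mathcal S}^{\mathrm{epi}(\vec y)}_{n_j}(x_i,x_j),$$ where $$\bar{\mathcal S}^{\mathrm{epi}(\vec y)}_n(z_1,z_2)=\mathbb E_{B_0=z_1}\bigl[\bar{\mathcal S}_{n-\tau}(B_\tau,z_2)\mathbf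 1_{\tau<n}\bigr],$$ $B$ is the random walk on $\mathbb Z$ with transition matrix $Q$, and $\tau=\min\{m=0,\dots,n-1:B_m>y_{m+1}\}$ ($\tau=\infty$ if there is no such $m$). Moreover, in the definition of $\mathcal S_{-n}$ the contour $\gamma_r$ can be replaced by $\gamma_{r'}$ for any $r'\in[r,1)$.
   Context: Notation: $\gamma_s$ is the positively oriented circle of radius $s$ centred at $0$; analytic on a closed set means analytic on an open set containing it. Kernels on $\mathbb Z\times\mathbb Z$ act as $Kf(x)=\sum_yK(x,y)f(y)$ and compose by summation; $K^*(x,y)=K(y,x)$. Assumptions: $\kappa\in\{0,1,2,\dots\}$, $\theta\in(0,1)$ and $(q_i)_{i\in\mathbb Z}$ with $q_i\ge0$ satisfy $q_i=1$ for $i>\kappa$ and $\sum_iq_i\theta^i<\infty$. Put $a(w)=\sum_{i\le\kappa}(q_{i+1}-q_i)w^i$; $\psi$ is a complex function. There are radii $0<r<\theta<1<\bar r$ such that $a$ is analytic on $\{|w|\ge r\}$ and $1/a$, $\psi$, $1/\psi$ are analytic and non-zero on $\{r\le|w|\le\bar r\}$. Kernels: $\alpha=\frac{1-\theta}{a(\theta)\theta}=1/\sum_i\theta^iq_i$; $Q(x,y)=\alpha\theta^{x-y}q_{x-y}$ (a Markov transition matrix); $A(x,y)=\alpha\theta^{x-y}(q_{x-y+1}-q_{x-y})$; for $k\in\mathbb Z$, $$Q^k(x,y)=\frac{\alpha^k}{2\pi \mathrm i}\oint_{\gamma_r}dw\frac{\theta^{x-y}}{w^{x-y-k+1}}\Bigl(\frac{a(w)}{1-w}\Bigr)^k,\quad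 A^k(x,y)=\frac{\alpha^k}{2\pi \mathrm i}\oint_{\gamma_r}dw\frac{\theta^{x-y}}{w^{x-y+1}}a(w)^k,\quad \mathcal R^{\pm1}(x,y)=\frac1{2\pi \mathrm i}\oint_{\gamma_r}dw\frac{\theta^{x-y}}{w^{x-y+1}}\psi(w)^{\pm1}.$$ For $\ell\ge1$, $\bar Q^{(\ell)}=A^\ell\bar Q_0^{(\ell)}$ with $\bar Q_0^{(\ell)}(z_1,z_2)=\theta^{z_1-z_2}\frac{(z_1-z_2-1)_{\ell-1}}{(\ell-1)!}$, $(x)_\ell=x(x-1)\cdots(x-\ell+1)$, $(x)_0=1$. The kernel $K$: fix $\bar n\in\mathbb N$ and $\vec y\in\mathbb Z^{\bar n}$. For $1\le n\le\bar n$ and $n-\bar n\le k\le n-1$ let $$\Psi^n_k(x)=\mathcal RQ^{-k}(x,y_{n-k})=\frac{\alpha^{-k}}{2\pi \mathrm i}\oint_{\gamma_r}dw\,\frac{\theta^{x-y_{n-k}}}{w^{x-y_{n-k}+k+1}}\Bigl(\frac{1-w}{a(w)}\Bigr)^k\psi(w).$$ $\{\Phi^n_k\}_{k=0,\dots,n-1}$ is the unique family of functions on $\mathbb Z$ such that $\sum_{x\in\mathbb Z}\Psi^n_\ell(x)\Phi^n_k(x)=\mathbf 1_{k=\ell}$ for $0\le k,\ell\le n-1$ and $\theta^x\Phi^n_k(x)$ is a polynomial of degree $k$ in $x$. Then $$K(n_i,x_i;n_j,x_j)=-Q^{n_j-n_i}(x_i,x_j)\mathbf 1_{n_i<n_j}+\sum_{k=1}^{n_j}\Psi^{n_i}_{n_i-k}(x_i)\Phi^{n_j}_{n_j-k}(x_j).$$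 *)

theory Defs
  imports
    "HOL-Complex_Analysis.Complex_Analysis"
    "HOL-Probability.Probability"
    "HOL-Computational_Algebra.Polynomial"
begin

type_synonym kernel = "int \<Rightarrow> int \<Rightarrow> complex"

definition kcomp :: "kernel \<Rightarrow> kernel \<Rightarrow> kernel" (infixl \<open>\<circ>\<^sub>K\<close> 70) where
  "(K \<circ>\<^sub>K L) x y = (\<Sum>\<^sub>\<infinity>z. K x z * L z y)"

definition adjoint_ker :: "kernel \<Rightarrow> kernel" where
  "adjoint_ker K x y = K y x"

(* Also equal to (1 - \<theta>) / (a(\<theta>) * \<theta>), by summation by parts. *)
definition alpha :: "real \<Rightarrow> (int \<Rightarrow> real) \<Rightarrow> real" where
  "alpha \<theta> q = 1 / (\<Sum>\<^sub>\<infinity>i. \<theta> powi i * q i)"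

definition Q_ker :: "real \<Rightarrow> (int \<Rightarrow> real) \<Rightarrow> int \<Rightarrow> int \<Rightarrow> real" where
  "Q_ker \<theta> q x y = alpha \<theta> q * \<theta> powi (x - y) * q (x - y)"

definition A_ker :: "real \<Rightarrow> (int \<Rightarrow> real) \<Rightarrow> kernel" where
  "A_ker \<theta> q x y = complex_of_real (alpha \<theta> q * \<theta> powi (x - y) * (q (x - y + 1) - q (x - y)))"

definition Q_pow ::
  "real \<Rightarrow> (int \<Rightarrow> real) \<Rightarrow> (complex \<Rightarrow> complex) \<Rightarrow> real \<Rightarrow> int \<Rightarrow> kernel" where
  "Q_pow \<theta> q a r k x y =
     complex_of_real (alpha \<theta> q) powi k / (2 * of_real pi * \<i>) *
     contour_integral (circlepath 0 r)
       (\<lambda>w. complex_of_real \<theta> powi (x - y) / w powi (x - y - k + 1) * (a w / (1 - w)) powi k)"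

definition A_pow ::
  "real \<Rightarrow> (int \<Rightarrow> real) \<Rightarrow> (complex \<Rightarrow> complex) \<Rightarrow> real \<Rightarrow> int \<Rightarrow> kernel" where
  "A_pow \<theta> q a r k x y =
     complex_of_real (alpha \<theta> q) powi k / (2 * of_real pi * \<i>) *
     contour_integral (circlepath 0 r)
       (\<lambda>w. complex_of_real \<theta> powi (x - y) / w powi (x - y + 1) * a w powi k)"

(* Used with exponents e = 1 and e = -1. *)
definition R_pow :: "real \<Rightarrow> (complex \<Rightarrow> complex) \<Rightarrow> real \<Rightarrow> int \<Rightarrow> kernel" where
  "R_pow \<theta> \<psi> r e x y =
     1 / (2 * of_real pi * \<i>) *
     contour_integral (circlepath 0 r)
       (\<lambda>w. complex_of_real \<theta> powi (x - y) / w powi (x - y + 1) * \<psi> w powi e)"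

(* By definition of the generalized binomial coefficient, u gchoose (l - 1) is the falling
   factorial u (u - 1) ... (u - l + 2) divided by (l - 1)!. *)
definition Qbar0 :: "real \<Rightarrow> nat \<Rightarrow> kernel" where
  "Qbar0 \<theta> l z1 z2 =
     complex_of_real \<theta> powi (z1 - z2) * (of_int (z1 - z2 - 1) gchoose (l - 1))"

definition Qbar ::
  "real \<Rightarrow> (int \<Rightarrow> real) \<Rightarrow> (complex \<Rightarrow> complex) \<Rightarrow> real \<Rightarrow> nat \<Rightarrow> kernel" where
  "Qbar \<theta> q a r l = A_pow \<theta> q a r (int l) \<circ>\<^sub>K Qbar0 \<theta> l"

(* Here n - nbar \<le> k \<le> n - 1 may be negative. This is the kernel (R Q^(-k))(x, y_(n-k)). *)
definition Psi ::
  "real \<Rightarrow> (int \<Rightarrow> real) \<Rightarrow> (complex \<Rightarrow> complex) \<Rightarrow> (complex \<Rightarrow> complex) \<Rightarrow> real \<Rightarrow>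
   (nat \<Rightarrow> int) \<Rightarrow> nat \<Rightarrow> int \<Rightarrow> int \<Rightarrow> complex" where
  "Psi \<theta> q a \<psi> r y n k x =
     (let d = x - y (nat (int n - k)) in
      complex_of_real (alpha \<theta> q) powi (- k) / (2 * of_real pi * \<i>) *
      contour_integral (circlepath 0 r)
        (\<lambda>w. complex_of_real \<theta> powi d / w powi (d + k + 1) * ((1 - w) / a w) powi k * \<psi> w))"

definition biorthogonal ::
  "real \<Rightarrow> nat \<Rightarrow> (int \<Rightarrow> int \<Rightarrow> complex) \<Rightarrow> (nat \<Rightarrow> int \<Rightarrow> complex) \<Rightarrow> bool" where
  "biorthogonal \<theta> n \<Psi> \<Phi> \<longleftrightarrow>
     (\<forall>k<n. \<forall>l<n. ((\<lambda>x. \<Psi> (int l) x * \<Phi> k x) has_sum (if k = l then 1 else 0)) UNIV) \<and>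
     (\<forall>k<n. \<exists>p :: complex poly. degree p = k \<and>
        (\<forall>x. complex_of_real \<theta> powi x * \<Phi> k x = poly p (of_int x)))"

(* Only the members k < n of a biorthogonal family are determined, hence the description
   ranges over the k-th member instead of the whole family. *)
definition Phi ::
  "real \<Rightarrow> (int \<Rightarrow> real) \<Rightarrow> (complex \<Rightarrow> complex) \<Rightarrow> (complex \<Rightarrow> complex) \<Rightarrow> real \<Rightarrow>
   (nat \<Rightarrow> int) \<Rightarrow> nat \<Rightarrow> nat \<Rightarrow> int \<Rightarrow> complex" where
  "Phi \<theta> q a \<psi> r y n k = (THE f. \<exists>\<Phi>. biorthogonal \<theta> n (Psi \<theta> q a \<psi> r y n) \<Phi> \<and> f = \<Phi> k)"

definition K_ker ::
  "real \<Rightarrow> (int \<Rightarrow> real) \<Rightarrow> (complex \<Rightarrow> complex) \<Rightarrow> (complex \<Rightarrow> complex) \<Rightarrow> real \<Rightarrow>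
   (nat \<Rightarrow> int) \<Rightarrow> nat \<Rightarrow> int \<Rightarrow> nat \<Rightarrow> int \<Rightarrow> complex" where
  "K_ker \<theta> q a \<psi> r y ni xi nj xj =
     - (if ni < nj then Q_pow \<theta> q a r (int nj - int ni) xi xj else 0) +
     (\<Sum>k=1..nj. Psi \<theta> q a \<psi> r y ni (int ni - int k) xi * Phi \<theta> q a \<psi> r y nj (nj - k) xj)"

definition S_ker ::
  "real \<Rightarrow> (int \<Rightarrow> real) \<Rightarrow> (complex \<Rightarrow> complex) \<Rightarrow> (complex \<Rightarrow> complex) \<Rightarrow> real \<Rightarrow> nat \<Rightarrow> kernel" where
  "S_ker \<theta> q a \<psi> r n =
     adjoint_ker (R_pow \<theta> \<psi> r 1 \<circ>\<^sub>K Q_pow \<theta> q a r (- int n) \<circ>\<^sub>K A_ker \<theta> q)"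

definition S_contour ::
  "real \<Rightarrow> (int \<Rightarrow> real) \<Rightarrow> (complex \<Rightarrow> complex) \<Rightarrow> (complex \<Rightarrow> complex) \<Rightarrow> real \<Rightarrow> nat \<Rightarrow> kernel" where
  "S_contour \<theta> q a \<psi> s n z1 z2 =
     complex_of_real (alpha \<theta> q) powi (- int n + 1) / (2 * of_real pi * \<i>) *
     contour_integral (circlepath 0 s)
       (\<lambda>w. complex_of_real \<theta> powi (z2 - z1) / w powi (z2 - z1 + int n + 1) *
            ((1 - w) ^ n / a w ^ (n - 1)) * \<psi> w)"

definition Sbar_ker ::
  "real \<Rightarrow> (int \<Rightarrow> real) \<Rightarrow> (complex \<Rightarrow> complex) \<Rightarrow> (complex \<Rightarrow> complex) \<Rightarrow> real \<Rightarrow> nat \<Rightarrow> kernel" where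
  "Sbar_ker \<theta> q a \<psi> r n =
     Qbar \<theta> q a r n \<circ>\<^sub>K R_pow \<theta> \<psi> r (- 1) \<circ>\<^sub>K A_pow \<theta> q a r (- 1)"

definition Sbar_contour ::
  "real \<Rightarrow> (int \<Rightarrow> real) \<Rightarrow> (complex \<Rightarrow> complex) \<Rightarrow> (complex \<Rightarrow> complex) \<Rightarrow> real \<Rightarrow> nat \<Rightarrow> kernel" where
  "Sbar_contour \<theta> q a \<psi> \<delta> n z1 z2 =
     complex_of_real (alpha \<theta> q) ^ (n - 1) / (2 * of_real pi * \<i>) *
     contour_integral (circlepath 0 \<delta>)
       (\<lambda>w. (1 - w) powi (z2 - z1 + int n - 1) / (complex_of_real \<theta> powi (z2 - z1) * w ^ n) *
            (a (1 - w) ^ (n - 1) / \<psi> (1 - w)))"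

(* Markov chain B on the integers, started at z, with transition matrix Q; the last clause is
   the Markov property with the conditional probability multiplied out. *)
definition random_walk_from ::
  "(int \<Rightarrow> int \<Rightarrow> real) \<Rightarrow> int \<Rightarrow> 'w measure \<Rightarrow> (nat \<Rightarrow> 'w \<Rightarrow> int) \<Rightarrow> bool" where
  "random_walk_from Q z M B \<longleftrightarrow>
     prob_space M \<and>
     (\<forall>m. B m \<in> measurable M (count_space UNIV)) \<and>
     (AE \<omega> in M. B 0 \<omega> = z) \<and>
     (\<forall>m (b :: nat \<Rightarrow> int).
        measure M {\<omega> \<in> space M. \<forall>i\<le>Suc m. B i \<omega> = b i} =
        measure M {\<omega> \<in> space M. \<forall>i\<le>m. B i \<omega> = b i} * Q (b m) (b (Suc m)))"

(* The infimum of the empty set is \<infinity>. *)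
definition hit_time :: "nat \<Rightarrow> (nat \<Rightarrow> int) \<Rightarrow> (nat \<Rightarrow> int) \<Rightarrow> enat" where
  "hit_time n y b = Inf {enat m | m. m < n \<and> b m > y (m + 1)}"

definition stopped_value ::
  "(nat \<Rightarrow> kernel) \<Rightarrow> (nat \<Rightarrow> int) \<Rightarrow> nat \<Rightarrow> int \<Rightarrow> (nat \<Rightarrow> int) \<Rightarrow> complex" where
  "stopped_value S y n z2 b =
     (let \<tau> = hit_time n y b in
      if \<tau> < enat n then S (n - the_enat \<tau>) (b (the_enat \<tau>)) z2 else 0)"

(* P z is the law under which the walk B starts at z. *)
definition epi_ker ::
  "(int \<Rightarrow> 'w measure) \<Rightarrow> (nat \<Rightarrow> 'w \<Rightarrow> int) \<Rightarrow> (nat \<Rightarrow> kernel) \<Rightarrow> (nat \<Rightarrow> int) \<Rightarrow> nat \<Rightarrow> kernel" where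
  "epi_ker P B S y n z1 z2 = (LINT \<omega>|P z1. stopped_value S y n z2 (\<lambda>m. B m \<omega>))"

end

theory Submission
  imports Defs "HOL-Probability.Product_PMF"
begin

text \<open>
  Up to the conjugation by \<open>\<theta> powi (x - y)\<close> every kernel is a convolution, determined by a symbol on
  the circles around 0, and composing kernels multiplies symbols. With \<open>Qbar (n)\<close> one leaves this
  calculus only by a pole at 1: these kernels are residues at 1, polynomial in \<open>x - y\<close> of degree
  \<open>n - 1\<close>, and \<open>A^(-1) Q^k\<close> coincides with \<open>A^(-1) Qbar (k)\<close> as soon as \<open>x - y > (k - 1) \<kappa>\<close>.

  The pairing of polynomials with the \<open>Psi\<close> is triangular, since the symbol of \<open>Psi l\<close> contains
  \<open>(1 - w)^l\<close>, that is, an \<open>l\<close>-th difference. This gives existence and uniqueness of the \<open>Phi\<close>, and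
  expanding the polynomial \<open>x \<mapsto> Sbar n (z, x)\<close> in them gives
  \<open>Sbar n (z, x) = (\<Sum>k=1..n. A^(-1) Qbar (k) (z, y k) Phi (n - k) x)\<close>.
  Hence the stopped expectation is \<open>(\<Sum>k=1..n. A^(-1) Q^k (z, y k) Phi (n - k) x)\<close> for all \<open>z\<close>:
  for \<open>z > y 1\<close> by the gaps between the \<open>y k\<close>, and for \<open>z \<le> y 1\<close> by induction on \<open>n\<close> and the first
  step of the walk, where the term \<open>k = 1\<close> vanishes. Composing with \<open>R Q^(-n) A\<close> yields the kernel.
\<close>

subsection \<open>Laurent coefficients\<close>

text \<open>The factor \<open>A^(-1)\<close> is what lets the first-step argument close: a step of
  the walk may go upwards, so \<open>Q\<close> need not vanish from points at or below
  \<open>y 1\<close>, whereas \<open>A^(-1) Q\<close> has the symbol \<open>w / (1 - w)\<close>,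
  hence the entries \<open>\<theta> powi d\<close> for \<open>d = x - y \<ge> 1\<close> and 0
  otherwise. The gap \<open>\<kappa>\<close> comes from \<open>a\<close>, whose Laurent coefficients
  vanish above \<open>\<kappa>\<close>; the coefficients of \<open>(w / (1 - w)) ^ k\<close> agree
  with a polynomial in \<open>d\<close> only for \<open>d \<ge> 1\<close>, and convolving with those
  of \<open>a ^ (k - 1)\<close> moves this threshold to \<open>(k - 1) \<kappa>\<close>.

  Two annuli are needed. Symbols containing \<open>1 / (1 - w)\<close> are expanded below the pole,
  for \<open>r \<le> cmod w \<le> \<theta>\<close>; symbols acting on pole kernels have to be
  analytic around 1, and for them the annulus extends to \<open>rbar\<close>.

  The obstacle in the probabilistic half is growth: \<open>Sbar n (z, x)\<close> is unbounded as
  \<open>z\<close> tends to minus infinity, but the stopping rule evaluates it only above the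
  boundary, where the weight \<open>\<theta> powi (z - x)\<close> dominates.\<close>

definition closed_annulus :: "real \<Rightarrow> real \<Rightarrow> complex set" where
  "closed_annulus r s = {w. r \<le> cmod w \<and> cmod w \<le> s}"

definition laurent_coeff :: "real \<Rightarrow> (complex \<Rightarrow> complex) \<Rightarrow> int \<Rightarrow> complex" where
  "laurent_coeff r f d =
     contour_integral (circlepath 0 r) (\<lambda>w. f w / w powi (d + 1)) / (2 * of_real pi * \<i>)"

lemma contour_integrable_circlepath_sphere:
  assumes "0 < r" "continuous_on (sphere 0 r) f"
  shows "f contour_integrable_on circlepath 0 r"
  using assms by (intro contour_integrable_continuous_circlepath) auto

lemma sphere_subset_closed_annulus: "r \<le> t \<Longrightarrow> t \<le> s \<Longrightarrow> sphere 0 t \<subseteq> closed_annulus r s"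
  by (auto simp: closed_annulus_def)

lemma contour_integral_circlepath_cong:
  assumes "\<And>w. cmod w = r \<Longrightarrow> f w = g w" "0 < r"
  shows "contour_integral (circlepath 0 r) f = contour_integral (circlepath 0 r) g"
  by (rule contour_integral_eq) (use assms in \<open>auto simp: path_image_circlepath\<close>)

text \<open>Every interchange of an unordered sum with a contour integral goes through here: the
  majorant \<open>M\<close> gives uniform convergence along the filter of finite index sets, which
  the integral respects.\<close>

lemma has_sum_contour_integral_circlepath:
  fixes g :: "'i \<Rightarrow> complex \<Rightarrow> complex"
  assumes r: "0 < r"
    and cont: "\<And>j. j \<in> I \<Longrightarrow> continuous_on (sphere 0 r) (g j)"
    and bound: "\<And>j u. j \<in> I \<Longrightarrow> cmod u = r \<Longrightarrow> norm (g j u) \<le> M j"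
    and M: "M summable_on I"
    and G: "\<And>u. cmod u = r \<Longrightarrow> ((\<lambda>j. g j u) has_sum G u) I"
  shows "((\<lambda>j. contour_integral (circlepath 0 r) (g j)) has_sum
           contour_integral (circlepath 0 r) G) I"
proof -
  have int: "g j contour_integrable_on circlepath 0 r" if "j \<in> I" for j
    using contour_integrable_circlepath_sphere[OF r cont[OF that]] .
  have ul: "uniform_limit (sphere 0 r) (\<lambda>X u. \<Sum>j\<in>X. g j u) (\<lambda>u. \<Sum>\<^sub>\<infinity>j\<in>I. g j u)
          (finite_subsets_at_top I)"
    using bound M by (intro Weierstrass_m_test_general[where M = M]) auto
  have ul': "uniform_limit (sphere 0 r) (\<lambda>X u. \<Sum>j\<in>X. g j u) G (finite_subsets_at_top I)"
    by (rule uniform_limit_cong'[THEN iffD1, OF _ _ ul]) (use G in \<open>auto simp: infsumI\<close>)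
  have ev: "\<forall>\<^sub>F X in finite_subsets_at_top I. finite X \<and> X \<subseteq> I"
    by (rule eventually_finite_subsets_at_top_weakI) auto
  have evi: "\<forall>\<^sub>F X in finite_subsets_at_top I.
      (\<lambda>u. \<Sum>j\<in>X. g j u) contour_integrable_on circlepath 0 r"
    using ev by eventually_elim (auto intro!: contour_integrable_sum int)
  have "((\<lambda>X. contour_integral (circlepath 0 r) (\<lambda>u. \<Sum>j\<in>X. g j u)) \<longlongrightarrow>
       contour_integral (circlepath 0 r) G) (finite_subsets_at_top I)"
    by (rule contour_integral_uniform_limit_circlepath(2)[OF evi ul' _ r]) auto
  moreover have "\<forall>\<^sub>F X in finite_subsets_at_top I.
      contour_integral (circlepath 0 r) (\<lambda>u. \<Sum>j\<in>X. g j u) =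
      (\<Sum>j\<in>X. contour_integral (circlepath 0 r) (g j))"
    using ev by eventually_elim (auto intro!: contour_integral_sum int)
  ultimately show ?thesis
    unfolding has_sum_def by (rule Lim_transform_eventually)
qed

lemma contour_integral_circlepath_radius:
  assumes f: "f analytic_on closed_annulus r s" and r: "0 < r" "r \<le> s"
    and t: "t \<in> {r..s}"
  shows "contour_integral (circlepath 0 t) f = contour_integral (circlepath 0 r) f"
proof -
  obtain S where S: "open S" "closed_annulus r s \<subseteq> S" "f holomorphic_on S"
    using f analytic_on_holomorphic by auto
  have eq: "circlepath 0 u x = of_real u * exp (2 * of_real pi * \<i> * x)" for u x
    by (simp add: circlepath)
  show ?thesis
  proof (rule Cauchy_theorem_homotopic_loops[OF _ S(1,3)])
    \<comment> \<open>The linear homotopy between concentric circles is radial: it runs through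
      circles whose radii are convex combinations of \<open>t\<close> and \<open>r\<close>, and so
      never leaves the annulus.\<close>
    show "homotopic_loops S (circlepath 0 t) (circlepath 0 r)"
    proof (rule homotopic_loops_linear)
      fix x :: real assume x: "x \<in> {0..1}"
      show "closed_segment (circlepath 0 t x) (circlepath 0 r x) \<subseteq> S"
      proof
        fix z assume "z \<in> closed_segment (circlepath 0 t x) (circlepath 0 r x)"
        then obtain v where v: "0 \<le> v" "v \<le> 1"
          "z = (1 - v) *\<^sub>R circlepath 0 t x + v *\<^sub>R circlepath 0 r x"
          by (auto simp: closed_segment_def)
        have z: "z = of_real ((1 - v) * t + v * r) * exp (2 * of_real pi * \<i> * x)"
          unfolding v(3) eq by (simp add: scaleR_conv_of_real algebra_simps)
        have 1: "r \<le> (1 - v) * t + v * r"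
        proof -
          have "(1 - v) * r \<le> (1 - v) * t" using v t by (intro mult_left_mono) auto
          then show ?thesis by (simp add: algebra_simps)
        qed
        have 2: "(1 - v) * t + v * r \<le> s"
        proof -
          have "(1 - v) * t \<le> (1 - v) * s" "v * r \<le> v * s"
            using v t r by (auto intro!: mult_left_mono)
          then show ?thesis by (simp add: algebra_simps)
        qed
        have "cmod z = (1 - v) * t + v * r"
          unfolding z norm_mult norm_of_real using 1 r by (simp del: of_real_add of_real_mult of_real_diff)
        then show "z \<in> S" using S(2) 1 2 by (auto simp: closed_annulus_def)
      qed
    qed auto
  qed auto
qed

section \<open>Geometric series and the Laurent expansion on an annulus\<close>

lemma has_sum_geometric_pos_powi:
  fixes u w :: "'a :: {real_normed_field, banach}"
  assumes "norm w < norm u"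
  shows "((\<lambda>j::int. w powi j / u powi (j + 1)) has_sum 1 / (u - w)) {0..}"
proof -
  have u: "u \<noteq> 0" "u \<noteq> w" using assms by auto
  have n: "norm (w / u) < 1" using assms u by (simp add: norm_divide divide_simps)
  have "(\<lambda>n. (w / u) ^ n) sums (1 / (1 - w / u))" by (rule geometric_sums[OF n])
  moreover have "summable (\<lambda>n. norm ((w / u) ^ n))"
    unfolding norm_power using n by (intro summable_geometric) auto
  ultimately have "((\<lambda>n. (w / u) ^ n) has_sum (1 / (1 - w / u))) UNIV"
    by (rule norm_summable_imp_has_sum[rotated])
  from has_sum_cmult_right[OF this, of "1 / u"]
  have "((\<lambda>n. w ^ n / u ^ Suc n) has_sum (1 / (u - w))) UNIV"
    using u by (simp add: power_divide field_simps)
  also have "?this \<longleftrightarrow> ?thesis"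
    by (intro has_sum_reindex_bij_witness[of _ nat int])
       (auto simp: u power_int_add_1 power_int_add)
  finally show ?thesis .
qed

text \<open>Exchanging \<open>u\<close> with \<open>w\<close> and substituting
  \<open>- 1 - j\<close> for \<open>j\<close> turns this into the series over nonnegative
  exponents.\<close>

lemma has_sum_geometric_neg_powi:
  fixes u w :: "'a :: {real_normed_field, banach}"
  assumes "norm u < norm w" "u \<noteq> 0"
  shows "((\<lambda>j::int. w powi j / u powi (j + 1)) has_sum 1 / (w - u)) {..<0}"
proof -
  have "((\<lambda>j::int. u powi j / w powi (j + 1)) has_sum 1 / (w - u)) {0..}"
    by (rule has_sum_geometric_pos_powi[OF assms(1)])
  also have "?this \<longleftrightarrow> ?thesis"
  proof (rule has_sum_reindex_bij_witness[of _ "\<lambda>j. - 1 - j" "\<lambda>j. - 1 - j"])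
    fix j :: int
    have "u powi (- j) = inverse (u powi j)" "w powi (-1-j) = inverse (w powi (j+1))"
      using power_int_minus[of w "j + 1"] by (simp_all add: power_int_minus algebra_simps)
    then show "w powi (- 1 - j) / u powi (- 1 - j + 1) = u powi j / w powi (j + 1)"
      by (simp add: field_simps)
  qed auto
  finally show ?thesis .
qed

lemma laurent_coeff_radius:
  assumes f: "f analytic_on closed_annulus r s" and r: "0 < r" and t: "t \<in> {r..s}"
  shows "laurent_coeff t f d = laurent_coeff r f d"
proof -
  have "(\<lambda>w. f w / w powi (d + 1)) analytic_on closed_annulus r s"
    using r by (intro analytic_intros f) (auto simp: closed_annulus_def)
  then show ?thesis unfolding laurent_coeff_def
    using contour_integral_circlepath_radius[of _ r s t] r t by simp
qed

lemma laurent_coeff_cong: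
  assumes "\<And>w. cmod w = r \<Longrightarrow> f w = g w" "0 < r"
  shows "laurent_coeff r f d = laurent_coeff r g d"
  unfolding laurent_coeff_def
  by (subst contour_integral_circlepath_cong[OF _ assms(2)]) (use assms in auto)

lemma continuous_on_bounded_sphere:
  fixes f :: "complex \<Rightarrow> complex"
  assumes "continuous_on (sphere 0 r) f"
  obtains C where "0 < C" "\<And>w. cmod w = r \<Longrightarrow> cmod (f w) \<le> C"
proof -
  have "compact (f ` sphere 0 r)"
    by (intro compact_continuous_image assms) auto
  then obtain C where "0 < C" "\<forall>x\<in>f ` sphere 0 r. norm x \<le> C"
    using bounded_pos compact_imp_bounded by metis
  then show ?thesis using that by auto
qed

text \<open>Cauchy's estimate. For \<open>r < 1\<close> the bound tends to 0 as \<open>d\<close>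
  tends to minus infinity, which later fixes the free constant in the coefficients of
  \<open>sym_Q\<close>.\<close>

lemma laurent_coeff_bound:
  assumes f: "continuous_on (sphere 0 r) f" and r: "0 < r"
  obtains C where "0 < C" "\<And>d. cmod (laurent_coeff r f d) \<le> C * r powi (- d)"
proof -
  obtain C where C: "0 < C" "\<And>w. cmod w = r \<Longrightarrow> cmod (f w) \<le> C"
    using continuous_on_bounded_sphere[OF f] by auto
  have "cmod (laurent_coeff r f d) \<le> C * r powi (- d)" for d
  proof -
    have int: "(\<lambda>w. f w / w powi (d + 1)) contour_integrable_on circlepath 0 r"
      using r by (intro contour_integrable_circlepath_sphere continuous_intros f) auto
    have "cmod (contour_integral (circlepath 0 r) (\<lambda>w. f w / w powi (d + 1)))
        \<le> C / r powi (d + 1) * (2 * pi * r)"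
    proof (rule has_contour_integral_bound_circlepath[OF has_contour_integral_integral[OF int] _ r])
      fix x :: complex assume "cmod (x - 0) = r"
      then show "cmod (f x / x powi (d + 1)) \<le> C / r powi (d + 1)"
        using C r by (auto simp: norm_divide norm_power_int intro!: divide_right_mono)
    qed (use C r in auto)
    then have "cmod (contour_integral (circlepath 0 r) (\<lambda>w. f w / w powi (d + 1))) / (2 * pi)
        \<le> C / r powi (d + 1) * (2 * pi * r) / (2 * pi)"
      by (intro divide_right_mono) auto
    then have "cmod (laurent_coeff r f d) \<le> C / r powi (d + 1) * (2 * pi * r) / (2 * pi)"
      unfolding laurent_coeff_def norm_divide norm_mult by simp
    also have "\<dots> = C * r powi (- d)"
      using r by (simp add: power_int_add power_int_minus field_simps)
    finally show ?thesis .
  qed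
  then show ?thesis using that C by blast
qed

lemma has_sum_finite_sum:
  fixes f :: "'i \<Rightarrow> 'a \<Rightarrow> 'b :: topological_comm_monoid_add"
  assumes "\<And>i. i \<in> I \<Longrightarrow> (f i has_sum s i) A"
  shows "((\<lambda>x. \<Sum>i\<in>I. f i x) has_sum (\<Sum>i\<in>I. s i)) A"
  using assms by (induction I rule: infinite_finite_induct) (auto intro!: has_sum_add)

lemma has_sum_cmult_cancel:
  fixes c :: complex
  assumes "c \<noteq> 0" "((\<lambda>j. c * f j) has_sum c * S) A"
  shows "(f has_sum S) A"
  using has_sum_cmult_right[OF assms(2), of "1 / c"] assms(1) by (simp add: field_simps)

text \<open>Cauchy's formula for an annulus writes \<open>f w\<close> as the difference of the
  integrals over the two boundary circles; expanding the Cauchy kernel geometrically yields the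
  exponents \<open>j \<ge> 0\<close> on the outer circle and \<open>j < 0\<close> on the inner
  one.\<close>

theorem laurent_expansion_closed_annulus:
  assumes f: "f analytic_on closed_annulus r s" and r: "0 < r" and w: "r < cmod w" "cmod w < s"
  shows "((\<lambda>j. laurent_coeff r f j * w powi j) has_sum f w) UNIV"
proof -
  define c where "c = 2 * complex_of_real pi * \<i>"
  have c0: "c \<noteq> 0" by (simp add: c_def)
  have rs: "r < s" "0 < s" using r w by auto
  obtain S where S: "open S" "closed_annulus r s \<subseteq> S" "f holomorphic_on S"
    using f analytic_on_holomorphic by auto
  have wS: "w \<in> S" using S w by (auto simp: closed_annulus_def)
  \<comment> \<open>The removable singularity at \<open>w\<close> is filled by the derivative. The
    quotient is then analytic on the whole annulus, so its integrals over the two boundary circles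
    agree.\<close>
  define g where "g u = (if u = w then deriv f w else (f u - f w) / (u - w))" for u
  have "g holomorphic_on S" unfolding g_def using pole_lemma_open[OF S(3,1)] .
  then have "g analytic_on closed_annulus r s"
    using S analytic_on_holomorphic by blast
  then have g_eq: "contour_integral (circlepath 0 s) g = contour_integral (circlepath 0 r) g"
    using contour_integral_circlepath_radius[of g r s s] rs r by simp
  have contf: "continuous_on (sphere 0 t) f" if "t \<in> {r..s}" for t
    using S that by (meson analytic_imp_holomorphic analytic_on_subset atLeastAtMost_iff f
        holomorphic_on_imp_continuous_on sphere_subset_closed_annulus)
  have split: "contour_integral (circlepath 0 t) g =
      contour_integral (circlepath 0 t) (\<lambda>u. f u / (u - w)) -
      f w * contour_integral (circlepath 0 t) (\<lambda>u. 1 / (u - w))"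
    if t: "t \<in> {r..s}" "t \<noteq> cmod w" for t
  proof -
    have t0: "0 < t" using t r by auto
    have "contour_integral (circlepath 0 t) g =
      contour_integral (circlepath 0 t) (\<lambda>u. f u / (u - w) - f w * (1 / (u - w)))"
      by (rule contour_integral_circlepath_cong[OF _ t0])
         (use t in \<open>auto simp: g_def diff_divide_distrib\<close>)
    also have "\<dots> = contour_integral (circlepath 0 t) (\<lambda>u. f u / (u - w)) -
        contour_integral (circlepath 0 t) (\<lambda>u. f w * (1 / (u - w)))"
      by (rule contour_integral_diff; rule contour_integrable_circlepath_sphere[OF t0])
         (use t in \<open>auto intro!: continuous_intros contf\<close>)
    also have "contour_integral (circlepath 0 t) (\<lambda>u. f w * (1 / (u - w))) =
        f w * contour_integral (circlepath 0 t) (\<lambda>u. 1 / (u - w))"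
      by (rule contour_integral_lmul; rule contour_integrable_circlepath_sphere[OF t0])
         (use t in \<open>auto intro!: continuous_intros contf\<close>)
    finally show ?thesis .
  qed
  have one_s: "contour_integral (circlepath 0 s) (\<lambda>u. 1 / (u - w)) = c"
    using Cauchy_integral_circlepath_simple[of "\<lambda>_. 1" 0 s w] w
    by (auto simp: c_def intro!: contour_integral_unique)
  have one_r: "contour_integral (circlepath 0 r) (\<lambda>u. 1 / (u - w)) = 0"
    by (rule contour_integral_unique, rule Cauchy_theorem_disc_simple[of _ 0 "cmod w"])
       (use w r in \<open>auto intro!: holomorphic_intros\<close>)
  have main: "c * f w = contour_integral (circlepath 0 s) (\<lambda>u. f u / (u - w)) -
      contour_integral (circlepath 0 r) (\<lambda>u. f u / (u - w))"
    using g_eq split[of s] split[of r] one_s one_r w rs by (simp add: algebra_simps)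
  define h where "h j u = f u * (w powi j / u powi (j + 1))" for j u
  have h_int: "contour_integral (circlepath 0 t) (h j) = c * (laurent_coeff r f j * w powi j)"
    if t: "t \<in> {r..s}" for t j
  proof -
    have t0: "0 < t" using t r by auto
    have "contour_integral (circlepath 0 t) (h j) =
        contour_integral (circlepath 0 t) (\<lambda>u. w powi j * (f u / u powi (j + 1)))"
      unfolding h_def by (rule contour_integral_circlepath_cong[OF _ t0]) auto
    also have "\<dots> = w powi j * contour_integral (circlepath 0 t) (\<lambda>u. f u / u powi (j + 1))"
      by (rule contour_integral_lmul; rule contour_integrable_circlepath_sphere[OF t0])
         (use t t0 in \<open>auto intro!: continuous_intros contf\<close>)
    also have "contour_integral (circlepath 0 t) (\<lambda>u. f u / u powi (j + 1)) = c * laurent_coeff t f j"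
      using c0 unfolding laurent_coeff_def c_def by simp
    finally show ?thesis using laurent_coeff_radius[OF f r t] by simp
  qed
  \<comment> \<open>Common to both circles: \<open>f\<close> is bounded on each of them, so a
    geometric majorant in the moduli of \<open>w\<close> and \<open>u\<close> is enough.\<close>
  have hs: "((\<lambda>j. contour_integral (circlepath 0 t) (h j)) has_sum
      contour_integral (circlepath 0 t) (\<lambda>u. f u * G u)) I"
    if t: "t \<in> {r..s}" and sm: "(\<lambda>j. cmod w powi j / t powi (j + 1)) summable_on I"
      and hsG: "\<And>u. cmod u = t \<Longrightarrow> ((\<lambda>j. w powi j / u powi (j + 1)) has_sum G u) I" for t I G
  proof -
    have t0: "0 < t" using t r by auto
    obtain C where C: "0 < C" "\<And>w. cmod w = t \<Longrightarrow> cmod (f w) \<le> C"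
      using continuous_on_bounded_sphere[OF contf[OF t]] by auto
    show ?thesis
    proof (rule has_sum_contour_integral_circlepath[OF t0,
          where M = "\<lambda>j. C * (cmod w powi j / t powi (j + 1))"])
      show "continuous_on (sphere 0 t) (h j)" for j
        unfolding h_def using t t0 by (auto intro!: continuous_intros contf)
      show "cmod (h j u) \<le> C * (cmod w powi j / t powi (j + 1))" if "cmod u = t" for j u
        unfolding h_def norm_mult norm_divide norm_power_int that
        using C that t0 by (intro mult_right_mono) auto
      show "(\<lambda>j. C * (cmod w powi j / t powi (j + 1))) summable_on I"
        by (intro summable_on_cmult_right sm)
      show "((\<lambda>j. h j u) has_sum f u * G u) I" if "cmod u = t" for u
        unfolding h_def by (intro has_sum_cmult_right hsG that)
    qed
  qed
  have "((\<lambda>j. contour_integral (circlepath 0 s) (h j)) has_sum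
      contour_integral (circlepath 0 s) (\<lambda>u. f u * (1 / (u - w)))) {0..}"
  proof (rule hs)
    show "(\<lambda>j. cmod w powi j / s powi (j + 1)) summable_on {0..}"
      using has_sum_geometric_pos_powi[of "cmod w" s] w rs by (auto intro: has_sum_imp_summable)
    show "((\<lambda>j. w powi j / u powi (j + 1)) has_sum 1 / (u - w)) {0..}" if "cmod u = s" for u
      using has_sum_geometric_pos_powi[of w u] that w by auto
  qed (use rs in auto)
  then have pos: "((\<lambda>j. c * (laurent_coeff r f j * w powi j)) has_sum
      contour_integral (circlepath 0 s) (\<lambda>u. f u * (1 / (u - w)))) {0..}"
    using h_int[of s] rs by simp
  have "((\<lambda>j. contour_integral (circlepath 0 r) (h j)) has_sum
      contour_integral (circlepath 0 r) (\<lambda>u. f u * (1 / (w - u)))) {..<0}"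
  proof (rule hs)
    show "(\<lambda>j. cmod w powi j / r powi (j + 1)) summable_on {..<0}"
      using has_sum_geometric_neg_powi[of r "cmod w"] w rs r by (auto intro: has_sum_imp_summable)
    show "((\<lambda>j. w powi j / u powi (j + 1)) has_sum 1 / (w - u)) {..<0}" if "cmod u = r" for u
      using has_sum_geometric_neg_powi[of u w] that w r by auto
  qed (use rs in auto)
  then have neg: "((\<lambda>j. c * (laurent_coeff r f j * w powi j)) has_sum
      contour_integral (circlepath 0 r) (\<lambda>u. f u * (1 / (w - u)))) {..<0}"
    using h_int[of r] rs by simp
  have neg_eq: "contour_integral (circlepath 0 r) (\<lambda>u. f u * (1 / (w - u))) =
      - contour_integral (circlepath 0 r) (\<lambda>u. f u / (u - w))"
  proof -
    have "contour_integral (circlepath 0 r) (\<lambda>u. f u * (1 / (w - u))) =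
      contour_integral (circlepath 0 r) (\<lambda>u. - (f u / (u - w)))"
      by (rule contour_integral_circlepath_cong[OF _ r]) (use w in \<open>auto simp: divide_simps algebra_simps\<close>)
    then show ?thesis by (simp add: contour_integral_neg)
  qed
  have "((\<lambda>j. c * (laurent_coeff r f j * w powi j)) has_sum c * f w) ({0..} \<union> {..<0})"
    using has_sum_Un_disjoint[OF pos neg] unfolding main neg_eq by (simp add: Int_def)
  moreover have "{0..} \<union> {..<0} = (UNIV :: int set)" by auto
  ultimately show ?thesis using has_sum_cmult_cancel[OF c0] by simp
qed

lemma analytic_on_closed_annulus_sphere:
  assumes "f analytic_on closed_annulus r s" "r \<le> t" "t \<le> s"
  shows "continuous_on (sphere 0 t) f"
  using assms by (meson analytic_imp_holomorphic analytic_on_subset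
      holomorphic_on_imp_continuous_on sphere_subset_closed_annulus)

text \<open>For complex families unordered summability is absolute, so convergence of the expansion
  at the single point \<open>t\<close> suffices.\<close>

lemma laurent_coeff_abs_summable:
  assumes f: "f analytic_on closed_annulus r s" and r: "0 < r" and t: "r < t" "t < s"
  shows "(\<lambda>j. cmod (laurent_coeff r f j) * t powi j) summable_on UNIV"
proof -
  have "(\<lambda>j. laurent_coeff r f j * of_real t powi j) summable_on UNIV"
    using laurent_expansion_closed_annulus[OF f r, of "of_real t"] r t
    by (auto intro: has_sum_imp_summable)
  then have "(\<lambda>j. cmod (laurent_coeff r f j * of_real t powi j)) summable_on UNIV"
    by (simp add: summable_on_iff_abs_summable_on_complex)
  then show ?thesis using r t by (simp add: norm_mult norm_power_int)
qed

lemma laurent_coeff_const_mult: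
  assumes "f analytic_on closed_annulus r s" "0 < r" "r \<le> s"
  shows "laurent_coeff r (\<lambda>w. c * f w) d = c * laurent_coeff r f d"
proof -
  have "continuous_on (sphere 0 r) f"
    using assms by (intro analytic_on_closed_annulus_sphere) auto
  then have "(\<lambda>w. f w / w powi (d + 1)) contour_integrable_on circlepath 0 r"
    by (intro contour_integrable_circlepath_sphere) (use assms in \<open>auto intro!: continuous_intros\<close>)
  from contour_integral_lmul[OF this, of c] show ?thesis
    unfolding laurent_coeff_def by simp
qed

text \<open>Only \<open>f\<close> is expanded; the power \<open>u powi j\<close> moves into the
  denominator under \<open>g\<close> and turns its index into \<open>d - j\<close>.\<close>

theorem laurent_coeff_mult:
  assumes f: "f analytic_on closed_annulus r s" and g: "g analytic_on closed_annulus r s"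
    and r: "0 < r" "r < s"
  shows "((\<lambda>j. laurent_coeff r f j * laurent_coeff r g (d - j)) has_sum
           laurent_coeff r (\<lambda>w. f w * g w) d) UNIV"
proof -
  \<comment> \<open>The coefficients are taken on the boundary circle \<open>r\<close>, but the
    expansion holds strictly inside the annulus; the product is therefore integrated on an
    intermediate circle and then moved back.\<close>
  define t where "t = (r + s) / 2"
  have t: "r < t" "t < s" "0 < t" using r by (auto simp: t_def)
  define c where "c = 2 * complex_of_real pi * \<i>"
  have c0: "c \<noteq> 0" by (simp add: c_def)
  have cg: "continuous_on (sphere 0 t) g" and cf: "continuous_on (sphere 0 t) f"
    using t by (auto intro!: analytic_on_closed_annulus_sphere f g)
  obtain C where C: "0 < C" "\<And>w. cmod w = t \<Longrightarrow> cmod (g w / w powi (d + 1)) \<le> C"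
  proof (rule continuous_on_bounded_sphere[of t "\<lambda>w. g w / w powi (d + 1)"])
    show "continuous_on (sphere 0 t) (\<lambda>w. g w / w powi (d + 1))"
      using t by (auto intro!: continuous_intros cg)
  qed blast
  define h where "h j u = laurent_coeff r f j * (g u / u powi (d - j + 1))" for j u
  have h_eq: "h j u = laurent_coeff r f j * u powi j * (g u / u powi (d + 1))" if "cmod u = t" for j u
  proof -
    have "u \<noteq> 0" using that t by auto
    then have "u powi (d + 1) = u powi (d - j + 1) * u powi j"
      by (subst power_int_add[symmetric]) auto
    then show ?thesis using \<open>u \<noteq> 0\<close> by (simp add: h_def)
  qed
  have "((\<lambda>j. contour_integral (circlepath 0 t) (h j)) has_sum
      contour_integral (circlepath 0 t) (\<lambda>u. f u * (g u / u powi (d + 1)))) UNIV"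
  proof (rule has_sum_contour_integral_circlepath
      [where M = "\<lambda>j. cmod (laurent_coeff r f j) * t powi j * C"])
    show "continuous_on (sphere 0 t) (h j)" for j
      unfolding h_def using t by (auto intro!: continuous_intros cg)
    show "cmod (h j u) \<le> cmod (laurent_coeff r f j) * t powi j * C" if "cmod u = t" for j u
      unfolding h_eq[OF that] norm_mult norm_power_int that
      using C(2)[OF that] t by (intro mult_left_mono) auto
    show "(\<lambda>j. cmod (laurent_coeff r f j) * t powi j * C) summable_on UNIV"
      by (intro summable_on_cmult_left laurent_coeff_abs_summable[OF f r(1) t(1,2)])
    show "((\<lambda>j. h j u) has_sum f u * (g u / u powi (d + 1))) UNIV" if "cmod u = t" for u
      unfolding h_eq[OF that]
      by (intro has_sum_cmult_left laurent_expansion_closed_annulus[OF f r(1)]) (use that t in auto)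
  qed (use t in auto)
  moreover have "contour_integral (circlepath 0 t) (h j) =
      c * (laurent_coeff r f j * laurent_coeff r g (d - j))" for j
  proof -
    have "contour_integral (circlepath 0 t) (h j) =
        laurent_coeff r f j * contour_integral (circlepath 0 t) (\<lambda>u. g u / u powi (d - j + 1))"
      unfolding h_def
      by (rule contour_integral_lmul; rule contour_integrable_circlepath_sphere[OF t(3)])
         (use t in \<open>auto intro!: continuous_intros cg\<close>)
    also have "contour_integral (circlepath 0 t) (\<lambda>u. g u / u powi (d - j + 1)) =
        c * laurent_coeff t g (d - j)"
      using c0 unfolding laurent_coeff_def c_def by simp
    finally show ?thesis using laurent_coeff_radius[OF g r(1), of t] t by simp
  qed
  moreover have "contour_integral (circlepath 0 t) (\<lambda>u. f u * (g u / u powi (d + 1))) =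
      c * laurent_coeff r (\<lambda>w. f w * g w) d"
  proof -
    have "laurent_coeff t (\<lambda>w. f w * g w) d = laurent_coeff r (\<lambda>w. f w * g w) d"
      by (rule laurent_coeff_radius[OF _ r(1)]) (use t in \<open>auto intro!: analytic_intros f g\<close>)
    then show ?thesis using c0 by (simp add: laurent_coeff_def c_def)
  qed
  ultimately show ?thesis using has_sum_cmult_cancel[OF c0] by simp
qed

subsection \<open>Residues at 1\<close>

text \<open>Minus the residue at \<open>u = 1\<close> of \<open>f u * u powi (n - 1 - d) / (1 - u) ^ n\<close>, in the variable
  \<open>w = 1 - u\<close>. For \<open>f = 1\<close> it is the polynomial \<open>d - 1 gchoose (n - 1)\<close>.\<close>

definition pole_coeff :: "real \<Rightarrow> nat \<Rightarrow> (complex \<Rightarrow> complex) \<Rightarrow> int \<Rightarrow> complex" where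
  "pole_coeff \<delta> n f d = laurent_coeff \<delta> (\<lambda>w. (1 - w) powi (int n - 1 - d) * f (1 - w)) (int n - 1)"

text \<open>The closed disc of radius \<open>\<delta>\<close> about 1 lies in the open annulus. For
  a symbol analytic on the annulus, the only singularity inside the integration circle is then the
  pole that \<open>pole_coeff\<close> puts at 1; the origin stays outside.\<close>

locale pole_annulus =
  fixes r s \<delta> :: real
  assumes radii_pos: "0 < r" "0 < \<delta>" and radii_less: "r < 1 - \<delta>" "1 + \<delta> < s"
begin

lemma one_minus_bounds:
  assumes "cmod w \<le> \<delta>"
  shows "1 - \<delta> \<le> cmod (1 - w)" "cmod (1 - w) \<le> 1 + \<delta>" "r < cmod (1 - w)" "cmod (1 - w) < s"
    "1 - w \<in> closed_annulus r s" "1 - w \<noteq> 0"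
proof -
  show 1: "1 - \<delta> \<le> cmod (1 - w)" "cmod (1 - w) \<le> 1 + \<delta>"
    using assms norm_triangle_ineq2[of 1 w] norm_triangle_ineq4[of 1 w] by auto
  then show 2: "r < cmod (1 - w)" "cmod (1 - w) < s" using radii_less by auto
  then show "1 - w \<in> closed_annulus r s" by (auto simp: closed_annulus_def)
  show "1 - w \<noteq> 0" using 2 radii_pos by auto
qed

lemma one_minus_nonzero:
  assumes "cmod w = \<delta>"
  shows "1 - w \<noteq> 0" "w \<noteq> 0" "w \<noteq> 1"
  using one_minus_bounds[of w] radii_pos assms by force+

lemma analytic_reflect:
  assumes "f analytic_on closed_annulus r s"
  shows "(\<lambda>w. f (1 - w)) analytic_on cball 0 \<delta>"
proof -
  have "(\<lambda>w. 1 - w) analytic_on cball 0 \<delta>" by (intro analytic_intros)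
  from analytic_on_compose_gen[OF this assms] one_minus_bounds(5) show ?thesis
    by (simp add: o_def)
qed

lemma analytic_reflect_powi:
  assumes "f analytic_on closed_annulus r s"
  shows "(\<lambda>w. (1 - w) powi k * f (1 - w)) analytic_on cball 0 \<delta>"
  by (intro analytic_intros analytic_reflect assms) (use one_minus_bounds(6) in auto)

lemma continuous_reflect_powi:
  assumes "f analytic_on closed_annulus r s"
  shows "continuous_on (sphere 0 \<delta>) (\<lambda>w. (1 - w) powi k * f (1 - w) / w powi m)"
proof -
  have "continuous_on (cball 0 \<delta>) (\<lambda>w. (1 - w) powi k * f (1 - w))"
    using analytic_reflect_powi[OF assms]
    by (intro holomorphic_on_imp_continuous_on analytic_imp_holomorphic)
  then have "continuous_on (sphere 0 \<delta>) (\<lambda>w. (1 - w) powi k * f (1 - w))"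
    by (rule continuous_on_subset) auto
  then show ?thesis using radii_pos by (auto intro!: continuous_intros)
qed

lemma pole_coeff_cong:
  assumes "\<And>u. u \<in> closed_annulus r s \<Longrightarrow> f u = g u"
  shows "pole_coeff \<delta> n f d = pole_coeff \<delta> n g d"
  unfolding pole_coeff_def
  by (rule laurent_coeff_cong) (use assms one_minus_bounds radii_pos in auto)

lemma pole_coeff_zero:
  assumes "f analytic_on closed_annulus r s"
  shows "pole_coeff \<delta> 0 f d = 0"
proof -
  have "((\<lambda>w. (1 - w) powi (int 0 - 1 - d) * f (1 - w)) has_contour_integral 0) (circlepath 0 \<delta>)"
    by (rule Cauchy_theorem_convex_simple[OF analytic_imp_holomorphic[OF analytic_reflect_powi[OF assms]]])
       (use radii_pos in auto)
  from contour_integral_unique[OF this] show ?thesis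
    by (simp add: pole_coeff_def laurent_coeff_def)
qed

text \<open>A simple pole leaves the value at 1, whatever \<open>d\<close> is. This constant later
  makes the diagonal of the pairing nonzero.\<close>

lemma pole_coeff_one:
  assumes "f analytic_on closed_annulus r s"
  shows "pole_coeff \<delta> 1 f d = f 1"
proof -
  have "((\<lambda>w. (1 - w) powi (- d) * f (1 - w) / (w - 0)) has_contour_integral
      2 * of_real pi * \<i> * ((1 - 0) powi (- d) * f (1 - 0))) (circlepath 0 \<delta>)"
    by (rule Cauchy_integral_circlepath_simple)
       (use analytic_imp_holomorphic[OF analytic_reflect_powi[OF assms]] radii_pos in auto)
  from contour_integral_unique[OF this] show ?thesis
    by (simp add: pole_coeff_def laurent_coeff_def)
qed

text \<open>In the variable \<open>w = 1 - u\<close> the factor is \<open>w / (1 - w)\<close>: it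
  cancels one order of the pole and absorbs the shift in the exponent of
  \<open>1 - w\<close>.\<close>

lemma pole_coeff_inverse_minus_one:
  "pole_coeff \<delta> (Suc n) (\<lambda>u. (inverse u - 1) * f u) d = pole_coeff \<delta> n f d"
proof -
  have "(1 - w) powi (int (Suc n) - 1 - d) * ((inverse (1 - w) - 1) * f (1 - w)) / w powi (int (Suc n) - 1 + 1)
      = (1 - w) powi (int n - 1 - d) * f (1 - w) / w powi (int n - 1 + 1)" if "cmod w = \<delta>" for w
  proof -
    note nz = one_minus_nonzero[OF that]
    have "(1 - w) powi (int (Suc n) - 1 - d) = (1 - w) powi (int n - 1 - d) * (1 - w)"
      using nz power_int_add_1[of "1 - w" "int n - 1 - d"] by (simp add: algebra_simps)
    moreover have "w powi (int (Suc n) - 1 + 1) = w powi (int n - 1 + 1) * w"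
      using nz power_int_add_1[of w "int n"] by (simp add: algebra_simps)
    moreover have "(1 - w) * (inverse (1 - w) - 1) = w" using nz by (simp add: field_simps)
    ultimately have "(1 - w) powi (int (Suc n) - 1 - d) * ((inverse (1 - w) - 1) * f (1 - w)) / w powi (int (Suc n) - 1 + 1)
      = (1 - w) powi (int n - 1 - d) * w * f (1 - w) / (w powi (int n - 1 + 1) * w)"
      by (simp only: mult.assoc) (metis mult.assoc)
    then show ?thesis using nz by simp
  qed
  from contour_integral_circlepath_cong[OF this radii_pos(2)] show ?thesis
    unfolding pole_coeff_def laurent_coeff_def by simp
qed

text \<open>Passing from \<open>d\<close> to \<open>d + 1\<close> divides the integrand by
  \<open>1 - w\<close>, so the difference of the two is \<open>w\<close> times the integrand at
  \<open>d + 1\<close>, and the order of the pole drops by one. This is why pole coefficients are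
  polynomials in \<open>d\<close>.\<close>

lemma pole_coeff_diff:
  assumes f: "f analytic_on closed_annulus r s"
  shows "pole_coeff \<delta> (Suc n) f (d + 1) - pole_coeff \<delta> (Suc n) f d = pole_coeff \<delta> n f d"
proof -
  have int: "(\<lambda>w. (1 - w) powi (int (Suc n) - 1 - k) * f (1 - w) / w powi (int (Suc n) - 1 + 1))
      contour_integrable_on circlepath 0 \<delta>" for k
    by (intro contour_integrable_circlepath_sphere continuous_reflect_powi[OF f] radii_pos)
  have "contour_integral (circlepath 0 \<delta>)
        (\<lambda>w. (1 - w) powi (int n - 1 - d) * f (1 - w) / w powi (int n - 1 + 1)) =
      contour_integral (circlepath 0 \<delta>) (\<lambda>w.
        (1 - w) powi (int (Suc n) - 1 - (d + 1)) * f (1 - w) / w powi (int (Suc n) - 1 + 1) -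
        (1 - w) powi (int (Suc n) - 1 - d) * f (1 - w) / w powi (int (Suc n) - 1 + 1))"
  proof (rule contour_integral_circlepath_cong[OF _ radii_pos(2)])
    fix w assume w: "cmod w = \<delta>"
    note nz = one_minus_nonzero[OF w]
    have "(1 - w) powi (int (Suc n) - 1 - d) = (1 - w) powi (int n - 1 - d) * (1 - w)"
      using nz power_int_add_1[of "1 - w" "int n - 1 - d"] by (simp add: algebra_simps)
    moreover have "w powi (int (Suc n) - 1 + 1) = w powi (int n - 1 + 1) * w"
      using nz power_int_add_1[of w "int n"] by (simp add: algebra_simps)
    moreover have "int (Suc n) - 1 - (d + 1) = int n - 1 - d" by simp
    ultimately show "(1 - w) powi (int n - 1 - d) * f (1 - w) / w powi (int n - 1 + 1) =
        (1 - w) powi (int (Suc n) - 1 - (d + 1)) * f (1 - w) / w powi (int (Suc n) - 1 + 1) -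
        (1 - w) powi (int (Suc n) - 1 - d) * f (1 - w) / w powi (int (Suc n) - 1 + 1)"
      using nz by (simp add: divide_simps) (simp add: algebra_simps)
  qed
  also have "\<dots> = contour_integral (circlepath 0 \<delta>) (\<lambda>w.
        (1 - w) powi (int (Suc n) - 1 - (d + 1)) * f (1 - w) / w powi (int (Suc n) - 1 + 1)) -
      contour_integral (circlepath 0 \<delta>) (\<lambda>w.
        (1 - w) powi (int (Suc n) - 1 - d) * f (1 - w) / w powi (int (Suc n) - 1 + 1))"
    by (rule contour_integral_diff[OF int int])
  finally show ?thesis
    unfolding pole_coeff_def laurent_coeff_def by (simp add: diff_divide_distrib)
qed

text \<open>Replacing \<open>d\<close> by \<open>d - j\<close> multiplies the integrand by
  \<open>(1 - w) powi j\<close>, so the sum over \<open>j\<close> rebuilds \<open>g (1 - w)\<close>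
  from its Laurent expansion.\<close>

theorem has_sum_pole_coeff:
  assumes g: "g analytic_on closed_annulus r s" and f: "f analytic_on closed_annulus r s"
  shows "((\<lambda>j. laurent_coeff r g j * pole_coeff \<delta> n f (d - j)) has_sum
           pole_coeff \<delta> n (\<lambda>u. g u * f u) d) UNIV"
proof -
  define c where "c = 2 * complex_of_real pi * \<i>"
  have c0: "c \<noteq> 0" by (simp add: c_def)
  define F where "F k w = (1 - w) powi (int n - 1 - k) * f (1 - w) / w powi (int n - 1 + 1)" for k w
  have cF: "continuous_on (sphere 0 \<delta>) (F k)" for k
    unfolding F_def by (rule continuous_reflect_powi[OF f])
  obtain C where C: "0 < C" "\<And>w. cmod w = \<delta> \<Longrightarrow> cmod (F d w) \<le> C"
    using continuous_on_bounded_sphere[OF cF] by blast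
  define h where "h j w = laurent_coeff r g j * F (d - j) w" for j w
  have h_eq: "h j w = laurent_coeff r g j * (1 - w) powi j * F d w" if "cmod w = \<delta>" for j w
  proof -
    have "(1 - w) powi (int n - 1 - (d - j)) = (1 - w) powi j * (1 - w) powi (int n - 1 - d)"
      using one_minus_nonzero[OF that] by (subst power_int_add[symmetric]) (auto simp: algebra_simps)
    then show ?thesis by (simp add: h_def F_def)
  qed
  have d01: "0 < 1 - \<delta>" using radii_pos radii_less by auto
  have "((\<lambda>j. contour_integral (circlepath 0 \<delta>) (h j)) has_sum
      contour_integral (circlepath 0 \<delta>) (\<lambda>w. g (1 - w) * F d w)) UNIV"
  proof (rule has_sum_contour_integral_circlepath[where
        M = "\<lambda>j. (cmod (laurent_coeff r g j) * (1 - \<delta>) powi j + cmod (laurent_coeff r g j) * (1 + \<delta>) powi j) * C"])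
    show "continuous_on (sphere 0 \<delta>) (h j)" for j
      unfolding h_def by (auto intro!: continuous_intros cF)
    show "cmod (h j w) \<le> (cmod (laurent_coeff r g j) * (1 - \<delta>) powi j +
        cmod (laurent_coeff r g j) * (1 + \<delta>) powi j) * C" if w: "cmod w = \<delta>" for j w
    proof -
      \<comment> \<open>On the circle \<open>cmod (1 - w)\<close> varies between
        \<open>1 - \<delta>\<close> and \<open>1 + \<delta>\<close>; negative \<open>j\<close> are
        dominated by the first end and nonnegative \<open>j\<close> by the second, hence a majorant
        containing both.\<close>
      have "cmod (1 - w) powi j \<le> (1 - \<delta>) powi j + (1 + \<delta>) powi j"
      proof (cases "j \<ge> 0")
        case True
        then have "cmod (1 - w) powi j \<le> (1 + \<delta>) powi j"
          using one_minus_bounds[of w] w by (intro power_int_mono) auto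
        then show ?thesis using d01 by (smt (verit) zero_le_power_int)
      next
        case False
        then have "cmod (1 - w) powi j \<le> (1 - \<delta>) powi j"
          using one_minus_bounds[of w] w d01 by (intro power_int_antimono) auto
        then show ?thesis using radii_pos by (smt (verit) zero_le_power_int)
      qed
      then have "cmod (laurent_coeff r g j) * cmod (1 - w) powi j * cmod (F d w) \<le>
          cmod (laurent_coeff r g j) * ((1 - \<delta>) powi j + (1 + \<delta>) powi j) * C"
        using C(2)[OF w] d01 radii_pos by (intro mult_mono mult_nonneg_nonneg add_nonneg_nonneg zero_le_power_int) auto
      then show ?thesis
        unfolding h_eq[OF w] norm_mult norm_power_int by (simp add: algebra_simps)
    qed
    show "(\<lambda>j. (cmod (laurent_coeff r g j) * (1 - \<delta>) powi j +
        cmod (laurent_coeff r g j) * (1 + \<delta>) powi j) * C) summable_on UNIV"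
      using radii_pos radii_less
      by (intro summable_on_cmult_left summable_on_add laurent_coeff_abs_summable[OF g]) auto
    show "((\<lambda>j. h j w) has_sum g (1 - w) * F d w) UNIV" if w: "cmod w = \<delta>" for w
      unfolding h_eq[OF w]
      by (intro has_sum_cmult_left laurent_expansion_closed_annulus[OF g])
         (use w one_minus_bounds[of w] radii_pos in auto)
  qed (use radii_pos in auto)
  moreover have "contour_integral (circlepath 0 \<delta>) (h j) =
      c * (laurent_coeff r g j * pole_coeff \<delta> n f (d - j))" for j
  proof -
    have "contour_integral (circlepath 0 \<delta>) (h j) =
        laurent_coeff r g j * contour_integral (circlepath 0 \<delta>) (F (d - j))"
      unfolding h_def
      by (rule contour_integral_lmul; rule contour_integrable_circlepath_sphere[OF radii_pos(2) cF])
    then show ?thesis using c0 by (simp add: pole_coeff_def laurent_coeff_def F_def[abs_def] c_def)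
  qed
  moreover have "contour_integral (circlepath 0 \<delta>) (\<lambda>w. g (1 - w) * F d w) =
      c * pole_coeff \<delta> n (\<lambda>u. g u * f u) d"
    using c0 by (simp add: pole_coeff_def laurent_coeff_def F_def c_def algebra_simps)
  ultimately show ?thesis using has_sum_cmult_cancel[OF c0] by simp
qed

end

section \<open>Polynomiality of pole coefficients, by discrete differences\<close>

lemma int_function_eqI:
  fixes F G :: "int \<Rightarrow> 'a :: ab_group_add"
  assumes diff: "\<And>d. F (d + 1) - F d = G (d + 1) - G d" and e: "F e = G e"
  shows "F d = G d"
proof (induction d rule: int_induct[of _ e])
  case (step1 i)
  have "F (i + 1) = (F (i + 1) - F i) + F i" by simp
  also have "\<dots> = G (i + 1)" unfolding diff using step1 by simp
  finally show ?case .
next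
  case (step2 i)
  have "F (i - 1) = F i - (F (i - 1 + 1) - F (i - 1))" by simp
  also have "\<dots> = G (i - 1)" unfolding diff using step2 by simp
  finally show ?case .
qed (rule e)

lemma gchoose_polynomial:
  "\<exists>p :: complex poly. degree p = k \<and> p \<noteq> 0 \<and> (\<forall>x. poly p x = x gchoose k)"
proof (intro exI conjI allI)
  define P where "P = (\<Prod>i=0..<k. [:- of_nat i, 1 :: complex:])"
  have P0: "P \<noteq> 0" unfolding P_def by (subst prod_zero_iff) auto
  have dP: "degree P = k" unfolding P_def by (subst degree_prod_eq_sum_degree) auto
  show "degree (smult (1 / fact k) P) = k" using dP by simp
  show "smult (1 / fact k) P \<noteq> 0" using P0 by simp
  show "poly (smult (1 / fact k) P) x = x gchoose k" for x
    unfolding P_def gbinomial_prod_rev by (simp add: poly_prod algebra_simps)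
qed

context pole_annulus
begin

text \<open>Newton's forward difference formula at 0: by \<open>pole_coeff_diff\<close> the
  \<open>i\<close>-th difference in \<open>d\<close> is the pole coefficient of order
  \<open>n - i\<close>.\<close>

lemma pole_coeff_newton:
  assumes f: "f analytic_on closed_annulus r s"
  shows "pole_coeff \<delta> n f d = (\<Sum>i<n. pole_coeff \<delta> (n - i) f 0 * (of_int d gchoose i))"
proof (induction n arbitrary: d)
  case 0
  then show ?case using pole_coeff_zero[OF f] by simp
next
  case (Suc n)
  define G where "G d = (\<Sum>i<Suc n. pole_coeff \<delta> (Suc n - i) f 0 * (of_int d gchoose i))" for d
  have "G (d + 1) - G d = pole_coeff \<delta> n f d" for d
  proof -
    have "G (d + 1) - G d =
        (\<Sum>i<n. pole_coeff \<delta> (n - i) f 0 * ((of_int d + 1 gchoose Suc i) - (of_int d gchoose Suc i)))"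
      unfolding G_def sum.lessThan_Suc_shift by (simp add: sum_subtractf[symmetric] right_diff_distrib)
    also have "\<dots> = (\<Sum>i<n. pole_coeff \<delta> (n - i) f 0 * (of_int d gchoose i))"
      by (simp add: gbinomial_Suc_Suc)
    finally show ?thesis using Suc by simp
  qed
  then have "pole_coeff \<delta> (Suc n) f (d + 1) - pole_coeff \<delta> (Suc n) f d = G (d + 1) - G d" for d
    using pole_coeff_diff[OF f] by simp
  moreover have "pole_coeff \<delta> (Suc n) f 0 = G 0"
    unfolding G_def sum.lessThan_Suc_shift by (simp add: gbinomial_0_left)
  ultimately have "pole_coeff \<delta> (Suc n) f d = G d"
    by (rule int_function_eqI)
  then show ?case unfolding G_def .
qed

lemma pole_coeff_polynomial:
  assumes f: "f analytic_on closed_annulus r s" and n: "0 < n"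
  shows "\<exists>p. degree p < n \<and> (\<forall>d. pole_coeff \<delta> n f d = poly p (of_int d))"
proof -
  obtain b :: "nat \<Rightarrow> complex poly" where b: "\<And>k. degree (b k) = k" "\<And>k x. poly (b k) x = x gchoose k"
    using gchoose_polynomial by metis
  define p where "p = (\<Sum>i<n. smult (pole_coeff \<delta> (n - i) f 0) (b i))"
  have "degree (smult (pole_coeff \<delta> (n - i) f 0) (b i)) \<le> n - 1" if "i < n" for i
    using degree_smult_le[of "pole_coeff \<delta> (n - i) f 0" "b i"] b that by simp
  then have "degree p \<le> n - 1"
    unfolding p_def by (intro degree_sum_le) auto
  then have "degree p < n" using n by linarith
  moreover have "pole_coeff \<delta> n f d = poly p (of_int d)" for d
    unfolding p_def by (subst pole_coeff_newton[OF f]) (simp add: poly_sum b)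
  ultimately show ?thesis by blast
qed

text \<open>A polynomial has no coefficients beyond its degree. This supplies the initial value in
  \<open>pole_coeff_gchoose\<close>.\<close>

lemma laurent_coeff_power_one_minus:
  assumes "int m < k"
  shows "laurent_coeff \<delta> (\<lambda>w. (1 - w) ^ m) k = 0"
  using assms
proof (induction m arbitrary: k)
  case 0
  define n where "n = nat k"
  have k: "k = int n" and n: "n \<noteq> 0" using 0 by (auto simp: n_def)
  have "((\<lambda>u. 1 / u ^ (Suc n)) has_contour_integral 0) (circlepath 0 \<delta>)"
    using Cauchy_has_contour_integral_higher_derivative_circlepath[of 0 \<delta> "\<lambda>_. 1" 0 n] n radii_pos
    by simp
  moreover have "u powi (k + 1) = u ^ Suc n" for u :: complex
    unfolding k using power_int_of_nat[of u "Suc n"] by (simp add: add.commute)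
  ultimately show ?case
    by (simp add: laurent_coeff_def contour_integral_unique)
next
  case (Suc m)
  have int: "(\<lambda>w. (1 - w) ^ m / w powi j) contour_integrable_on circlepath 0 \<delta>" for j
    by (rule contour_integrable_circlepath_sphere) (use radii_pos in \<open>auto intro!: continuous_intros\<close>)
  have "contour_integral (circlepath 0 \<delta>) (\<lambda>w. (1 - w) ^ Suc m / w powi (k + 1)) =
      contour_integral (circlepath 0 \<delta>) (\<lambda>w. (1 - w) ^ m / w powi (k + 1) - (1 - w) ^ m / w powi k)"
    by (rule contour_integral_circlepath_cong[OF _ radii_pos(2)])
       (use radii_pos in \<open>auto simp: power_int_add divide_simps algebra_simps\<close>)
  also have "\<dots> = contour_integral (circlepath 0 \<delta>) (\<lambda>w. (1 - w) ^ m / w powi (k + 1)) -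
      contour_integral (circlepath 0 \<delta>) (\<lambda>w. (1 - w) ^ m / w powi k)"
    by (rule contour_integral_diff[OF int int])
  finally have "laurent_coeff \<delta> (\<lambda>w. (1 - w) ^ Suc m) k =
      laurent_coeff \<delta> (\<lambda>w. (1 - w) ^ m) k - laurent_coeff \<delta> (\<lambda>w. (1 - w) ^ m) (k - 1)"
    by (simp add: laurent_coeff_def diff_divide_distrib)
  also have "\<dots> = 0" using Suc.IH[of k] Suc.IH[of "k - 1"] Suc.prems by simp
  finally show ?case .
qed

lemma pole_coeff_gchoose: "pole_coeff \<delta> (Suc n) (\<lambda>_. 1) d = of_int (d - 1) gchoose n"
proof (induction n arbitrary: d)
  case 0
  then show ?case using pole_coeff_one[of "\<lambda>_. 1" d] by simp
next
  case (Suc n)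
  have diff: "(of_int (d + 1 - 1) gchoose Suc n) - (of_int (d - 1) gchoose Suc n) =
      (of_int (d - 1) gchoose n :: complex)" for d
    using gbinomial_Suc_Suc[of "of_int (d - 1) :: complex" n] by simp
  show ?case
  proof (rule int_function_eqI[where F = "pole_coeff \<delta> (Suc (Suc n)) (\<lambda>_. 1)"
        and G = "\<lambda>d. of_int (d - 1) gchoose Suc n" and e = 1])
    show "pole_coeff \<delta> (Suc (Suc n)) (\<lambda>_. 1) (d + 1) - pole_coeff \<delta> (Suc (Suc n)) (\<lambda>_. 1) d =
        (of_int (d + 1 - 1) gchoose Suc n) - (of_int (d - 1) gchoose Suc n)" for d
      unfolding diff using pole_coeff_diff[of "\<lambda>_. 1" "Suc n" d] Suc by simp
    \<comment> \<open>The base point is \<open>d = 1\<close> because the exponent of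
      \<open>1 - w\<close> is then exactly \<open>n\<close>, one less than the index of the
      coefficient that is extracted.\<close>
    have "pole_coeff \<delta> (Suc (Suc n)) (\<lambda>_. 1) 1 = laurent_coeff \<delta> (\<lambda>w. (1 - w) ^ n) (int (Suc n))"
      by (simp add: pole_coeff_def algebra_simps)
    also have "\<dots> = 0" by (rule laurent_coeff_power_one_minus) simp
    finally show "pole_coeff \<delta> (Suc (Suc n)) (\<lambda>_. 1) 1 = of_int (1 - 1) gchoose Suc n"
      by simp
  qed
qed

text \<open>On the circle \<open>cmod (1 - w) \<ge> 1 - \<delta> \<ge> \<theta>\<close>, so raising
  \<open>d\<close> from \<open>d0\<close> costs at most a factor
  \<open>\<theta> powi (d0 - d)\<close>, which the weight compensates. Towards minus infinity the
  weight explodes, hence the half-line.\<close>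

lemma pole_coeff_bounded:
  assumes f: "f analytic_on closed_annulus r s" and \<theta>: "0 < \<theta>" "\<theta> \<le> 1 - \<delta>"
  shows "\<exists>C. \<forall>d\<ge>d0. cmod (of_real \<theta> powi d * pole_coeff \<delta> n f d) \<le> C"
proof -
  define F where "F d w = (1 - w) powi (int n - 1 - d) * f (1 - w) / w powi (int n - 1 + 1)" for d w
  have cF: "continuous_on (sphere 0 \<delta>) (F d)" for d
    unfolding F_def by (rule continuous_reflect_powi[OF f])
  obtain C where C: "0 < C" "\<And>w. cmod w = \<delta> \<Longrightarrow> cmod (F d0 w) \<le> C"
    using continuous_on_bounded_sphere[OF cF] by blast
  have bd: "cmod (F d w) \<le> C / \<theta> powi (d - d0)" if "d \<ge> d0" "cmod w = \<delta>" for d w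
  proof -
    have "(1 - w) powi (int n - 1 - d0) = (1 - w) powi (int n - 1 - d) * (1 - w) powi (d - d0)"
      using one_minus_nonzero[OF that(2)] power_int_add[of "1 - w" "int n - 1 - d" "d - d0"]
      by (simp add: algebra_simps)
    then have "F d0 w = F d w * (1 - w) powi (d - d0)" by (simp add: F_def)
    then have 1: "cmod (F d w) * cmod (1 - w) powi (d - d0) \<le> C"
      using C(2)[OF that(2)] by (simp add: norm_mult norm_power_int)
    have "\<theta> powi (d - d0) \<le> cmod (1 - w) powi (d - d0)"
      using \<theta> one_minus_bounds[of w] that by (intro power_int_mono) auto
    then have "cmod (F d w) * \<theta> powi (d - d0) \<le> cmod (F d w) * cmod (1 - w) powi (d - d0)"
      by (intro mult_left_mono) auto
    with 1 have "cmod (F d w) * \<theta> powi (d - d0) \<le> C" by simp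
    then show ?thesis using \<theta> by (simp add: pos_le_divide_eq)
  qed
  have "cmod (of_real \<theta> powi d * pole_coeff \<delta> n f d) \<le> \<theta> powi d0 * (C * \<delta>)" if d: "d \<ge> d0" for d
  proof -
    have int: "F d contour_integrable_on circlepath 0 \<delta>"
      by (intro contour_integrable_circlepath_sphere cF radii_pos)
    have "cmod (contour_integral (circlepath 0 \<delta>) (F d)) \<le> C / \<theta> powi (d - d0) * (2 * pi * \<delta>)"
      by (rule has_contour_integral_bound_circlepath[OF has_contour_integral_integral[OF int]])
         (use bd[OF d] radii_pos C \<theta> in auto)
    then have "cmod (contour_integral (circlepath 0 \<delta>) (F d)) / (2 * pi)
        \<le> C / \<theta> powi (d - d0) * (2 * pi * \<delta>) / (2 * pi)"
      by (intro divide_right_mono) auto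
    then have "cmod (pole_coeff \<delta> n f d) \<le> C / \<theta> powi (d - d0) * \<delta>"
      unfolding pole_coeff_def laurent_coeff_def F_def[abs_def] norm_divide norm_mult by simp
    then have "\<theta> powi d * cmod (pole_coeff \<delta> n f d) \<le> \<theta> powi d * (C / \<theta> powi (d - d0) * \<delta>)"
      using \<theta> by (intro mult_left_mono) auto
    also have "\<dots> = \<theta> powi d0 * (C * \<delta>)"
      using \<theta> by (simp add: power_int_diff)
    finally show ?thesis using \<theta> by (simp add: norm_mult norm_power_int)
  qed
  then show ?thesis by blast
qed

lemma pole_coeff_inverse_minus_one_power:
  "pole_coeff \<delta> (n + l) (\<lambda>u. (inverse u - 1) ^ l * f u) d = pole_coeff \<delta> n f d"
proof (induction l)
  case (Suc l)
  have "(\<lambda>u. (inverse u - 1) ^ Suc l * f u) = (\<lambda>u. (inverse u - 1) * ((inverse u - 1) ^ l * f u))"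
    by (simp add: mult.assoc)
  then show ?case using pole_coeff_inverse_minus_one[of "n + l"] Suc by simp
qed simp

end

subsection \<open>Biorthogonal systems\<close>

text \<open>Elimination of the leading term against a basis with one member in each degree. The base
  case is asked only for \<open>m \<le> degree p\<close>, so that claims confined to low degrees are
  covered.\<close>

lemma poly_triangular_induct:
  fixes b :: "nat \<Rightarrow> complex poly"
  assumes b: "\<And>m. degree (b m) = m" "\<And>m. b m \<noteq> 0"
    and base: "\<And>m. m \<le> degree p \<Longrightarrow> P (b m)"
    and add: "\<And>p q. P p \<Longrightarrow> P q \<Longrightarrow> P (p + q)"
    and smult: "\<And>c p. P p \<Longrightarrow> P (smult c p)"
  shows "P p"
  using base
proof (induction "degree p" arbitrary: p rule: less_induct)
  case less
  define m c where "m = degree p" and "c = lead_coeff p / lead_coeff (b m)"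
  define p' where "p' = p - smult c (b m)"
  have Pb: "P (smult c (b m))" using less(2) m_def smult by simp
  have "degree (smult c (b m)) \<le> m" using degree_smult_le[of c "b m"] b by simp
  then have d: "degree p' \<le> m" unfolding p'_def by (intro degree_diff_le) (auto simp: m_def)
  have "coeff (b m) m \<noteq> 0" using b(1)[of m] b(2)[of m] by (metis leading_coeff_0_iff)
  then have "coeff p' m = 0" using b(1)[of m] by (simp add: p'_def c_def m_def)
  then have cases: "p' = 0 \<or> degree p' < m" using d
    by (metis le_neq_implies_less leading_coeff_0_iff)
  have "P p'"
  proof (cases "p' = 0")
    \<comment> \<open>The zero polynomial has degree 0, so for a constant \<open>p\<close> the
      remainder is of no smaller degree; it is reached as the zero multiple of \<open>b m\<close>
      instead.\<close>
    case True
    then show ?thesis using smult[of "b m" 0] less(2)[of m] m_def by simp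
  next
    case False
    then have "degree p' < degree p" using cases m_def by simp
    then show ?thesis using less by simp
  qed
  then have "P (p' + smult c (b m))" by (rule add[OF _ Pb])
  then show ?case by (simp add: p'_def)
qed

text \<open>The linear algebra behind the \<open>Phi\<close>: the matrix of the numbers
  \<open>S l (b m)\<close> is triangular with nonzero diagonal. Only \<open>l < N\<close> is
  constrained, matching the range of a biorthogonal family.\<close>

locale triangular_functionals =
  fixes S :: "nat \<Rightarrow> complex poly \<Rightarrow> complex" and b :: "nat \<Rightarrow> complex poly" and N :: nat
  assumes S_add: "l < N \<Longrightarrow> S l (p + q) = S l p + S l q"
    and S_smult: "l < N \<Longrightarrow> S l (smult c p) = c * S l p"
    and b: "degree (b m) = m" "b m \<noteq> 0"
    and S_lower: "l < N \<Longrightarrow> m < l \<Longrightarrow> S l (b m) = 0"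
    and S_diag: "l < N \<Longrightarrow> S l (b l) \<noteq> 0"
begin

lemma S_diff: "l < N \<Longrightarrow> S l (p - q) = S l p - S l q"
  using S_add[of l p "smult (- 1) q"] S_smult[of l "- 1" q] by simp

lemma S_sum: "l < N \<Longrightarrow> S l (\<Sum>i\<in>A. p i) = (\<Sum>i\<in>A. S l (p i))"
  using S_smult[of l 0 0] by (induction A rule: infinite_finite_induct) (auto simp: S_add)

lemma S_degree_less:
  assumes "l < N" "degree p < l"
  shows "S l p = 0"
  by (rule poly_triangular_induct[where b = b and P = "\<lambda>p. S l p = 0", OF b])
     (use assms in \<open>auto simp: S_lower S_add S_smult\<close>)

lemma S_degree_eq:
  assumes "l < N" "p \<noteq> 0" "degree p = l"
  shows "S l p \<noteq> 0"
proof (cases "l = 0")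
  \<comment> \<open>Constants are treated directly, since no degree lies below 0 to express that the
    leading term has been removed.\<close>
  case True
  obtain c where c: "b 0 = [:c:]" using b(1)[of 0] degree_eq_zeroE by blast
  obtain d where d: "p = [:d:]" using True assms(3) degree_eq_zeroE by blast
  have "p = smult (d / c) (b 0)" using c d b(2)[of 0] by simp
  moreover have "d \<noteq> 0" "c \<noteq> 0" using c d b(2)[of 0] assms(2) by auto
  ultimately show ?thesis using True assms(1) S_smult S_diag[of 0] by simp
next
  case False
  define c where "c = lead_coeff p / lead_coeff (b l)"
  have c: "c \<noteq> 0" using assms(2) b(2) by (simp add: c_def)
  define p' where "p' = p - smult c (b l)"
  have "degree (smult c (b l)) \<le> l" using degree_smult_le[of c "b l"] b by simp
  then have d: "degree p' \<le> l" unfolding p'_def by (intro degree_diff_le) (auto simp: assms)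
  have "coeff (b l) l \<noteq> 0" using b(1)[of l] b(2)[of l] by (metis leading_coeff_0_iff)
  then have "coeff p' l = 0" using b(1)[of l] assms(3) by (simp add: p'_def c_def)
  then have "degree p' < l" using d False
    by (metis degree_0 gr0I le_neq_implies_less leading_coeff_0_iff)
  then have "S l p' = 0" using S_degree_less assms by simp
  moreover have "S l p = S l p' + c * S l (b l)"
    unfolding p'_def using assms by (simp add: S_diff S_smult)
  ultimately show ?thesis using c S_diag assms by simp
qed

lemma eq_0_if_functionals_0:
  assumes "degree p < N" "\<And>l. l < N \<Longrightarrow> S l p = 0"
  shows "p = 0"
  using S_degree_eq[of "degree p" p] assms by auto

text \<open>Back substitution from the top: \<open>S n\<close> alone determines the coefficient of
  \<open>b n\<close>, and the correction of lower degree supplied by induction is invisible to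
  \<open>S n\<close>.\<close>

lemma solve_functionals:
  assumes "n \<le> N" "0 < n"
  shows "\<exists>p. degree p < n \<and> (\<forall>l<n. S l p = v l)"
  using assms
proof (induction n arbitrary: v)
  case (Suc n)
  have nN: "n < N" using Suc by simp
  define p0 where "p0 = smult (v n / S n (b n)) (b n)"
  have d0: "degree p0 \<le> n" using degree_smult_le[of _ "b n"] b unfolding p0_def by metis
  have S0: "S n p0 = v n" using S_smult[OF nN] S_diag[OF nN] by (simp add: p0_def)
  show ?case
  proof (cases "n = 0")
    case True
    then show ?thesis using d0 S0 by (intro exI[of _ p0]) auto
  next
    case False
    then obtain p1 where p1: "degree p1 < n" "\<forall>l<n. S l p1 = v l - S l p0"
      using Suc.IH[of "\<lambda>l. v l - S l p0"] Suc.prems by auto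
    have "S l (p0 + p1) = v l" if "l < Suc n" for l
    proof (cases "l = n")
      case True
      then show ?thesis using S_degree_less[OF nN p1(1)] S0 S_add[OF nN] by simp
    next
      case False
      then show ?thesis using p1 that nN S_add[of l] by simp
    qed
    moreover have "degree (p0 + p1) < Suc n" using d0 p1(1) by (intro degree_add_less) auto
    ultimately show ?thesis by blast
  qed
qed simp

lemma dual_basis:
  "\<exists>\<phi>. \<forall>k<N. degree (\<phi> k) = k \<and> (\<forall>l<N. S l (\<phi> k) = (if l = k then 1 else 0))"
proof -
  have "\<exists>p. degree p = k \<and> (\<forall>l<N. S l p = (if l = k then 1 else 0))" if k: "k < N" for k
  proof -
    obtain p where p: "degree p < Suc k" "\<forall>l<Suc k. S l p = (if l = k then 1 else 0)"
      using solve_functionals[of "Suc k" "\<lambda>l. if l = k then 1 else 0"] k by auto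
    \<comment> \<open>A polynomial of smaller degree would be annihilated by \<open>S k\<close>,
      against the prescribed value 1. The degree is thus exactly \<open>k\<close>, and all
      functionals above \<open>k\<close> vanish on \<open>p\<close>.\<close>
    have "\<not> degree p < k" using S_degree_less[OF k] p by fastforce
    then have "degree p = k" using p by simp
    moreover have "S l p = (if l = k then 1 else 0)" if "l < N" for l
      using p S_degree_less[OF that, of p] \<open>degree p = k\<close> by (cases "l \<le> k") auto
    ultimately show ?thesis by blast
  qed
  then show ?thesis by metis
qed

end

subsection \<open>Random walks and their stopped values\<close>

text \<open>Law of the first \<open>n\<close> positions, the start included, so a path of positive
  length \<open>n\<close> records \<open>n - 1\<close> steps: exactly the values that the stopping
  rule with horizon \<open>n\<close> inspects.\<close>

primrec path_pmf :: "('a \<Rightarrow> 'a pmf) \<Rightarrow> nat \<Rightarrow> 'a \<Rightarrow> 'a list pmf" where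
  "path_pmf K 0 z = return_pmf []"
| "path_pmf K (Suc n) z = map_pmf ((#) z) (bind_pmf (K z) (path_pmf K n))"

lemma pmf_path_pmf:
  "pmf (path_pmf K n z) bs =
     (if length bs = n \<and> (n > 0 \<longrightarrow> bs ! 0 = z) then \<Prod>i<n-1. pmf (K (bs ! i)) (bs ! Suc i) else 0)"
proof (induction n arbitrary: z bs)
  case 0
  then show ?case by simp
next
  case (Suc n)
  show ?case
  proof (cases bs)
    case Nil
    then have "bs \<notin> set_pmf (path_pmf K (Suc n) z)" by auto
    then have "pmf (path_pmf K (Suc n) z) bs = 0" by (simp add: set_pmf_eq)
    then show ?thesis using Nil by simp
  next
    case (Cons b cs)
    show ?thesis
    proof (cases "b = z")
      case False
      then have "bs \<notin> set_pmf (path_pmf K (Suc n) z)" using Cons by auto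
      then have "pmf (path_pmf K (Suc n) z) bs = 0" by (simp add: set_pmf_eq)
      then show ?thesis using Cons False by simp
    next
      case True
      have "pmf (path_pmf K (Suc n) z) bs = pmf (bind_pmf (K z) (path_pmf K n)) cs"
        using Cons True by (simp add: pmf_map_inj')
      also have "\<dots> = measure_pmf.expectation (K z) (\<lambda>c. pmf (path_pmf K n c) cs)"
        by (rule pmf_bind)
      also have "\<dots> = (if length cs = n then \<Prod>i<n. pmf (K (bs ! i)) (bs ! Suc i) else 0)"
      proof (cases n)
        case 0
        then show ?thesis by auto
      next
        case n: (Suc m)
        show ?thesis
        proof (cases "length cs = n")
          case True
          define C where "C = (\<Prod>i<m. pmf (K (cs ! i)) (cs ! Suc i))"
          \<comment> \<open>The path law charges \<open>cs\<close> only when started from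
            \<open>cs ! 0\<close>, so the expectation over the first step collapses to a single
            atom.\<close>
          have "pmf (path_pmf K n c) cs = C * indicator {cs ! 0} c" for c
            unfolding Suc.IH using True n by (auto simp: C_def indicator_def)
          then have "measure_pmf.expectation (K z) (\<lambda>c. pmf (path_pmf K n c) cs) =
              C * pmf (K z) (cs ! 0)"
            by (simp add: measure_pmf_single)
          also have "\<dots> = (\<Prod>i<n. pmf (K (bs ! i)) (bs ! Suc i))"
            unfolding n prod.lessThan_Suc_shift using Cons \<open>b = z\<close> by (simp add: C_def)
          finally show ?thesis using True by simp
        next
          case False
          then show ?thesis by (simp add: Suc.IH)
        qed
      qed
      finally show ?thesis using Cons True by simp
    qed
  qed
qed

lemma random_walk_cylinder:
  assumes "random_walk_from Q z M B"
  shows "measure M {\<omega> \<in> space M. \<forall>i\<le>m. B i \<omega> = b i} =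
    (if b 0 = z then \<Prod>i<m. Q (b i) (b (Suc i)) else 0)"
proof (induction m)
  case 0
  interpret prob_space M using assms by (simp add: random_walk_from_def)
  have [measurable]: "B m \<in> measurable M (count_space UNIV)" for m
    using assms by (simp add: random_walk_from_def)
  have ae: "AE \<omega> in M. B 0 \<omega> = z" using assms by (simp add: random_walk_from_def)
  have "prob {\<omega> \<in> space M. B 0 \<omega> = b 0} = (if b 0 = z then 1 else 0)"
  proof (cases "b 0 = z")
    case True
    then show ?thesis using ae by (simp add: prob_eq_1)
  next
    case False
    then show ?thesis using ae by (auto simp: prob_eq_0 elim: AE_mp)
  qed
  then show ?case by simp
next
  case (Suc m)
  then show ?case using assms by (simp add: random_walk_from_def)
qed

lemma measurable_path:
  fixes B :: "nat \<Rightarrow> 'w \<Rightarrow> 'a :: countable"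
  assumes [measurable]: "\<And>m. B m \<in> measurable M (count_space UNIV)"
  shows "(\<lambda>\<omega>. map (\<lambda>i. B i \<omega>) [0..<n]) \<in> measurable M (count_space UNIV)"
proof (subst measurable_count_space_eq_countable)
  have "{\<omega> \<in> space M. map (\<lambda>i. B i \<omega>) [0..<n] = bs} \<in> sets M" for bs
  proof (cases "length bs = n")
    case True
    then have "{\<omega> \<in> space M. map (\<lambda>i. B i \<omega>) [0..<n] = bs} = {\<omega> \<in> space M. \<forall>i<n. B i \<omega> = bs ! i}"
      by (auto simp: list_eq_iff_nth_eq)
    also have "\<dots> \<in> sets M" by measurable
    finally show ?thesis .
  next
    case False
    then have "{\<omega> \<in> space M. map (\<lambda>i. B i \<omega>) [0..<n] = bs} = {}" by auto
    from this show ?thesis by (simp only: sets.empty_sets)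
  qed
  moreover have "(\<lambda>\<omega>. map (\<lambda>i. B i \<omega>) [0..<n]) -` {bs} \<inter> space M =
      {\<omega> \<in> space M. map (\<lambda>i. B i \<omega>) [0..<n] = bs}" for bs
    by auto
  ultimately show "(\<lambda>\<omega>. map (\<lambda>i. B i \<omega>) [0..<n]) \<in> space M \<rightarrow> UNIV \<and>
      (\<forall>bs\<in>UNIV. (\<lambda>\<omega>. map (\<lambda>i. B i \<omega>) [0..<n]) -` {bs} \<inter> space M \<in> sets M)"
    by simp
qed auto

text \<open>The cylinder probabilities determine the joint law of the first \<open>n\<close>
  positions, so every realisation of the chain can be replaced by the concrete path law.\<close>

lemma random_walk_path_distr:
  assumes walk: "random_walk_from Q z M B" and Q: "\<And>x y. Q x y = pmf (K x) y"
  shows "distr M (count_space UNIV) (\<lambda>\<omega>. map (\<lambda>i. B i \<omega>) [0..<n]) = measure_pmf (path_pmf K n z)"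
proof (rule measure_eqI_countable[where A = UNIV])
  interpret prob_space M using walk by (simp add: random_walk_from_def)
  have meas: "(\<lambda>\<omega>. map (\<lambda>i. B i \<omega>) [0..<n]) \<in> measurable M (count_space UNIV)"
    by (rule measurable_path) (use walk in \<open>simp add: random_walk_from_def\<close>)
  fix bs :: "int list"
  have "emeasure (distr M (count_space UNIV) (\<lambda>\<omega>. map (\<lambda>i. B i \<omega>) [0..<n])) {bs} =
      emeasure M {\<omega> \<in> space M. map (\<lambda>i. B i \<omega>) [0..<n] = bs}"
    by (subst emeasure_distr[OF meas]) (auto intro!: arg_cong[where f = "emeasure M"])
  also have "\<dots> = ennreal (prob {\<omega> \<in> space M. map (\<lambda>i. B i \<omega>) [0..<n] = bs})"
    by (rule emeasure_eq_measure)
  also have "prob {\<omega> \<in> space M. map (\<lambda>i. B i \<omega>) [0..<n] = bs} = pmf (path_pmf K n z) bs"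
  proof (cases "length bs = n")
    case False
    then have "{\<omega> \<in> space M. map (\<lambda>i. B i \<omega>) [0..<n] = bs} = {}" by auto
    then show ?thesis using False by (simp only: pmf_path_pmf) simp
  next
    case True
    then have eq: "{\<omega> \<in> space M. map (\<lambda>i. B i \<omega>) [0..<n] = bs} =
        {\<omega> \<in> space M. \<forall>i<n. B i \<omega> = bs ! i}"
      by (auto simp: list_eq_iff_nth_eq)
    show ?thesis
    proof (cases n)
      case 0
      then show ?thesis using True by (simp add: prob_space)
    next
      case (Suc m)
      have "prob {\<omega> \<in> space M. \<forall>i<n. B i \<omega> = bs ! i} = prob {\<omega> \<in> space M. \<forall>i\<le>m. B i \<omega> = bs ! i}"
        by (simp add: Suc less_Suc_eq_le)
      then show ?thesis
        unfolding eq pmf_path_pmf using random_walk_cylinder[OF walk, of m "(!) bs"] True Suc Q by simp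
    qed
  qed
  finally show "emeasure (distr M (count_space UNIV) (\<lambda>\<omega>. map (\<lambda>i. B i \<omega>) [0..<n])) {bs} =
      emeasure (measure_pmf (path_pmf K n z)) {bs}"
    by (simp add: emeasure_pmf_single)
qed auto

text \<open>Translates expectations into the unordered sums in which kernel composition is phrased;
  boundedness provides the absolute summability.\<close>

lemma has_sum_expectation_pmf:
  fixes h :: "'a \<Rightarrow> complex"
  assumes "\<And>x. cmod (h x) \<le> C"
  shows "((\<lambda>x. of_real (pmf p x) * h x) has_sum measure_pmf.expectation p h) UNIV"
proof -
  have "integrable (measure_pmf p) h"
    using assms by (intro measure_pmf.integrable_const_bound[where B = C]) auto
  then have "integrable (count_space UNIV) (\<lambda>x. pmf p x *\<^sub>R h x)"
    unfolding measure_pmf_eq_density by (subst (asm) integrable_density) auto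
  then have abs: "Infinite_Set_Sum.abs_summable_on (\<lambda>x. of_real (pmf p x) * h x) UNIV"
    unfolding Infinite_Set_Sum.abs_summable_on_def by (simp add: scaleR_conv_of_real)
  have "measure_pmf.expectation p h = infsetsum (\<lambda>x. of_real (pmf p x) * h x) UNIV"
    unfolding infsetsum_def measure_pmf_eq_density
    by (subst integral_density) (auto simp: scaleR_conv_of_real)
  also have "\<dots> = infsum (\<lambda>x. of_real (pmf p x) * h x) UNIV"
    by (rule infsetsum_infsum[OF abs])
  finally show ?thesis
    using abs abs_summable_equivalent abs_summable_summable has_sum_infsum by metis
qed

lemma norm_expectation_pmf_le:
  fixes h :: "'a \<Rightarrow> complex"
  assumes "\<And>x. cmod (h x) \<le> C"
  shows "cmod (measure_pmf.expectation p h) \<le> C"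
proof -
  have "cmod (measure_pmf.expectation p h) \<le> measure_pmf.expectation p (\<lambda>x. cmod (h x))"
    by (rule integral_norm_bound)
  also have "\<dots> \<le> C"
    using assms
    by (intro measure_pmf.integral_le_const measure_pmf.integrable_const_bound[where B = C]) auto
  finally show ?thesis .
qed

lemma expectation_bind_pmf:
  fixes g :: "'b \<Rightarrow> complex"
  assumes g: "\<And>x. cmod (g x) \<le> C"
  shows "measure_pmf.expectation (bind_pmf p f) g =
    measure_pmf.expectation p (\<lambda>x. measure_pmf.expectation (f x) g)"
proof -
  \<comment> \<open>The tower property is obtained for bounded real functions and then applied to
    the real and imaginary parts of \<open>g\<close>.\<close>
  have real: "measure_pmf.expectation (bind_pmf p f) h =
      measure_pmf.expectation p (\<lambda>x. measure_pmf.expectation (f x) h)"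
    if "\<And>x. \<bar>h x\<bar> \<le> C" for h :: "'b \<Rightarrow> real"
    unfolding measure_pmf_bind
    by (rule integral_bind[where B = C and B' = 1 and K = "count_space UNIV"])
       (use that in \<open>auto simp: measure_pmf.finite_measure measure_pmf.emeasure_space_1
          space_subprob_algebra measure_pmf.subprob_space_axioms\<close>)
  have int: "integrable (measure_pmf M) g" for M
    using g by (intro measure_pmf.integrable_const_bound[where B = C]) auto
  have int': "integrable (measure_pmf p) (\<lambda>x. measure_pmf.expectation (f x) g)"
    using norm_expectation_pmf_le[of g C] g
    by (intro measure_pmf.integrable_const_bound[where B = C]) auto
  have re: "\<bar>Re (g x)\<bar> \<le> C" and im: "\<bar>Im (g x)\<bar> \<le> C" for x
    using abs_Re_le_cmod[of "g x"] abs_Im_le_cmod[of "g x"] g[of x] by linarith+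
  show ?thesis
    using real[of "\<lambda>x. Re (g x)"] real[of "\<lambda>x. Im (g x)"] re im
    by (intro complex_eqI) (simp_all add: integral_Re[OF int] integral_Im[OF int]
        integral_Re[OF int'] integral_Im[OF int'])
qed

lemma expectation_path_pmf_Suc:
  fixes g :: "'a list \<Rightarrow> complex"
  assumes "\<And>bs. cmod (g bs) \<le> C"
  shows "measure_pmf.expectation (path_pmf K (Suc n) z) g =
    measure_pmf.expectation (K z) (\<lambda>c. measure_pmf.expectation (path_pmf K n c) (\<lambda>bs. g (z # bs)))"
proof -
  have "measure_pmf.expectation (path_pmf K (Suc n) z) g =
      measure_pmf.expectation (bind_pmf (K z) (path_pmf K n)) (\<lambda>bs. g (z # bs))"
    by simp
  also have "\<dots> = measure_pmf.expectation (K z)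
      (\<lambda>c. measure_pmf.expectation (path_pmf K n c) (\<lambda>bs. g (z # bs)))"
    by (rule expectation_bind_pmf[where C = C]) (rule assms)
  finally show ?thesis .
qed

section \<open>First-step analysis of the stopped value\<close>

lemma hit_time_Suc:
  "hit_time (Suc n) y b =
     (if b 0 > y 1 then 0 else eSuc (hit_time n (\<lambda>j. y (Suc j)) (\<lambda>m. b (Suc m))))"
proof (cases "b 0 > y 1")
  case True
  then have "enat 0 \<in> {enat m | m. m < Suc n \<and> b m > y (m + 1)}" by force
  then have "hit_time (Suc n) y b \<le> enat 0" unfolding hit_time_def by (rule Inf_lower)
  then show ?thesis using True by (simp add: enat_0)
next
  case False
  let ?A = "{enat m | m. m < n \<and> b (Suc m) > y (Suc (m + 1))}"
  have eq: "{enat m | m. m < Suc n \<and> b m > y (m + 1)} = eSuc ` ?A"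
  proof (intro equalityI subsetI)
    fix x assume "x \<in> {enat m | m. m < Suc n \<and> b m > y (m + 1)}"
    then obtain m where m: "x = enat m" "m < Suc n" "b m > y (m + 1)" by auto
    then obtain k where "m = Suc k" using False by (cases m) auto
    then show "x \<in> eSuc ` ?A" using m by (intro image_eqI[of _ _ "enat k"]) (auto simp: eSuc_enat)
  qed (auto simp: eSuc_enat)
  have "Inf (eSuc ` ?A) = eSuc (Inf ?A)"
  proof (rule antisym)
    show "eSuc (Inf ?A) \<le> Inf (eSuc ` ?A)"
    proof (rule Inf_greatest)
      fix x assume "x \<in> eSuc ` ?A"
      then obtain v where v: "x = eSuc v" "v \<in> ?A" by (elim imageE)
      from v(2) have "Inf ?A \<le> v" by (rule Inf_lower)
      then show "eSuc (Inf ?A) \<le> x" by (simp only: v(1) eSuc_ile_mono)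
    qed
    \<comment> \<open>With no hit both sides are infinite; otherwise the infimum is attained, since
      a nonempty set of extended naturals has a least element.\<close>
    show "Inf (eSuc ` ?A) \<le> eSuc (Inf ?A)"
    proof (cases "?A = {}")
      case True
      show ?thesis unfolding True by (simp add: top_enat_def)
    next
      case False
      then obtain v where "v \<in> ?A" by blast
      then have "(LEAST v. v \<in> ?A) \<in> ?A" by (rule LeastI)
      then have "Inf ?A \<in> ?A" unfolding Inf_enat_def using False by (simp only: if_False)
      then show ?thesis by (intro Inf_lower imageI)
    qed
  qed
  then show ?thesis using False eq by (simp add: hit_time_def)
qed

lemma stopped_value_0: "stopped_value S y 0 x b = 0"
  by (simp add: stopped_value_def hit_time_def top_enat_def)

lemma stopped_value_Suc:
  "stopped_value S y (Suc n) x b =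
     (if b 0 > y 1 then S (Suc n) (b 0) x
      else stopped_value S (\<lambda>j. y (Suc j)) n x (\<lambda>m. b (Suc m)))"
proof (cases "hit_time n (\<lambda>j. y (Suc j)) (\<lambda>m. b (Suc m))")
  case (enat k)
  then show ?thesis
    by (simp add: stopped_value_def hit_time_Suc Let_def eSuc_enat zero_enat_def)
next
  case infinity
  then show ?thesis
    by (simp add: stopped_value_def hit_time_Suc Let_def zero_enat_def)
qed

text \<open>Permits replacing a trajectory by the list of its first \<open>n\<close> positions,
  whose entries beyond the length are unspecified.\<close>

lemma stopped_value_cong:
  assumes "\<And>i. i < n \<Longrightarrow> b i = b' i"
  shows "stopped_value S y n x b = stopped_value S y n x b'"
  using assms
proof (induction n arbitrary: y b b')
  case (Suc n)
  have "stopped_value S (\<lambda>j. y (Suc j)) n x (\<lambda>m. b (Suc m)) =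
      stopped_value S (\<lambda>j. y (Suc j)) n x (\<lambda>m. b' (Suc m))"
    by (rule Suc.IH) (use Suc.prems in auto)
  moreover have "b 0 = b' 0" using Suc.prems by simp
  ultimately show ?case by (simp only: stopped_value_Suc)
qed (simp add: stopped_value_0)

text \<open>At each of the finitely many times the kernel is evaluated only above the current
  boundary point, so bounds on half-lines combine into a uniform one.\<close>

lemma stopped_value_bounded:
  assumes "\<And>k c. 0 < k \<Longrightarrow> k \<le> n \<Longrightarrow> \<exists>C. \<forall>b\<ge>c. cmod (S k b x) \<le> C"
  shows "\<exists>C. \<forall>b. cmod (stopped_value S y n x b) \<le> C"
  using assms
proof (induction n arbitrary: y)
  case 0
  then show ?case by (auto simp: stopped_value_0)
next
  case (Suc n)
  obtain C1 where C1: "\<forall>b. cmod (stopped_value S (\<lambda>j. y (Suc j)) n x b) \<le> C1"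
    using Suc.IH[of "\<lambda>j. y (Suc j)"] Suc.prems by (meson le_SucI)
  obtain C2 where C2: "\<forall>b\<ge>y 1. cmod (S (Suc n) b x) \<le> C2"
    using Suc.prems[of "Suc n" "y 1"] by auto
  have "cmod (stopped_value S y (Suc n) x b) \<le> max C1 C2" for b
    unfolding stopped_value_Suc using C1 C2 by (auto simp: le_max_iff_disj)
  then show ?case by blast
qed

lemma integrable_stopped_value:
  assumes walk: "random_walk_from Q z M B"
    and bd: "\<And>b. cmod (stopped_value S y n x b) \<le> C"
  shows "integrable M (\<lambda>\<omega>. stopped_value S y n x (\<lambda>m. B m \<omega>))"
proof -
  interpret prob_space M using walk by (simp add: random_walk_from_def)
  have meas: "(\<lambda>\<omega>. map (\<lambda>i. B i \<omega>) [0..<n]) \<in> measurable M (count_space UNIV)"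
    by (rule measurable_path) (use walk in \<open>simp add: random_walk_from_def\<close>)
  have "(\<lambda>\<omega>. stopped_value S y n x ((!) (map (\<lambda>i. B i \<omega>) [0..<n]))) \<in> borel_measurable M"
    by (rule measurable_compose[OF meas]) auto
  also have "(\<lambda>\<omega>. stopped_value S y n x ((!) (map (\<lambda>i. B i \<omega>) [0..<n]))) =
      (\<lambda>\<omega>. stopped_value S y n x (\<lambda>m. B m \<omega>))"
    by (intro ext stopped_value_cong) auto
  finally show ?thesis using bd by (intro integrable_const_bound[where B = C]) auto
qed

lemma epi_ker_path_pmf:
  assumes walk: "random_walk_from Q z (P z) B" and Q: "\<And>x y. Q x y = pmf (K x) y"
  shows "epi_ker P B S y n z x =
    measure_pmf.expectation (path_pmf K n z) (\<lambda>bs. stopped_value S y n x ((!) bs))"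
proof -
  interpret prob_space "P z" using walk by (simp add: random_walk_from_def)
  have meas: "(\<lambda>\<omega>. map (\<lambda>i. B i \<omega>) [0..<n]) \<in> measurable (P z) (count_space UNIV)"
    by (rule measurable_path) (use walk in \<open>simp add: random_walk_from_def\<close>)
  have "epi_ker P B S y n z x =
      (LINT \<omega>|P z. stopped_value S y n x ((!) (map (\<lambda>i. B i \<omega>) [0..<n])))"
    unfolding epi_ker_def by (intro Bochner_Integration.integral_cong refl stopped_value_cong) auto
  also have "\<dots> = integral\<^sup>L (distr (P z) (count_space UNIV) (\<lambda>\<omega>. map (\<lambda>i. B i \<omega>) [0..<n]))
      (\<lambda>bs. stopped_value S y n x ((!) bs))"
    by (subst integral_distr[OF meas]) auto
  finally show ?thesis unfolding random_walk_path_distr[OF walk Q] .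
qed

text \<open>From above \<open>y 1\<close> the walk is stopped at time 0; otherwise one step leads to
  the same problem with horizon \<open>n\<close> and the boundary shifted by one. The kernel in
  \<open>stopped_value\<close> is indexed by the remaining time, so the shift leaves
  \<open>S\<close> unchanged.\<close>

theorem epi_ker_Suc:
  assumes walk: "\<And>z. random_walk_from Q z (P z) B" and Q: "\<And>x y. Q x y = pmf (K x) y"
    and bd: "\<And>k c. 0 < k \<Longrightarrow> k \<le> Suc n \<Longrightarrow> \<exists>C. \<forall>b\<ge>c. cmod (S k b x) \<le> C"
  shows "z > y 1 \<Longrightarrow> epi_ker P B S y (Suc n) z x = S (Suc n) z x"
    and "z \<le> y 1 \<Longrightarrow> ((\<lambda>c. of_real (Q z c) * epi_ker P B S (\<lambda>j. y (Suc j)) n c x) has_sum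
           epi_ker P B S y (Suc n) z x) UNIV"
proof -
  have epi: "epi_ker P B S y n z x =
      measure_pmf.expectation (path_pmf K n z) (\<lambda>bs. stopped_value S y n x ((!) bs))" for y n z
    by (rule epi_ker_path_pmf[where Q = Q]) (rule walk Q)+
  obtain C where C: "\<And>b. cmod (stopped_value S y (Suc n) x b) \<le> C"
    using stopped_value_bounded[of "Suc n" S x y] bd by blast
  obtain C' where C': "\<And>b. cmod (stopped_value S (\<lambda>j. y (Suc j)) n x b) \<le> C'"
    using stopped_value_bounded[of n S x "\<lambda>j. y (Suc j)"] bd by (meson le_SucI)
  have *: "epi_ker P B S y (Suc n) z x = measure_pmf.expectation (K z) (\<lambda>c.
      measure_pmf.expectation (path_pmf K n c) (\<lambda>bs. stopped_value S y (Suc n) x ((!) (z # bs))))"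
    unfolding epi by (rule expectation_path_pmf_Suc[OF C])
  show "epi_ker P B S y (Suc n) z x = S (Suc n) z x" if "z > y 1"
    unfolding * using that by (simp add: stopped_value_Suc)
  assume "z \<le> y 1"
  then have "epi_ker P B S y (Suc n) z x =
      measure_pmf.expectation (K z) (\<lambda>c. epi_ker P B S (\<lambda>j. y (Suc j)) n c x)"
    unfolding * unfolding epi by (simp only: stopped_value_Suc) simp
  moreover have "cmod (epi_ker P B S (\<lambda>j. y (Suc j)) n c x) \<le> C'" for c
    unfolding epi by (rule norm_expectation_pmf_le) (rule C')
  ultimately show "((\<lambda>c. of_real (Q z c) * epi_ker P B S (\<lambda>j. y (Suc j)) n c x) has_sum
           epi_ker P B S y (Suc n) z x) UNIV"
    unfolding Q using has_sum_expectation_pmf by metis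
qed

subsection \<open>Kernels and their symbols\<close>

lemma laurent_coeff_inverse_minus_one:
  assumes f: "continuous_on (sphere 0 r) f" and r: "0 < r"
  shows "laurent_coeff r (\<lambda>w. (inverse w - 1) * f w) d = laurent_coeff r f (d + 1) - laurent_coeff r f d"
proof -
  have int: "(\<lambda>w. f w / w powi k) contour_integrable_on circlepath 0 r" for k
    by (intro contour_integrable_circlepath_sphere continuous_intros f) (use r in auto)
  have "contour_integral (circlepath 0 r) (\<lambda>w. (inverse w - 1) * f w / w powi (d + 1)) =
      contour_integral (circlepath 0 r) (\<lambda>w. f w / w powi (d + 1 + 1) - f w / w powi (d + 1))"
  proof (rule contour_integral_circlepath_cong[OF _ r])
    fix w :: complex assume "cmod w = r"
    then have "w \<noteq> 0" using r by auto
    then show "(inverse w - 1) * f w / w powi (d + 1) = f w / w powi (d + 1 + 1) - f w / w powi (d + 1)"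
      using power_int_add_1[of w "d + 1"] by (simp add: field_simps)
  qed
  then show ?thesis
    unfolding laurent_coeff_def by (simp add: contour_integral_diff[OF int int] diff_divide_distrib)
qed

lemma laurent_coeff_powi:
  assumes r: "0 < r"
  shows "laurent_coeff r (\<lambda>w. w powi i) d = (if i = d then 1 else 0)"
proof -
  have eq: "contour_integral (circlepath 0 r) (\<lambda>w. w powi i / w powi (d + 1)) =
      contour_integral (circlepath 0 r) (\<lambda>w. w powi (i - d - 1))"
  proof (rule contour_integral_circlepath_cong[OF _ r])
    fix w :: complex assume "cmod w = r"
    then have "w \<noteq> 0" using r by auto
    then show "w powi i / w powi (d + 1) = w powi (i - d - 1)"
      by (simp add: power_int_diff[symmetric] algebra_simps)
  qed
  show ?thesis
  proof (cases "i = d")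
    case True
    have "contour_integral (circlepath 0 r) (\<lambda>w. w powi (i - d - 1)) = 2 * of_real pi * \<i>"
      using Cauchy_integral_circlepath_simple[of "\<lambda>_. 1" 0 r 0] r True
      by (intro contour_integral_unique) (simp add: power_int_minus divide_inverse)
    then show ?thesis unfolding laurent_coeff_def eq using True by simp
  next
    case False
    define m where "m = i - d - 1"
    have m: "of_int (m + 1) \<noteq> (0 :: complex)" using False by (simp add: m_def del: of_int_diff of_int_add)
    have "((\<lambda>w. w powi m) has_contour_integral 0) (circlepath 0 r)"
    proof (rule Cauchy_theorem_primitive[where S = "- {0}" and f = "\<lambda>w. w powi (m + 1) / of_int (m + 1)"])
      fix w :: complex assume "w \<in> - {0}"
      then show "((\<lambda>w. w powi (m + 1) / of_int (m + 1)) has_field_derivative w powi m) (at w within - {0})"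
        using m by (auto intro!: derivative_eq_intros)
    qed (use r in auto)
    then show ?thesis unfolding laurent_coeff_def eq m_def[symmetric]
      using False by (simp add: contour_integral_unique[of _ 0])
  qed
qed

text \<open>These coefficients obey the same difference recursion as the polynomials
  \<open>d - 1 gchoose (k - 1)\<close>, but start from 0 at \<open>d = 0\<close>: for
  \<open>k > 0\<close> they are the truncation to \<open>d \<ge> 1\<close>. It is this truncation
  that separates \<open>A^(-1) Q^k\<close> from \<open>A^(-1) Qbar (k)\<close>.\<close>

lemma laurent_coeff_geometric_power:
  assumes r: "0 < r" "r < 1"
  shows "laurent_coeff r (\<lambda>w. (w / (1 - w)) ^ k) d =
    (if k = 0 then if d = 0 then 1 else 0 else if 1 \<le> d then of_int (d - 1) gchoose (k - 1) else 0)"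
proof (induction k arbitrary: d)
  case 0
  then show ?case using laurent_coeff_powi[OF r(1), of 0 d] by simp
next
  case (Suc k)
  define G :: "int \<Rightarrow> complex" where "G d = (if 1 \<le> d then of_int (d - 1) gchoose k else 0)" for d
  have cont: "continuous_on (sphere 0 r) (\<lambda>w :: complex. (w / (1 - w)) ^ Suc k)"
    using r by (intro continuous_intros) auto
  have diffL: "laurent_coeff r (\<lambda>w. (w / (1 - w)) ^ Suc k) (d + 1) -
      laurent_coeff r (\<lambda>w. (w / (1 - w)) ^ Suc k) d = laurent_coeff r (\<lambda>w. (w / (1 - w)) ^ k) d" for d
  proof -
    have "laurent_coeff r (\<lambda>w. (w / (1 - w)) ^ k) d =
        laurent_coeff r (\<lambda>w. (inverse w - 1) * (w / (1 - w)) ^ Suc k) d"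
    proof (rule laurent_coeff_cong[OF _ r(1)])
      fix w :: complex assume "cmod w = r"
      then have "w \<noteq> 0" "w \<noteq> 1" using r by auto
      then have "(inverse w - 1) * (w / (1 - w)) = 1" by (simp add: field_simps)
      then show "(w / (1 - w)) ^ k = (inverse w - 1) * (w / (1 - w)) ^ Suc k"
        by (metis mult.assoc mult_1 power_Suc)
    qed
    then show ?thesis using laurent_coeff_inverse_minus_one[OF cont r(1)] by simp
  qed
  have diffG: "G (d + 1) - G d =
    (if k = 0 then if d = 0 then 1 else 0 else if 1 \<le> d then of_int (d - 1) gchoose (k - 1) else 0)" for d
  proof (cases k)
    case 0
    then show ?thesis by (auto simp: G_def)
  next
    case (Suc m)
    have "(of_int d gchoose k) - (of_int (d - 1) gchoose k) = (of_int (d - 1) gchoose m :: complex)"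
      using gbinomial_Suc_Suc[of "of_int (d - 1) :: complex" m] Suc by simp
    then show ?thesis using Suc by (cases "d = 0") (auto simp: G_def)
  qed
  \<comment> \<open>At \<open>d = 0\<close> the zero of the numerator cancels the division by
    \<open>w\<close>, leaving a function holomorphic in the unit disc.\<close>
  have "((\<lambda>w. (w / (1 - w)) ^ Suc k / w powi (0 + 1)) has_contour_integral 0) (circlepath 0 r)"
  proof (rule has_contour_integral_eq)
    show "((\<lambda>w. w ^ k / (1 - w) ^ Suc k) has_contour_integral 0) (circlepath 0 r)"
      by (rule Cauchy_theorem_disc_simple[of _ 0 1]) (use r in \<open>auto intro!: holomorphic_intros\<close>)
    show "w ^ k / (1 - w) ^ Suc k = (w / (1 - w)) ^ Suc k / w powi (0 + 1)"
      if "w \<in> path_image (circlepath 0 r)" for w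
      using that r by (auto simp: power_divide)
  qed
  from contour_integral_unique[OF this]
  have eq0: "laurent_coeff r (\<lambda>w. (w / (1 - w)) ^ Suc k) 0 = G 0"
    by (simp add: laurent_coeff_def G_def)
  have "laurent_coeff r (\<lambda>w. (w / (1 - w)) ^ Suc k) d = G d"
    by (rule int_function_eqI[where F = "laurent_coeff r (\<lambda>w. (w / (1 - w)) ^ Suc k)"
          and G = G and e = 0]) (simp_all only: diffL diffG Suc.IH eq0)
  then show ?case by (simp add: G_def)
qed

text \<open>Degrees add: in every term of the convolution one of the two indices exceeds its
  bound.\<close>

lemma laurent_coeff_power_eq_0:
  assumes f: "f analytic_on closed_annulus r s" and r: "0 < r" "r < s"
    and top: "\<And>d. d > N \<Longrightarrow> laurent_coeff r f d = 0"
    and d: "d > int m * N"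
  shows "laurent_coeff r (\<lambda>w. f w ^ m) d = 0"
  using d
proof (induction m arbitrary: d)
  case 0
  then show ?case using laurent_coeff_powi[OF r(1), of 0 d] by simp
next
  case (Suc m)
  have "((\<lambda>j. laurent_coeff r f j * laurent_coeff r (\<lambda>w. f w ^ m) (d - j)) has_sum
      laurent_coeff r (\<lambda>w. f w * f w ^ m) d) UNIV"
    by (intro laurent_coeff_mult[where s = s] f r analytic_intros)
  moreover have "laurent_coeff r f j * laurent_coeff r (\<lambda>w. f w ^ m) (d - j) = 0" for j
  proof (cases "j > N")
    case False
    then have "d - j > int m * N" using Suc.prems by (simp add: algebra_simps)
    then show ?thesis using Suc.IH by simp
  qed (simp add: top)
  ultimately have "((\<lambda>_. 0) has_sum laurent_coeff r (\<lambda>w. f w * f w ^ m) d) (UNIV :: int set)"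
    by (simp only:)
  then show ?case using has_sum_unique[OF _ has_sum_0_simp] by simp
qed

locale kernel_setup =
  fixes \<kappa> :: nat and \<theta> r rbar :: real and q :: "int \<Rightarrow> real" and a \<psi> :: "complex \<Rightarrow> complex"
  assumes theta: "0 < \<theta>" "\<theta> < 1"
    and q_nonneg: "\<And>i. q i \<ge> 0"
    and q_one: "\<And>i. i > int \<kappa> \<Longrightarrow> q i = 1"
    and q_sum: "(\<lambda>i. q i * \<theta> powi i) summable_on UNIV"
    and radii: "0 < r" "r < \<theta>" "1 < rbar"
    and a_series: "\<And>w. \<theta> \<le> cmod w \<Longrightarrow>
        ((\<lambda>i. complex_of_real (q (i + 1) - q i) * w powi i) has_sum a w) {..int \<kappa>}"
    and a_analytic: "a analytic_on {w. r \<le> cmod w}"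
    and inv_a_analytic: "(\<lambda>w. 1 / a w) analytic_on {w. r \<le> cmod w \<and> cmod w \<le> rbar}"
    and psi_analytic: "\<psi> analytic_on {w. r \<le> cmod w \<and> cmod w \<le> rbar}"
    and inv_psi_analytic: "(\<lambda>w. 1 / \<psi> w) analytic_on {w. r \<le> cmod w \<and> cmod w \<le> rbar}"
    and nonzero: "\<And>w. r \<le> cmod w \<Longrightarrow> cmod w \<le> rbar \<Longrightarrow> a w \<noteq> 0 \<and> \<psi> w \<noteq> 0"
begin

text \<open>\<open>sym_A\<close> is the symbol of \<open>A\<close> and \<open>sym_Q\<close> that of \<open>Q\<close>. The radius \<open>\<delta>\<close> satisfies \<open>\<delta> < 1 - \<theta>\<close>, so
  that the growth of \<open>pole_coeff \<delta> n f d\<close> as \<open>d\<close> tends to infinity is beaten by \<open>\<theta> powi d\<close>.\<close>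

definition "\<delta> = min (1 - \<theta>) (rbar - 1) / 2"
definition "\<alpha> = alpha \<theta> q"
definition "sym_A w = complex_of_real \<alpha> * a w"
definition "sym_Q w = sym_A w * (w / (1 - w))"

definition ker :: "(complex \<Rightarrow> complex) \<Rightarrow> kernel" where
  "ker f x y = of_real \<theta> powi (x - y) * laurent_coeff r f (x - y)"

definition pker :: "nat \<Rightarrow> (complex \<Rightarrow> complex) \<Rightarrow> kernel" where
  "pker n f x y = of_real \<theta> powi (x - y) * pole_coeff \<delta> n f (x - y)"

sublocale pole_annulus r rbar \<delta>
  using theta radii by unfold_locales (auto simp: \<delta>_def min_def field_simps)

lemma theta_le: "\<theta> \<le> 1 - \<delta>"
  using theta radii by (auto simp: \<delta>_def min_def field_simps)

lemma theta_nonzero [simp]: "\<theta> \<noteq> 0"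
  using theta by simp

lemma theta_powi: "complex_of_real \<theta> powi (x - z) * complex_of_real \<theta> powi (z - y) = complex_of_real \<theta> powi (x - y)"
  by (subst power_int_add[symmetric]) auto

lemma q_theta: "\<theta> powi i * q i \<ge> 0"
  using theta q_nonneg by simp

lemma q_sum': "(\<lambda>i. \<theta> powi i * q i) summable_on UNIV"
  using q_sum by (simp add: mult.commute)

lemma q_theta_le: "\<theta> powi i * q i \<le> (\<Sum>\<^sub>\<infinity>i. \<theta> powi i * q i)"
  using finite_sum_le_infsum[OF q_sum', of "{i}"] q_theta by simp

lemma alpha_pos: "\<alpha> > 0"
proof -
  have "0 < \<theta> powi (int \<kappa> + 1) * q (int \<kappa> + 1)" using theta q_one by simp
  also have "\<dots> \<le> (\<Sum>\<^sub>\<infinity>i. \<theta> powi i * q i)" by (rule q_theta_le)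
  finally show ?thesis by (simp add: \<alpha>_def alpha_def)
qed

lemma alpha_nonzero [simp]: "\<alpha> \<noteq> 0"
  using alpha_pos by simp

lemma Q_ker_pmf: "\<exists>K. \<forall>z b. Q_ker \<theta> q z b = pmf (K z) b"
proof -
  have "\<exists>p. \<forall>b. Q_ker \<theta> q z b = pmf p b" for z
  proof -
    let ?f = "\<lambda>b. Q_ker \<theta> q z b"
    have nn: "?f b \<ge> 0" for b
      using q_theta[of "z - b"] alpha_pos
      by (simp add: Q_ker_def \<alpha>_def mult.assoc)
    have "((\<lambda>i. \<alpha> * (\<theta> powi i * q i)) has_sum \<alpha> * (\<Sum>\<^sub>\<infinity>i. \<theta> powi i * q i)) UNIV"
      by (intro has_sum_cmult_right has_sum_infsum q_sum')
    also have "\<alpha> * (\<Sum>\<^sub>\<infinity>i. \<theta> powi i * q i) = 1"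
      using alpha_pos by (simp add: \<alpha>_def alpha_def)
    also have "((\<lambda>i. \<alpha> * (\<theta> powi i * q i)) has_sum 1) UNIV \<longleftrightarrow> (?f has_sum 1) UNIV"
      by (rule has_sum_reindex_bij_witness[of _ "\<lambda>b. z - b" "\<lambda>i. z - i"])
         (auto simp: Q_ker_def \<alpha>_def)
    finally have hs: "(?f has_sum 1) UNIV" .
    then have "(\<lambda>b. norm (?f b)) summable_on UNIV"
      using nn by (simp add: has_sum_imp_summable)
    then have abs: "Infinite_Set_Sum.abs_summable_on ?f UNIV"
      using abs_summable_equivalent by blast
    have "(\<integral>\<^sup>+b. ?f b \<partial>count_space UNIV) = 1"
      using nn_integral_conv_infsetsum[OF abs nn] infsetsum_infsum[OF abs] infsumI[OF hs] by simp
    then have "pmf (embed_pmf ?f) b = ?f b" for b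
      by (intro pmf_embed_pmf nn)
    then show ?thesis by metis
  qed
  then show ?thesis by metis
qed

lemma Ann_eq: "{w. r \<le> cmod w \<and> cmod w \<le> rbar} = closed_annulus r rbar"
  by (simp add: closed_annulus_def)

lemma ann_subset: "closed_annulus r \<theta> \<subseteq> closed_annulus r rbar"
  using theta radii by (auto simp: closed_annulus_def)

lemma one_in_Ann: "1 \<in> closed_annulus r rbar"
  using theta radii by (simp add: closed_annulus_def)

lemma nonzero_Ann:
  assumes "w \<in> closed_annulus r rbar"
  shows "a w \<noteq> 0" "\<psi> w \<noteq> 0" "sym_A w \<noteq> 0" "w \<noteq> 0"
  using assms nonzero[of w] radii by (auto simp: closed_annulus_def sym_A_def)

lemma nonzero_ann:
  assumes "w \<in> closed_annulus r \<theta>"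
  shows "a w \<noteq> 0" "\<psi> w \<noteq> 0" "sym_A w \<noteq> 0" "w \<noteq> 0" "w \<noteq> 1" "sym_Q w \<noteq> 0"
proof -
  show *: "a w \<noteq> 0" "\<psi> w \<noteq> 0" "sym_A w \<noteq> 0" "w \<noteq> 0"
    using nonzero_Ann ann_subset assms by blast+
  show "w \<noteq> 1" using assms theta by (auto simp: closed_annulus_def)
  with * show "sym_Q w \<noteq> 0" by (simp add: sym_Q_def)
qed

lemma sphere_in_ann: "cmod w = r \<Longrightarrow> w \<in> closed_annulus r \<theta>"
  using radii by (simp add: closed_annulus_def)

lemma analytic_Ann:
  "a analytic_on closed_annulus r rbar" "sym_A analytic_on closed_annulus r rbar"
  "\<psi> analytic_on closed_annulus r rbar" "(\<lambda>w. 1 / \<psi> w) analytic_on closed_annulus r rbar"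
proof -
  show a: "a analytic_on closed_annulus r rbar"
    by (rule analytic_on_subset[OF a_analytic]) (auto simp: closed_annulus_def)
  show "sym_A analytic_on closed_annulus r rbar"
    unfolding sym_A_def by (intro analytic_intros a)
qed (use psi_analytic inv_psi_analytic Ann_eq in auto)

lemma analytic_ann:
  "sym_A analytic_on closed_annulus r \<theta>" "\<psi> analytic_on closed_annulus r \<theta>"
  "sym_Q analytic_on closed_annulus r \<theta>" "a analytic_on closed_annulus r \<theta>"
  using analytic_Ann analytic_on_subset[OF _ ann_subset] nonzero_ann
  unfolding sym_Q_def by (auto intro!: analytic_intros)

section \<open>Composition of kernels as multiplication of symbols\<close>

lemma ker_cong: "(\<And>w. w \<in> closed_annulus r \<theta> \<Longrightarrow> f w = g w) \<Longrightarrow> ker f x y = ker g x y"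
  unfolding ker_def using laurent_coeff_cong[of r f g] sphere_in_ann radii by simp

lemma pker_cong: "(\<And>w. w \<in> closed_annulus r rbar \<Longrightarrow> f w = g w) \<Longrightarrow> pker n f x y = pker n g x y"
  unfolding pker_def using pole_coeff_cong[of f g] by simp

text \<open>\<open>laurent_coeff_mult\<close> and \<open>has_sum_pole_coeff\<close> sum over the
  index \<open>j\<close> of their first factor. Read with \<open>j = x - z\<close> such a sum is a
  composition with that factor on the left; read with \<open>j = z - y\<close>, as in the next
  lemma, it stands on the right.\<close>

lemma has_sum_convolution_left:
  "((\<lambda>j. of_real \<theta> powi (x - y) * (F j * G (x - y - j))) has_sum S) UNIV \<longleftrightarrow>
   ((\<lambda>z. of_real \<theta> powi (x - z) * F (x - z) * (of_real \<theta> powi (z - y) * G (z - y))) has_sum S)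
     (UNIV :: int set)" for S :: complex
proof (rule has_sum_reindex_bij_witness[of _ "\<lambda>z. x - z" "\<lambda>j. x - j"])
  fix j :: int
  have e: "x - (x - j) = j" "x - j - y = x - y - j" by auto
  then show "of_real \<theta> powi (x - (x - j)) * F (x - (x - j)) * (of_real \<theta> powi (x - j - y) * G (x - j - y)) =
      of_real \<theta> powi (x - y) * (F j * G (x - y - j))"
    using theta_powi[of x "x - j" y] unfolding e by (simp add: mult_ac)
qed auto

lemma has_sum_convolution_right:
  "((\<lambda>j. of_real \<theta> powi (x - y) * (F j * G (x - y - j))) has_sum S) UNIV \<longleftrightarrow>
   ((\<lambda>z. of_real \<theta> powi (x - z) * G (x - z) * (of_real \<theta> powi (z - y) * F (z - y))) has_sum S)
     (UNIV :: int set)" for S :: complex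
proof (rule has_sum_reindex_bij_witness[of _ "\<lambda>z. z - y" "\<lambda>j. y + j"])
  fix j :: int
  have e: "y + j - y = j" "x - (y + j) = x - y - j" by auto
  then show "of_real \<theta> powi (x - (y + j)) * G (x - (y + j)) * (of_real \<theta> powi (y + j - y) * F (y + j - y)) =
      of_real \<theta> powi (x - y) * (F j * G (x - y - j))"
    using theta_powi[of x "y + j" y] unfolding e by (simp add: mult_ac)
qed auto

lemma has_sum_ker_ker:
  assumes "f analytic_on closed_annulus r \<theta>" "g analytic_on closed_annulus r \<theta>"
  shows "((\<lambda>z. ker f x z * ker g z y) has_sum ker (\<lambda>w. f w * g w) x y) UNIV"
proof -
  have "((\<lambda>j. of_real \<theta> powi (x - y) * (laurent_coeff r f j * laurent_coeff r g (x - y - j))) has_sum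
      ker (\<lambda>w. f w * g w) x y) UNIV"
    unfolding ker_def by (intro has_sum_cmult_right laurent_coeff_mult[where s = \<theta>] assms radii)
  then show ?thesis unfolding has_sum_convolution_left ker_def .
qed

lemma has_sum_ker_pker:
  assumes "g analytic_on closed_annulus r rbar" "f analytic_on closed_annulus r rbar"
  shows "((\<lambda>z. ker g x z * pker n f z y) has_sum pker n (\<lambda>u. g u * f u) x y) UNIV"
proof -
  have "((\<lambda>j. of_real \<theta> powi (x - y) * (laurent_coeff r g j * pole_coeff \<delta> n f (x - y - j))) has_sum
      pker n (\<lambda>u. g u * f u) x y) UNIV"
    unfolding pker_def by (intro has_sum_cmult_right has_sum_pole_coeff assms)
  then show ?thesis unfolding has_sum_convolution_left ker_def pker_def .
qed

lemma has_sum_pker_ker: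
  assumes "f analytic_on closed_annulus r rbar" "g analytic_on closed_annulus r rbar"
  shows "((\<lambda>z. pker n f x z * ker g z y) has_sum pker n (\<lambda>u. g u * f u) x y) UNIV"
proof -
  have "((\<lambda>j. of_real \<theta> powi (x - y) * (laurent_coeff r g j * pole_coeff \<delta> n f (x - y - j))) has_sum
      pker n (\<lambda>u. g u * f u) x y) UNIV"
    unfolding pker_def by (intro has_sum_cmult_right has_sum_pole_coeff assms)
  then show ?thesis unfolding has_sum_convolution_right ker_def pker_def .
qed

lemma kcomp_ker_ker:
  assumes "f analytic_on closed_annulus r \<theta>" "g analytic_on closed_annulus r \<theta>"
  shows "ker f \<circ>\<^sub>K ker g = ker (\<lambda>w. f w * g w)"
  using infsumI[OF has_sum_ker_ker[OF assms]] by (intro ext) (simp add: kcomp_def)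

lemma kcomp_ker_pker:
  assumes "g analytic_on closed_annulus r rbar" "f analytic_on closed_annulus r rbar"
  shows "ker g \<circ>\<^sub>K pker n f = pker n (\<lambda>w. g w * f w)"
  using infsumI[OF has_sum_ker_pker[OF assms]] by (intro ext) (simp add: kcomp_def)

lemma kcomp_pker_ker:
  assumes "f analytic_on closed_annulus r rbar" "g analytic_on closed_annulus r rbar"
  shows "pker n f \<circ>\<^sub>K ker g = pker n (\<lambda>w. g w * f w)"
  using infsumI[OF has_sum_pker_ker[OF assms]] by (intro ext) (simp add: kcomp_def)

section \<open>Symbols of the given kernels\<close>

lemma contour_integral_ker:
  assumes F: "F analytic_on closed_annulus r \<theta>" and k: "k \<noteq> 0"
    and eq: "\<And>w. w \<in> closed_annulus r \<theta> \<Longrightarrow>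
      k * H w = of_real \<theta> powi (x - y) * (F w / w powi (x - y + 1))"
  shows "k / (2 * of_real pi * \<i>) * contour_integral (circlepath 0 r) H = ker F x y"
proof -
  have "continuous_on (sphere 0 r) F"
    using F radii by (intro analytic_on_closed_annulus_sphere) auto
  then have int: "(\<lambda>w. F w / w powi (x - y + 1)) contour_integrable_on circlepath 0 r"
    using radii by (intro contour_integrable_circlepath_sphere continuous_intros) auto
  have "contour_integral (circlepath 0 r) H =
      contour_integral (circlepath 0 r) (\<lambda>w. (of_real \<theta> powi (x - y) / k) * (F w / w powi (x - y + 1)))"
  proof (rule contour_integral_circlepath_cong[OF _ radii(1)])
    fix w :: complex assume "cmod w = r"
    then show "H w = (of_real \<theta> powi (x - y) / k) * (F w / w powi (x - y + 1))"
      using eq[of w] sphere_in_ann[of w] k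
      by (metis nonzero_mult_div_cancel_left times_divide_eq_left)
  qed
  also have "\<dots> = of_real \<theta> powi (x - y) / k *
      contour_integral (circlepath 0 r) (\<lambda>w. F w / w powi (x - y + 1))"
    by (rule contour_integral_lmul[OF int])
  finally show ?thesis using k by (simp add: ker_def laurent_coeff_def)
qed

text \<open>The series for \<open>a\<close> is given only for \<open>\<theta> \<le> cmod w\<close>;
  it is integrated term by term on the circle of radius \<open>\<theta>\<close>, and analyticity of
  \<open>a\<close> carries the result to radius \<open>r\<close>.\<close>

lemma a_coeff: "laurent_coeff r a d = of_real (q (d + 1) - q d)"
proof -
  let ?c = "\<lambda>i. complex_of_real (q (i + 1) - q i)"
  have "((\<lambda>i. contour_integral (circlepath 0 \<theta>) (\<lambda>w. ?c i * (w powi i / w powi (d + 1)))) has_sum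
      contour_integral (circlepath 0 \<theta>) (\<lambda>w. a w / w powi (d + 1))) {..int \<kappa>}"
  proof (rule has_sum_contour_integral_circlepath[where
        M = "\<lambda>i. cmod (?c i * of_real \<theta> powi i) * (1 / \<theta> powi (d + 1))"])
    show "continuous_on (sphere 0 \<theta>) (\<lambda>w. ?c i * (w powi i / w powi (d + 1)))" for i
      using theta by (intro continuous_intros) auto
    show "cmod (?c i * (u powi i / u powi (d + 1))) \<le> cmod (?c i * of_real \<theta> powi i) * (1 / \<theta> powi (d + 1))"
      if "cmod u = \<theta>" for i u
      using that theta by (simp add: norm_mult norm_divide norm_power_int)
    have "(\<lambda>i. ?c i * of_real \<theta> powi i) summable_on {..int \<kappa>}"
      using a_series[of "of_real \<theta>"] theta by (auto intro: has_sum_imp_summable)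
    then show "(\<lambda>i. cmod (?c i * of_real \<theta> powi i) * (1 / \<theta> powi (d + 1))) summable_on {..int \<kappa>}"
      by (intro summable_on_cmult_left) (simp only: summable_on_iff_abs_summable_on_complex)
    show "((\<lambda>i. ?c i * (u powi i / u powi (d + 1))) has_sum a u / u powi (d + 1)) {..int \<kappa>}"
      if "cmod u = \<theta>" for u
      using has_sum_divide_const[OF a_series[of u], of "u powi (d + 1)"] that by simp
  qed (rule theta)
  moreover have "contour_integral (circlepath 0 \<theta>) (\<lambda>w. ?c i * (w powi i / w powi (d + 1))) =
      2 * of_real pi * \<i> * (if i = d then ?c d else 0)" for i
  proof -
    have int: "(\<lambda>w. w powi i / w powi (d + 1)) contour_integrable_on circlepath 0 \<theta>"
      using theta by (intro contour_integrable_circlepath_sphere continuous_intros) auto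
    have "contour_integral (circlepath 0 \<theta>) (\<lambda>w. w powi i / w powi (d + 1)) =
        2 * of_real pi * \<i> * laurent_coeff \<theta> (\<lambda>w. w powi i) d"
      by (simp add: laurent_coeff_def)
    then show ?thesis
      unfolding contour_integral_lmul[OF int] laurent_coeff_powi[OF theta(1)] by simp
  qed
  moreover have "contour_integral (circlepath 0 \<theta>) (\<lambda>w. a w / w powi (d + 1)) =
      2 * of_real pi * \<i> * laurent_coeff r a d"
    using laurent_coeff_radius[OF analytic_Ann(1) radii(1), of \<theta> d] radii theta
    by (simp add: laurent_coeff_def)
  ultimately have "((\<lambda>i. 2 * of_real pi * \<i> * (if i = d then ?c d else 0)) has_sum
      2 * of_real pi * \<i> * laurent_coeff r a d) {..int \<kappa>}"
    by (simp only:)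
  then have hs: "((\<lambda>i. if i = d then ?c d else 0) has_sum laurent_coeff r a d) {..int \<kappa>}"
    by (rule has_sum_cmult_cancel[rotated]) simp
  show ?thesis
  proof (cases "d \<le> int \<kappa>")
    case True
    then have "((\<lambda>i. if i = d then ?c d else 0) has_sum ?c d) {..int \<kappa>}"
      by (intro has_sum_finite_neutralI[of "{d}"]) auto
    then show ?thesis by (rule has_sum_unique[OF hs])
  next
    case False
    then have "((\<lambda>i. if i = d then ?c d else 0) has_sum 0) {..int \<kappa>}"
      by (intro has_sum_0) auto
    from has_sum_unique[OF hs this] show ?thesis using False q_one by simp
  qed
qed

lemma sym_A_coeff: "laurent_coeff r sym_A d = of_real (\<alpha> * (q (d + 1) - q d))"
  unfolding sym_A_def
  using laurent_coeff_const_mult[OF analytic_Ann(1) radii(1), of "of_real \<alpha>" d] radii theta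
  by (simp add: a_coeff)

lemma A_ker_eq: "A_ker \<theta> q = ker sym_A"
  by (intro ext) (simp add: A_ker_def ker_def sym_A_coeff \<alpha>_def)

text \<open>A single nonnegative term is at most the whole sum, which forces geometric decay of
  \<open>q\<close> to the left.\<close>

lemma q_limit: "(\<lambda>n. q (- int n)) \<longlonglongrightarrow> 0"
proof (rule Lim_null_comparison)
  let ?S = "\<Sum>\<^sub>\<infinity>i. \<theta> powi i * q i"
  have "\<bar>q (- int n)\<bar> \<le> ?S * \<theta> ^ n" for n
    using q_theta_le[of "- int n"] theta q_nonneg[of "- int n"]
    by (simp add: power_int_minus field_simps)
  then show "\<forall>\<^sub>F n in sequentially. norm (q (- int n)) \<le> ?S * \<theta> ^ n" by simp
  show "(\<lambda>n. ?S * \<theta> ^ n) \<longlonglongrightarrow> 0"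
    using theta by (intro tendsto_mult_right_zero LIMSEQ_power_zero) auto
qed

text \<open>Multiplying \<open>sym_Q\<close> by \<open>1 / w - 1\<close> gives \<open>sym_A\<close>,
  so the coefficients of \<open>sym_Q\<close> and the numbers \<open>\<alpha> * q d\<close> have the
  same increments. The remaining constant is 0, because both sequences tend to 0 at minus
  infinity.\<close>

lemma sym_Q_coeff: "laurent_coeff r sym_Q d = of_real (\<alpha> * q d)"
proof -
  define v where "v d = laurent_coeff r sym_Q d" for d
  have cX: "continuous_on (sphere 0 r) sym_Q"
    using analytic_ann(3) radii by (intro analytic_on_closed_annulus_sphere) auto
  have diff: "v (d + 1) - v d = of_real (\<alpha> * q (d + 1)) - of_real (\<alpha> * q d)" for d
  proof -
    have "v (d + 1) - v d = laurent_coeff r (\<lambda>w. (inverse w - 1) * sym_Q w) d"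
      unfolding v_def laurent_coeff_inverse_minus_one[OF cX radii(1)] ..
    also have "\<dots> = laurent_coeff r sym_A d"
    proof (rule laurent_coeff_cong[OF _ radii(1)])
      fix w assume "cmod w = r"
      then have "w \<noteq> 0" "w \<noteq> 1" using nonzero_ann[OF sphere_in_ann] by auto
      then have "(inverse w - 1) * (w / (1 - w)) = 1" by (simp add: field_simps)
      then show "(inverse w - 1) * sym_Q w = sym_A w" unfolding sym_Q_def by (metis mult.left_commute mult.right_neutral)
    qed
    finally show ?thesis by (simp add: sym_A_coeff algebra_simps)
  qed
  define k where "k = v 0 - of_real (\<alpha> * q 0)"
  have vk: "v d = of_real (\<alpha> * q d) + k" for d
    by (rule int_function_eqI[where F = v and G = "\<lambda>d. of_real (\<alpha> * q d) + k" and e = 0])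
       (use diff in \<open>auto simp: k_def\<close>)
  obtain C where C: "\<And>d. cmod (v d) \<le> C * r powi (- d)"
    using laurent_coeff_bound[OF cX radii(1)] unfolding v_def by blast
  have "(\<lambda>n. v (- int n)) \<longlonglongrightarrow> 0"
  proof (rule Lim_null_comparison)
    show "\<forall>\<^sub>F n in sequentially. cmod (v (- int n)) \<le> C * r ^ n"
      using C[of "- int _"] by simp
    show "(\<lambda>n. C * r ^ n) \<longlonglongrightarrow> 0"
      using theta radii by (intro tendsto_mult_right_zero LIMSEQ_power_zero) auto
  qed
  moreover have "(\<lambda>n. v (- int n)) \<longlonglongrightarrow> of_real (\<alpha> * 0) + k"
    unfolding vk by (intro tendsto_intros q_limit)
  ultimately have "k = 0" using LIMSEQ_unique by fastforce
  then show ?thesis using vk unfolding v_def by simp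
qed

lemma Q_ker_eq: "complex_of_real (Q_ker \<theta> q x y) = ker sym_Q x y"
  by (simp add: Q_ker_def ker_def sym_Q_coeff \<alpha>_def)

lemma Q_pow_eq: "Q_pow \<theta> q a r k = ker (\<lambda>w. sym_Q w powi k)"
proof (intro ext)
  fix x y
  show "Q_pow \<theta> q a r k x y = ker (\<lambda>w. sym_Q w powi k) x y"
    unfolding Q_pow_def \<alpha>_def[symmetric]
  proof (rule contour_integral_ker)
    fix w assume "w \<in> closed_annulus r \<theta>"
    note nz = nonzero_ann[OF this]
    \<comment> \<open>The shift by \<open>k\<close> in the exponent of \<open>w\<close> is the
      contribution of the factor \<open>w\<close> in \<open>sym_Q\<close>.\<close>
    have "w powi (x - y + 1) = w powi (x - y - k + 1) * w powi k"
      using nz power_int_add[of w "x - y - k + 1" k] by (simp add: algebra_simps)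
    then show "of_real \<alpha> powi k * (of_real \<theta> powi (x - y) / w powi (x - y - k + 1) * (a w / (1 - w)) powi k) =
        of_real \<theta> powi (x - y) * (sym_Q w powi k / w powi (x - y + 1))"
      using nz by (simp add: sym_Q_def sym_A_def power_int_mult_distrib power_int_divide_distrib field_simps)
  qed (use nonzero_ann in \<open>auto intro!: analytic_intros analytic_ann\<close>)
qed

lemma A_pow_eq: "A_pow \<theta> q a r k = ker (\<lambda>w. sym_A w powi k)"
proof (intro ext)
  fix x y
  show "A_pow \<theta> q a r k x y = ker (\<lambda>w. sym_A w powi k) x y"
    unfolding A_pow_def \<alpha>_def[symmetric]
    by (rule contour_integral_ker)
       (use nonzero_ann in \<open>auto intro!: analytic_intros analytic_ann simp: sym_A_def power_int_mult_distrib\<close>)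
qed

lemma R_pow_eq: "R_pow \<theta> \<psi> r e = ker (\<lambda>w. \<psi> w powi e)"
proof (intro ext)
  fix x y
  show "R_pow \<theta> \<psi> r e x y = ker (\<lambda>w. \<psi> w powi e) x y"
    unfolding R_pow_def
    by (rule contour_integral_ker)
       (use nonzero_ann in \<open>auto intro!: analytic_intros analytic_ann\<close>)
qed

lemma Psi_eq: "Psi \<theta> q a \<psi> r y n k x = ker (\<lambda>w. \<psi> w * sym_Q w powi (- k)) x (y (nat (int n - k)))"
  unfolding Psi_def Let_def \<alpha>_def[symmetric]
proof (rule contour_integral_ker)
  let ?d = "x - y (nat (int n - k))"
  fix w assume "w \<in> closed_annulus r \<theta>"
  note nz = nonzero_ann[OF this]
  have "inverse (sym_Q w) = inverse (of_real \<alpha>) * ((1 - w) / a w) * inverse w"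
    using nz by (simp add: sym_Q_def sym_A_def field_simps)
  then have sym_Q: "sym_Q w powi (- k) = of_real \<alpha> powi (- k) * ((1 - w) / a w) powi k * inverse (w powi k)"
    by (simp only: power_int_minus power_int_inverse[symmetric] power_int_mult_distrib)
  have "w powi (?d + k + 1) = w powi (?d + 1) * w powi k"
    using nz power_int_add[of w "?d + 1" k] by (simp add: algebra_simps)
  then show "of_real \<alpha> powi (- k) * (of_real \<theta> powi ?d / w powi (?d + k + 1) * ((1 - w) / a w) powi k * \<psi> w) =
      of_real \<theta> powi ?d * (\<psi> w * sym_Q w powi (- k) / w powi (?d + 1))"
    unfolding sym_Q by (simp add: divide_inverse mult_ac)
qed (use nonzero_ann in \<open>auto intro!: analytic_intros analytic_ann\<close>)

text \<open>The symbol of \<open>R Q^(-l)\<close>, with the factor that acts on polynomials as an \<open>l\<close>-th difference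
  split off.\<close>

definition sym_RQ :: "nat \<Rightarrow> complex \<Rightarrow> complex" where
  "sym_RQ l u = (inverse u - 1) ^ l * (\<psi> u / sym_A u ^ l)"

lemma sym_RQ_analytic: "sym_RQ l analytic_on closed_annulus r rbar"
  unfolding sym_RQ_def using nonzero_Ann by (intro analytic_intros analytic_Ann) auto

lemma Psi_eq_sym_RQ:
  assumes "l \<le> n"
  shows "Psi \<theta> q a \<psi> r y n (int l) x = ker (sym_RQ l) x (y (n - l))"
proof -
  have "\<psi> w * sym_Q w powi (- int l) = sym_RQ l w" if "w \<in> closed_annulus r \<theta>" for w
  proof -
    note nz = nonzero_ann[OF that]
    have "inverse (sym_Q w) = (inverse w - 1) * inverse (sym_A w)" using nz by (simp add: sym_Q_def field_simps)
    moreover have "sym_Q w powi (- int l) = inverse (sym_Q w) ^ l" by (simp add: power_int_minus power_inverse)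
    ultimately show ?thesis
      by (simp add: sym_RQ_def power_mult_distrib power_inverse divide_inverse mult_ac)
  qed
  then have "ker (\<lambda>w. \<psi> w * sym_Q w powi (- int l)) x z = ker (sym_RQ l) x z" for z
    by (rule ker_cong)
  moreover have "nat (int n - int l) = n - l" by simp
  ultimately show ?thesis unfolding Psi_eq by simp
qed

text \<open>\<open>ker_AQ k\<close> is the kernel \<open>A^(-1) Q^k\<close>.\<close>

definition ker_AQ :: "nat \<Rightarrow> kernel" where
  "ker_AQ k = ker (\<lambda>w. sym_A w ^ (k - 1) * (w / (1 - w)) ^ k)"

lemma ker_AQ_analytic: "(\<lambda>w. sym_A w ^ m * (w / (1 - w)) ^ k) analytic_on closed_annulus r \<theta>"
  using nonzero_ann(5) by (intro analytic_intros analytic_ann) auto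

lemma ker_AQ_one: "x \<le> y \<Longrightarrow> ker_AQ 1 x y = 0"
  using laurent_coeff_geometric_power[OF radii(1), of 1 "x - y"] radii theta
  by (simp add: ker_AQ_def ker_def)

lemma has_sum_Q_ker_AQ:
  assumes "0 < k"
  shows "((\<lambda>z. of_real (Q_ker \<theta> q x z) * ker_AQ k z y) has_sum ker_AQ (Suc k) x y) UNIV"
proof -
  have "((\<lambda>z. ker sym_Q x z * ker_AQ k z y) has_sum ker (\<lambda>w. sym_Q w * (sym_A w ^ (k - 1) * (w / (1 - w)) ^ k)) x y) UNIV"
    unfolding ker_AQ_def by (intro has_sum_ker_ker analytic_ann ker_AQ_analytic)
  also have "(\<lambda>w. sym_Q w * (sym_A w ^ (k - 1) * (w / (1 - w)) ^ k)) = (\<lambda>w. sym_A w ^ (Suc k - 1) * (w / (1 - w)) ^ Suc k)"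
    using assms by (cases k) (auto simp: sym_Q_def fun_eq_iff)
  finally show ?thesis unfolding Q_ker_eq ker_AQ_def .
qed

text \<open>Both kernels convolve the coefficients of \<open>sym_A ^ (k - 1)\<close>, which stop at
  \<open>(k - 1) \<kappa>\<close>, with a binomial sequence: truncated on the left-hand side,
  polynomial on the right.\<close>

lemma ker_AQ_eq_pker:
  assumes k: "0 < k" and d: "x - y > int (k - 1) * int \<kappa>"
  shows "ker_AQ k x y = pker k (\<lambda>w. sym_A w ^ (k - 1)) x y"
proof -
  obtain m where m: "k = Suc m" using k by (cases k) auto
  have zero: "laurent_coeff r (\<lambda>w. sym_A w ^ m) j = 0" if "j > int m * int \<kappa>" for j
    by (rule laurent_coeff_power_eq_0[OF analytic_ann(1) radii(1,2) _ that])
       (auto simp: sym_A_coeff q_one)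
  have "((\<lambda>j. laurent_coeff r (\<lambda>w. sym_A w ^ m) j * laurent_coeff r (\<lambda>w. (w / (1 - w)) ^ k) (x - y - j)) has_sum
      laurent_coeff r (\<lambda>w. sym_A w ^ m * (w / (1 - w)) ^ k) (x - y)) UNIV"
    by (rule laurent_coeff_mult[where s = \<theta>])
       (use nonzero_ann(5) radii in \<open>auto intro!: analytic_intros analytic_ann\<close>)
  moreover have "((\<lambda>j. laurent_coeff r (\<lambda>w. sym_A w ^ m) j * pole_coeff \<delta> k (\<lambda>_. 1) (x - y - j)) has_sum
      pole_coeff \<delta> k (\<lambda>u. sym_A u ^ m * 1) (x - y)) UNIV"
    by (intro has_sum_pole_coeff analytic_intros analytic_Ann)
  moreover have "laurent_coeff r (\<lambda>w. sym_A w ^ m) j * laurent_coeff r (\<lambda>w. (w / (1 - w)) ^ k) (x - y - j) =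
      laurent_coeff r (\<lambda>w. sym_A w ^ m) j * pole_coeff \<delta> k (\<lambda>_. 1) (x - y - j)" for j
  proof (cases "j > int m * int \<kappa>")
    \<comment> \<open>Wherever the first factor can be nonzero, the second is evaluated at an index
      at least 1, out of reach of the truncation.\<close>
    case False
    then have "x - y - j \<ge> 1" using d m by simp
    then have "laurent_coeff r (\<lambda>w. (w / (1 - w)) ^ k) (x - y - j) = pole_coeff \<delta> k (\<lambda>_. 1) (x - y - j)"
      unfolding m pole_coeff_gchoose using laurent_coeff_geometric_power[OF radii(1), of "Suc m"] radii theta
      by simp
    then show ?thesis by simp
  qed (simp add: zero)
  ultimately have "laurent_coeff r (\<lambda>w. sym_A w ^ m * (w / (1 - w)) ^ k) (x - y) =
      pole_coeff \<delta> k (\<lambda>u. sym_A u ^ m * 1) (x - y)"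
    using has_sum_unique by simp
  then show ?thesis by (simp add: ker_AQ_def ker_def pker_def m)
qed

section \<open>The kernels \<open>S\<close> and \<open>Sbar\<close> and their contour
  integrals\<close>

lemma S_ker_eq: "S_ker \<theta> q a \<psi> r n = adjoint_ker (ker (\<lambda>w. \<psi> w * sym_Q w powi (- int n) * sym_A w))"
proof -
  have "R_pow \<theta> \<psi> r 1 \<circ>\<^sub>K Q_pow \<theta> q a r (- int n) \<circ>\<^sub>K A_ker \<theta> q =
      ker (\<lambda>w. \<psi> w powi 1 * sym_Q w powi (- int n)) \<circ>\<^sub>K ker sym_A"
    unfolding R_pow_eq Q_pow_eq A_ker_eq using nonzero_ann
    by (subst kcomp_ker_ker) (auto intro!: analytic_intros analytic_ann)
  also have "\<dots> = ker (\<lambda>w. \<psi> w powi 1 * sym_Q w powi (- int n) * sym_A w)"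
    using nonzero_ann by (subst kcomp_ker_ker) (auto intro!: analytic_intros analytic_ann)
  finally show ?thesis by (simp add: S_ker_def)
qed

lemma S_contour_eq:
  assumes "0 < n"
  shows "S_contour \<theta> q a \<psi> r n z1 z2 = ker (\<lambda>w. \<psi> w * sym_Q w powi (- int n) * sym_A w) z2 z1"
  unfolding S_contour_def \<alpha>_def[symmetric]
proof (rule contour_integral_ker)
  let ?d = "z2 - z1"
  fix w assume "w \<in> closed_annulus r \<theta>"
  note nz = nonzero_ann[OF this]
  obtain m where m: "n = Suc m" using assms by (cases n) auto
  have 1: "w powi (?d + int n + 1) = w powi (?d + 1) * w ^ n"
    using nz power_int_add[of w "?d + 1" "int n"] by (simp add: algebra_simps)
  have 3: "sym_Q w powi (- int n) = inverse (sym_Q w ^ n)" by (simp add: power_int_minus)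
  have 2: "of_real \<alpha> powi (- int n + 1) = inverse (complex_of_real \<alpha> ^ m)"
    by (simp add: m power_int_minus)
  show "of_real \<alpha> powi (- int n + 1) * (of_real \<theta> powi ?d / w powi (?d + int n + 1) * ((1 - w) ^ n / a w ^ (n - 1)) * \<psi> w) =
      of_real \<theta> powi ?d * (\<psi> w * sym_Q w powi (- int n) * sym_A w / w powi (?d + 1))"
    unfolding 1 2 3 using nz
    by (simp add: m sym_Q_def sym_A_def power_int_minus power_mult_distrib power_divide field_simps)
qed (use nonzero_ann in \<open>auto intro!: analytic_intros analytic_ann\<close>)

text \<open>The factor \<open>(1 - w) ^ n\<close> stands in the numerator, so 1 is no singularity
  and the integrand is analytic on the annulus up to \<open>rbar\<close>.\<close>

lemma S_contour_radius:
  assumes "r' \<in> {r..<1}"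
  shows "S_contour \<theta> q a \<psi> r n z1 z2 = S_contour \<theta> q a \<psi> r' n z1 z2"
proof -
  have "contour_integral (circlepath 0 r') (\<lambda>w. of_real \<theta> powi (z2 - z1) / w powi (z2 - z1 + int n + 1) *
            ((1 - w) ^ n / a w ^ (n - 1)) * \<psi> w) =
     contour_integral (circlepath 0 r) (\<lambda>w. of_real \<theta> powi (z2 - z1) / w powi (z2 - z1 + int n + 1) *
            ((1 - w) ^ n / a w ^ (n - 1)) * \<psi> w)"
    by (rule contour_integral_circlepath_radius[where s = rbar])
       (use assms radii nonzero_Ann in \<open>auto intro!: analytic_intros analytic_Ann\<close>)
  then show ?thesis by (simp add: S_contour_def)
qed

text \<open>\<open>Sbar_ker n\<close> is the pole kernel of this symbol.\<close>

definition sym_Sbar :: "nat \<Rightarrow> complex \<Rightarrow> complex" where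
  "sym_Sbar n u = sym_A u ^ (n - 1) * (1 / \<psi> u)"

lemma sym_Sbar_analytic: "sym_Sbar n analytic_on closed_annulus r rbar"
  unfolding sym_Sbar_def by (intro analytic_intros analytic_Ann)

lemma Qbar0_eq: "0 < n \<Longrightarrow> Qbar0 \<theta> n = pker n (\<lambda>_. 1)"
  by (intro ext, cases n) (auto simp: Qbar0_def pker_def pole_coeff_gchoose)

text \<open>The \<open>n\<close> factors of \<open>A\<close> in \<open>Qbar\<close> lose one to
  \<open>A^(-1)\<close>, which leaves the exponent \<open>n - 1\<close> of
  \<open>sym_Sbar\<close>.\<close>

lemma Sbar_ker_eq:
  assumes "0 < n"
  shows "Sbar_ker \<theta> q a \<psi> r n = pker n (sym_Sbar n)"
proof -
  obtain m where m: "n = Suc m" using assms by (cases n) auto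
  have powi: "(\<lambda>w. f w powi k) analytic_on closed_annulus r rbar"
    if "f analytic_on closed_annulus r rbar" "\<And>w. w \<in> closed_annulus r rbar \<Longrightarrow> f w \<noteq> 0" for f k
    using that by (intro analytic_intros) auto
  have "Qbar \<theta> q a r n = pker n (\<lambda>w. sym_A w powi int n * 1)"
    unfolding Qbar_def A_pow_eq Qbar0_eq[OF assms] using nonzero_Ann
    by (intro kcomp_ker_pker powi analytic_Ann analytic_intros)
  then have "Sbar_ker \<theta> q a \<psi> r n = pker n (\<lambda>w. sym_A w powi int n * 1) \<circ>\<^sub>K
      ker (\<lambda>w. \<psi> w powi (- 1)) \<circ>\<^sub>K ker (\<lambda>w. sym_A w powi (- 1))"
    unfolding Sbar_ker_def A_pow_eq R_pow_eq by simp
  also have "pker n (\<lambda>w. sym_A w powi int n * 1) \<circ>\<^sub>K ker (\<lambda>w. \<psi> w powi (- 1)) =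
      pker n (\<lambda>w. \<psi> w powi (- 1) * (sym_A w powi int n * 1))"
    by (intro kcomp_pker_ker powi analytic_Ann analytic_on_mult analytic_on_const nonzero_Ann)
  also have "\<dots> \<circ>\<^sub>K ker (\<lambda>w. sym_A w powi (- 1)) =
      pker n (\<lambda>w. sym_A w powi (- 1) * (\<psi> w powi (- 1) * (sym_A w powi int n * 1)))"
    by (intro kcomp_pker_ker powi analytic_Ann analytic_on_mult analytic_on_const nonzero_Ann)
  also have "\<dots> = pker n (sym_Sbar n)"
    by (intro ext pker_cong) (use nonzero_Ann in \<open>auto simp: sym_Sbar_def m power_int_minus field_simps
          simp del: of_nat_Suc\<close>)
  finally show ?thesis .
qed

text \<open>The given radius may be smaller or larger than \<open>\<delta>\<close>. The integrand is
  singular at 0, so the two circles are compared through the annulus between them; analyticity there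
  comes from the hypotheses if \<open>\<delta>'\<close> is the larger radius, and from the choice of
  \<open>\<delta>\<close> otherwise.\<close>

lemma Sbar_contour_eq:
  assumes n: "0 < n" and d: "\<delta>' \<in> {0<..<1}"
    and a: "(\<lambda>w. a (1 - w)) analytic_on cball 0 \<delta>'"
    and psi: "(\<lambda>w. 1 / \<psi> (1 - w)) analytic_on cball 0 \<delta>'"
  shows "Sbar_contour \<theta> q a \<psi> \<delta>' n z1 z2 = pker n (sym_Sbar n) z1 z2"
proof -
  define H where "H w = (1 - w) powi (z2 - z1 + int n - 1) / (of_real \<theta> powi (z2 - z1) * w ^ n) *
            (a (1 - w) ^ (n - 1) / \<psi> (1 - w))" for w
  have H_analytic: "H analytic_on closed_annulus m M" if "0 < m" "M < 1"
    "(\<lambda>w. a (1 - w)) analytic_on cball 0 M" "(\<lambda>w. 1 / \<psi> (1 - w)) analytic_on cball 0 M" for m M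
  proof -
    have sub: "closed_annulus m M \<subseteq> cball 0 M" by (auto simp: closed_annulus_def)
    have 1: "(\<lambda>w. a (1 - w)) analytic_on closed_annulus m M"
      "(\<lambda>w. 1 / \<psi> (1 - w)) analytic_on closed_annulus m M"
      using that sub analytic_on_subset by blast+
    have "(\<lambda>w. (1 - w) powi (z2 - z1 + int n - 1) / (of_real \<theta> powi (z2 - z1) * w ^ n) *
            (a (1 - w) ^ (n - 1) * (1 / \<psi> (1 - w)))) analytic_on closed_annulus m M"
      by (intro analytic_intros 1) (use that(1,2) in \<open>auto simp: closed_annulus_def\<close>)
    then show ?thesis by (simp add: H_def[abs_def])
  qed
  have delta1: "\<delta> < 1" using theta theta_le by linarith
  have "contour_integral (circlepath 0 \<delta>') H = contour_integral (circlepath 0 \<delta>) H"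
  proof (cases "\<delta> \<le> \<delta>'")
    case True
    show ?thesis
      by (rule contour_integral_circlepath_radius[OF H_analytic[OF radii_pos(2) _ a psi]])
         (use True d radii_pos in auto)
  next
    case False
    have "contour_integral (circlepath 0 \<delta>) H = contour_integral (circlepath 0 \<delta>') H"
      by (rule contour_integral_circlepath_radius[OF H_analytic[OF _ delta1]])
         (use False d analytic_reflect[OF analytic_Ann(1)] analytic_reflect[OF analytic_Ann(4)] in auto)
    then show ?thesis ..
  qed
  also have "contour_integral (circlepath 0 \<delta>) H = contour_integral (circlepath 0 \<delta>)
      (\<lambda>w. of_real \<theta> powi (z1 - z2) / of_real \<alpha> ^ (n - 1) *
        ((1 - w) powi (int n - 1 - (z1 - z2)) * sym_Sbar n (1 - w) / w powi (int n - 1 + 1)))"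
  proof (rule contour_integral_circlepath_cong[OF _ radii_pos(2)])
    fix w :: complex assume "cmod w = \<delta>"
    have 1: "of_real \<theta> powi (z1 - z2) = inverse (complex_of_real \<theta> powi (z2 - z1))"
      using power_int_minus[of "complex_of_real \<theta>" "z2 - z1"] by simp
    have 2: "int n - 1 - (z1 - z2) = z2 - z1 + int n - 1" by simp
    show "H w = of_real \<theta> powi (z1 - z2) / of_real \<alpha> ^ (n - 1) *
        ((1 - w) powi (int n - 1 - (z1 - z2)) * sym_Sbar n (1 - w) / w powi (int n - 1 + 1))"
      unfolding 1 2 H_def sym_Sbar_def sym_A_def by (simp add: power_mult_distrib field_simps)
  qed
  also have "\<dots> = of_real \<theta> powi (z1 - z2) / of_real \<alpha> ^ (n - 1) * contour_integral (circlepath 0 \<delta>)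
      (\<lambda>w. (1 - w) powi (int n - 1 - (z1 - z2)) * sym_Sbar n (1 - w) / w powi (int n - 1 + 1))"
    by (rule contour_integral_lmul, rule contour_integrable_circlepath_sphere[OF radii_pos(2)],
        rule continuous_reflect_powi[OF sym_Sbar_analytic])
  finally show ?thesis
    unfolding Sbar_contour_def \<alpha>_def[symmetric] H_def[symmetric] pker_def pole_coeff_def laurent_coeff_def
    by simp
qed

subsection \<open>The biorthogonal family and the hitting problem\<close>

text \<open>Each factor \<open>1 / u - 1\<close> removes one order of the pole, and after
  \<open>n\<close> of them no pole is left. This vanishing is the triangularity of the
  pairing.\<close>

lemma pker_inverse_minus_one_power:
  assumes f: "f analytic_on closed_annulus r rbar"
  shows "pker n (\<lambda>u. (inverse u - 1) ^ l * f u) x y = (if l < n then pker (n - l) f x y else 0)"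
proof (cases "l < n")
  case True
  then show ?thesis
    using pole_coeff_inverse_minus_one_power[of "n - l" l f] by (simp add: pker_def)
next
  case False
  have eq: "(\<lambda>u. (inverse u - 1) ^ l * f u) = (\<lambda>u. (inverse u - 1) ^ n * ((inverse u - 1) ^ (l - n) * f u))"
    using False by (simp add: mult.assoc[symmetric] power_add[symmetric])
  have "pole_coeff \<delta> (0 + n) (\<lambda>u. (inverse u - 1) ^ l * f u) (x - y) = 
      pole_coeff \<delta> 0 (\<lambda>u. (inverse u - 1) ^ (l - n) * f u) (x - y)"
    unfolding eq by (rule pole_coeff_inverse_minus_one_power)
  also have "\<dots> = 0"
    using nonzero_Ann by (intro pole_coeff_zero analytic_intros f) auto
  finally show ?thesis using False by (simp add: pker_def)
qed

lemma psi_sym_A_analytic: "(\<lambda>u. \<psi> u / sym_A u ^ l) analytic_on closed_annulus r rbar"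
  using nonzero_Ann by (intro analytic_intros analytic_Ann) auto

definition weighted_poly :: "complex poly \<Rightarrow> int \<Rightarrow> complex" where
  "weighted_poly p x = of_real \<theta> powi (- x) * poly p (of_int x)"

definition Psi_pairing :: "(nat \<Rightarrow> int) \<Rightarrow> nat \<Rightarrow> nat \<Rightarrow> complex poly \<Rightarrow> complex" where
  "Psi_pairing y n l p = (\<Sum>\<^sub>\<infinity>x. ker (sym_RQ l) x (y (n - l)) * weighted_poly p x)"

text \<open>The basis consists of the polynomials \<open>- 1 - x gchoose m\<close>, because with the
  weight these are rows of pole kernels: pairing one with a symbol kernel is then a composition,
  governed by the calculus of symbols.\<close>

lemma binomial_basis:
  "\<exists>b :: nat \<Rightarrow> complex poly. \<forall>m. degree (b m) = m \<and> b m \<noteq> 0 \<and>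
     (\<forall>x. weighted_poly (b m) x = pker (Suc m) (\<lambda>_. 1) 0 x)"
proof -
  have "\<exists>b :: complex poly. degree b = m \<and> b \<noteq> 0 \<and>
     (\<forall>x. weighted_poly b x = pker (Suc m) (\<lambda>_. 1) 0 x)" for m
  proof -
    obtain p :: "complex poly" where p: "degree p = m" "p \<noteq> 0" "\<And>x. poly p x = x gchoose m"
      using gchoose_polynomial by metis
    define b where "b = pcompose p [:- 1, - 1:]"
    have "weighted_poly b x = pker (Suc m) (\<lambda>_. 1) 0 x" for x
    proof -
      have e: "of_int (0 - x - 1) = (- 1 - of_int x :: complex)" by simp
      show ?thesis
        unfolding weighted_poly_def b_def poly_pcompose p(3) pker_def pole_coeff_gchoose e by simp
    qed
    moreover have "degree b = m" by (simp add: b_def degree_pcompose p)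
    moreover have "b \<noteq> 0" using p(2) pcompose_eq_0[of p "[:- 1, - 1:]"] by (auto simp: b_def)
    ultimately show ?thesis by blast
  qed
  then show ?thesis by metis
qed

lemma has_sum_basis:
  assumes "\<And>x. weighted_poly b x = pker (Suc m) (\<lambda>_. 1) 0 x"
  shows "((\<lambda>x. ker (sym_RQ l) x z * weighted_poly b x) has_sum
    (if l \<le> m then pker (Suc m - l) (\<lambda>u. \<psi> u / sym_A u ^ l) 0 z else 0)) UNIV"
proof -
  have "((\<lambda>x. pker (Suc m) (\<lambda>_. 1) 0 x * ker (sym_RQ l) x z) has_sum
      pker (Suc m) (\<lambda>u. sym_RQ l u * 1) 0 z) UNIV"
    by (intro has_sum_pker_ker sym_RQ_analytic analytic_intros)
  moreover have "pker (Suc m) (\<lambda>u. sym_RQ l u * 1) 0 z =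
      (if l \<le> m then pker (Suc m - l) (\<lambda>u. \<psi> u / sym_A u ^ l) 0 z else 0)"
    using pker_inverse_minus_one_power[OF psi_sym_A_analytic[of l], of "Suc m" l 0 z]
    by (simp add: sym_RQ_def less_Suc_eq_le)
  ultimately show ?thesis by (simp add: assms mult.commute)
qed

lemma weighted_poly_add: "weighted_poly (p + p') x = weighted_poly p x + weighted_poly p' x"
  by (simp add: weighted_poly_def algebra_simps)

lemma weighted_poly_smult: "weighted_poly (smult k p) x = k * weighted_poly p x"
  by (simp add: weighted_poly_def)

lemma weighted_poly_sum: "weighted_poly (\<Sum>i\<in>A. p i) x = (\<Sum>i\<in>A. weighted_poly (p i) x)"
  by (simp add: weighted_poly_def poly_sum sum_distrib_left)

text \<open>Convergence passes by linearity from the basis to all polynomials. It guarantees that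
  the \<open>infsum\<close> in \<open>Psi_pairing\<close> is a genuine sum and not its default value
  0.\<close>

lemma summable_ker_weighted_poly: "(\<lambda>x. ker (sym_RQ l) x z * weighted_poly p x) summable_on UNIV"
proof -
  obtain b :: "nat \<Rightarrow> complex poly" where b: "\<And>m. degree (b m) = m" "\<And>m. b m \<noteq> 0"
    "\<And>m x. weighted_poly (b m) x = pker (Suc m) (\<lambda>_. 1) 0 x"
    using binomial_basis by metis
  show ?thesis
  proof (rule poly_triangular_induct[where b = b, OF b(1,2)])
    show "(\<lambda>x. ker (sym_RQ l) x z * weighted_poly (b m) x) summable_on UNIV" for m
      using has_sum_basis[OF b(3)] by (auto intro: has_sum_imp_summable)
    show "(\<lambda>x. ker (sym_RQ l) x z * weighted_poly (p + p') x) summable_on UNIV"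
      if "(\<lambda>x. ker (sym_RQ l) x z * weighted_poly p x) summable_on UNIV"
         "(\<lambda>x. ker (sym_RQ l) x z * weighted_poly p' x) summable_on UNIV" for p p'
      using summable_on_add[OF that] by (simp add: weighted_poly_add algebra_simps)
    show "(\<lambda>x. ker (sym_RQ l) x z * weighted_poly (smult k p) x) summable_on UNIV"
      if "(\<lambda>x. ker (sym_RQ l) x z * weighted_poly p x) summable_on UNIV" for k p
      using summable_on_cmult_right[OF that, of k] by (simp add: weighted_poly_smult algebra_simps)
  qed
qed

lemma has_sum_Psi_pairing: "((\<lambda>x. ker (sym_RQ l) x (y (n - l)) * weighted_poly p x) has_sum Psi_pairing y n l p) UNIV"
  unfolding Psi_pairing_def by (intro has_sum_infsum summable_ker_weighted_poly)

lemma triangular_Psi_pairing: "\<exists>b. triangular_functionals (Psi_pairing y n) b n"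
proof -
  obtain b :: "nat \<Rightarrow> complex poly" where b: "\<And>m. degree (b m) = m" "\<And>m. b m \<noteq> 0"
    "\<And>m x. weighted_poly (b m) x = pker (Suc m) (\<lambda>_. 1) 0 x"
    using binomial_basis by metis
  have Sb: "Psi_pairing y n l (b m) = (if l \<le> m then pker (Suc m - l) (\<lambda>u. \<psi> u / sym_A u ^ l) 0 (y (n - l)) else 0)" for l m
    unfolding Psi_pairing_def by (intro infsumI has_sum_basis b)
  have "triangular_functionals (Psi_pairing y n) b n"
  proof
    show "Psi_pairing y n l (p + p') = Psi_pairing y n l p + Psi_pairing y n l p'" for l p p'
      using has_sum_add[OF has_sum_Psi_pairing has_sum_Psi_pairing, of l y n p l y n p']
      unfolding Psi_pairing_def by (intro infsumI) (simp add: weighted_poly_add algebra_simps)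
    show "Psi_pairing y n l (smult k p) = k * Psi_pairing y n l p" for l k p
      using has_sum_cmult_right[OF has_sum_Psi_pairing, of k l y n p]
      unfolding Psi_pairing_def by (intro infsumI) (simp add: weighted_poly_smult algebra_simps)
    show "Psi_pairing y n l (b m) = 0" if "m < l" for l m using that by (simp add: Sb)
    \<comment> \<open>On the diagonal a simple pole remains, which contributes the value of
      \<open>\<psi> / sym_A ^ l\<close> at 1; the annulus contains 1, and neither function vanishes
      there.\<close>
    show "Psi_pairing y n l (b l) \<noteq> 0" for l
      using pole_coeff_one[OF psi_sym_A_analytic[of l]] nonzero_Ann[OF one_in_Ann]
      by (simp add: Sb pker_def)
  qed (use b in auto)
  then show ?thesis by blast
qed

lemma biorthogonal_iff:
  "biorthogonal \<theta> n (Psi \<theta> q a \<psi> r y n) \<Phi> \<longleftrightarrow>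
     (\<forall>k<n. \<exists>p. degree p = k \<and> (\<forall>x. \<Phi> k x = weighted_poly p x) \<and>
       (\<forall>l<n. Psi_pairing y n l p = (if l = k then 1 else 0)))"
proof -
  have poly: "(\<forall>x. complex_of_real \<theta> powi x * \<Phi> k x = poly p (of_int x)) \<longleftrightarrow>
      (\<forall>x. \<Phi> k x = weighted_poly p x)" for k p
    by (simp add: weighted_poly_def power_int_minus field_simps)
  have sum: "((\<lambda>x. Psi \<theta> q a \<psi> r y n (int l) x * \<Phi> k x) has_sum v) UNIV \<longleftrightarrow> Psi_pairing y n l p = v"
    if "l < n" "\<forall>x. \<Phi> k x = weighted_poly p x" for k l p v
  proof -
    have "(\<lambda>x. Psi \<theta> q a \<psi> r y n (int l) x * \<Phi> k x) =
        (\<lambda>x. ker (sym_RQ l) x (y (n - l)) * weighted_poly p x)"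
      using that Psi_eq_sym_RQ[of l n y] by simp
    then show ?thesis using has_sum_Psi_pairing[of l y n p] has_sum_unique by auto
  qed
  show ?thesis
  proof
    assume L: "biorthogonal \<theta> n (Psi \<theta> q a \<psi> r y n) \<Phi>"
    show "\<forall>k<n. \<exists>p. degree p = k \<and> (\<forall>x. \<Phi> k x = weighted_poly p x) \<and>
       (\<forall>l<n. Psi_pairing y n l p = (if l = k then 1 else 0))"
    proof (intro allI impI)
      fix k assume k: "k < n"
      then obtain p where p: "degree p = k" "\<forall>x. \<Phi> k x = weighted_poly p x"
        using L unfolding biorthogonal_def poly by blast
      have "Psi_pairing y n l p = (if l = k then 1 else 0)" if "l < n" for l
        using L k that sum[OF that p(2)] unfolding biorthogonal_def by (auto split: if_splits)
      then show "\<exists>p. degree p = k \<and> (\<forall>x. \<Phi> k x = weighted_poly p x) \<and>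
         (\<forall>l<n. Psi_pairing y n l p = (if l = k then 1 else 0))"
        using p by blast
    qed
  next
    assume R: "\<forall>k<n. \<exists>p. degree p = k \<and> (\<forall>x. \<Phi> k x = weighted_poly p x) \<and>
       (\<forall>l<n. Psi_pairing y n l p = (if l = k then 1 else 0))"
    show "biorthogonal \<theta> n (Psi \<theta> q a \<psi> r y n) \<Phi>"
      unfolding biorthogonal_def poly
    proof (intro conjI allI impI)
      fix k assume k: "k < n"
      then obtain p where p: "degree p = k" "\<forall>x. \<Phi> k x = weighted_poly p x"
        "\<forall>l<n. Psi_pairing y n l p = (if l = k then 1 else 0)"
        using R by blast
      show "\<exists>p. degree p = k \<and> (\<forall>x. \<Phi> k x = weighted_poly p x)" using p by blast
      show "((\<lambda>x. Psi \<theta> q a \<psi> r y n (int l) x * \<Phi> k x) has_sum (if k = l then 1 else 0)) UNIV"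
        if "l < n" for l
        using p(3) that unfolding sum[OF that p(2)] by auto
    qed
  qed
qed

lemma Psi_pairing_eqI:
  assumes "degree p < n" "degree p' < n" "\<And>l. l < n \<Longrightarrow> Psi_pairing y n l p = Psi_pairing y n l p'"
  shows "p = p'"
proof -
  obtain b where "triangular_functionals (Psi_pairing y n) b n" using triangular_Psi_pairing by blast
  then interpret triangular_functionals "Psi_pairing y n" b n .
  have "p - p' = 0"
    using assms by (intro eq_0_if_functionals_0) (auto simp: S_diff intro: degree_diff_less)
  then show ?thesis by simp
qed

text \<open>Identifies \<open>Phi\<close> from pairings alone: a degree below \<open>n\<close>
  suffices, as uniqueness turns \<open>p\<close> into the member of the dual basis, whose degree is
  \<open>k\<close>.\<close>

lemma Phi_eqI:
  assumes k: "k < n" and p: "degree p < n" "\<And>l. l < n \<Longrightarrow> Psi_pairing y n l p = (if l = k then 1 else 0)"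
  shows "Phi \<theta> q a \<psi> r y n k x = weighted_poly p x"
proof -
  obtain b where "triangular_functionals (Psi_pairing y n) b n" using triangular_Psi_pairing by blast
  then interpret triangular_functionals "Psi_pairing y n" b n .
  obtain \<phi> where \<phi>: "\<forall>k<n. degree (\<phi> k) = k \<and> (\<forall>l<n. Psi_pairing y n l (\<phi> k) = (if l = k then 1 else 0))"
    using dual_basis by blast
  have "\<phi> k = p"
    using \<phi> k p by (intro Psi_pairing_eqI[of _ n _ y]) auto
  have "Phi \<theta> q a \<psi> r y n k = weighted_poly p"
    unfolding Phi_def
  proof (rule the_equality)
    have "biorthogonal \<theta> n (Psi \<theta> q a \<psi> r y n) (\<lambda>k. weighted_poly (\<phi> k))"
      unfolding biorthogonal_iff using \<phi> by blast
    then show "\<exists>\<Phi>. biorthogonal \<theta> n (Psi \<theta> q a \<psi> r y n) \<Phi> \<and> weighted_poly p = \<Phi> k"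
      using \<open>\<phi> k = p\<close> by blast
  next
    fix f assume "\<exists>\<Phi>. biorthogonal \<theta> n (Psi \<theta> q a \<psi> r y n) \<Phi> \<and> f = \<Phi> k"
    then obtain p' where p': "degree p' = k" "\<forall>x. f x = weighted_poly p' x"
      "\<forall>l<n. Psi_pairing y n l p' = (if l = k then 1 else 0)"
      unfolding biorthogonal_iff using k by blast
    have "p' = p" using p' p k by (intro Psi_pairing_eqI[of _ n _ y]) auto
    then show "f = weighted_poly p" using p' by auto
  qed
  then show ?thesis by simp
qed

lemma Phi_family:
  obtains \<phi> where "\<And>k. k < n \<Longrightarrow> degree (\<phi> k) = k"
    "\<And>k l. k < n \<Longrightarrow> l < n \<Longrightarrow> Psi_pairing y n l (\<phi> k) = (if l = k then 1 else 0)"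
    "\<And>k x. k < n \<Longrightarrow> Phi \<theta> q a \<psi> r y n k x = weighted_poly (\<phi> k) x"
proof -
  obtain b where "triangular_functionals (Psi_pairing y n) b n" using triangular_Psi_pairing by blast
  then interpret triangular_functionals "Psi_pairing y n" b n .
  obtain \<phi> where \<phi>: "\<forall>k<n. degree (\<phi> k) = k \<and> (\<forall>l<n. Psi_pairing y n l (\<phi> k) = (if l = k then 1 else 0))"
    using dual_basis by blast
  show thesis
    by (rule that[of \<phi>]) (use \<phi> in \<open>auto intro!: Phi_eqI\<close>)
qed

text \<open>\<open>Psi l\<close> for horizon \<open>n\<close> sees \<open>y\<close> only at
  \<open>n - l\<close>, so raising the horizon by one and shifting \<open>y\<close> cancel out for
  \<open>l < n\<close>. The larger system adds the pairing with \<open>l = n\<close>, while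
  uniqueness in the smaller one asks only for \<open>l < n\<close>.\<close>

lemma Phi_shift:
  assumes k: "k < n"
  shows "Phi \<theta> q a \<psi> r (\<lambda>j. y (Suc j)) n k x = Phi \<theta> q a \<psi> r y (Suc n) k x"
proof -
  obtain \<phi> where \<phi>: "\<And>k. k < Suc n \<Longrightarrow> degree (\<phi> k) = k"
    "\<And>k l. k < Suc n \<Longrightarrow> l < Suc n \<Longrightarrow> Psi_pairing y (Suc n) l (\<phi> k) = (if l = k then 1 else 0)"
    "\<And>k x. k < Suc n \<Longrightarrow> Phi \<theta> q a \<psi> r y (Suc n) k x = weighted_poly (\<phi> k) x"
    using Phi_family[of "Suc n" y] by blast
  have "Psi_pairing (\<lambda>j. y (Suc j)) n l (\<phi> k) = Psi_pairing y (Suc n) l (\<phi> k)" if "l < n" for l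
    using that by (simp add: Psi_pairing_def Suc_diff_le)
  then have "Phi \<theta> q a \<psi> r (\<lambda>j. y (Suc j)) n k x = weighted_poly (\<phi> k) x"
    using k \<phi> by (intro Phi_eqI) auto
  then show ?thesis using \<phi>(3) k by simp
qed

lemma pker_weighted_poly:
  assumes f: "f analytic_on closed_annulus r rbar" and n: "0 < n"
  obtains p where "degree p < n" "\<And>x. pker n f z x = weighted_poly p x"
proof -
  obtain p0 where p0: "degree p0 < n" "\<And>d. pole_coeff \<delta> n f d = poly p0 (of_int d)"
    using pole_coeff_polynomial[OF f n] by blast
  define p where "p = smult (of_real \<theta> powi z) (pcompose p0 [:of_int z, - 1:])"
  have "degree p \<le> degree p0"
    unfolding p_def using degree_pcompose_le[of p0 "[:of_int z, - 1:]"]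
    by (intro order_trans[OF degree_smult_le]) auto
  then have "degree p < n" using p0(1) by simp
  moreover have "pker n f z x = weighted_poly p x" for x
  proof -
    have "complex_of_real \<theta> powi (z - x) = of_real \<theta> powi z * of_real \<theta> powi (- x)"
      using power_int_add[of "complex_of_real \<theta>" z "- x"] by simp
    then show ?thesis
      by (simp add: pker_def p0 weighted_poly_def p_def poly_pcompose)
  qed
  ultimately show thesis using that by blast
qed

text \<open>The coordinates of \<open>Sbar_ker n z\<close> in the basis \<open>Phi\<close> are read off by pairing with \<open>Psi\<close>.\<close>

lemma Sbar_expansion:
  assumes n: "0 < n"
  shows "Sbar_ker \<theta> q a \<psi> r n z x =
    (\<Sum>k=1..n. pker k (\<lambda>w. sym_A w ^ (k - 1)) z (y k) * Phi \<theta> q a \<psi> r y n (n - k) x)"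
proof -
  obtain b where "triangular_functionals (Psi_pairing y n) b n" using triangular_Psi_pairing by blast
  then interpret triangular_functionals "Psi_pairing y n" b n .
  obtain \<phi> where \<phi>: "\<And>k. k < n \<Longrightarrow> degree (\<phi> k) = k"
    "\<And>k l. k < n \<Longrightarrow> l < n \<Longrightarrow> Psi_pairing y n l (\<phi> k) = (if l = k then 1 else 0)"
    "\<And>k x. k < n \<Longrightarrow> Phi \<theta> q a \<psi> r y n k x = weighted_poly (\<phi> k) x"
    using Phi_family[of n y] by blast
  obtain p where p: "degree p < n" "\<And>x. pker n (sym_Sbar n) z x = weighted_poly p x"
    using pker_weighted_poly[OF sym_Sbar_analytic n] by blast
  have Sp: "Psi_pairing y n l p = pker (n - l) (\<lambda>w. sym_A w ^ (n - l - 1)) z (y (n - l))" if l: "l < n" for l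
  proof -
    have "((\<lambda>x. pker n (sym_Sbar n) z x * ker (sym_RQ l) x (y (n - l))) has_sum
        pker n (\<lambda>u. sym_RQ l u * sym_Sbar n u) z (y (n - l))) UNIV"
      by (intro has_sum_pker_ker sym_RQ_analytic sym_Sbar_analytic)
    then have "((\<lambda>x. ker (sym_RQ l) x (y (n - l)) * weighted_poly p x) has_sum
        pker n (\<lambda>u. sym_RQ l u * sym_Sbar n u) z (y (n - l))) UNIV"
      by (simp add: p(2) mult.commute)
    from has_sum_unique[OF has_sum_Psi_pairing[of l y n p] this]
    have "Psi_pairing y n l p = pker n (\<lambda>u. sym_RQ l u * sym_Sbar n u) z (y (n - l))" .
    \<comment> \<open>\<open>\<psi>\<close> cancels, and so do \<open>l\<close> powers of
      \<open>sym_A\<close>; what stays of \<open>sym_RQ l\<close> is the \<open>l\<close>-th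
      difference, which lowers the order of the pole from \<open>n\<close> to
      \<open>n - l\<close>.\<close>
    also have "\<dots> = pker n (\<lambda>u. (inverse u - 1) ^ l * sym_A u ^ (n - l - 1)) z (y (n - l))"
    proof (rule pker_cong)
      fix u assume "u \<in> closed_annulus r rbar"
      note nz = nonzero_Ann[OF this]
      have "sym_A u ^ (n - 1) = sym_A u ^ (n - l - 1) * sym_A u ^ l"
        using l by (simp add: power_add[symmetric])
      then show "sym_RQ l u * sym_Sbar n u = (inverse u - 1) ^ l * sym_A u ^ (n - l - 1)"
        using nz by (simp add: sym_RQ_def sym_Sbar_def)
    qed
    also have "\<dots> = pker (n - l) (\<lambda>w. sym_A w ^ (n - l - 1)) z (y (n - l))"
      using l by (subst pker_inverse_minus_one_power) (auto intro!: analytic_intros analytic_Ann)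
    finally show ?thesis .
  qed
  have "p = (\<Sum>k<n. smult (Psi_pairing y n k p) (\<phi> k))"
  proof (rule Psi_pairing_eqI[where n = n and y = y])
    have "degree (\<Sum>k<n. smult (Psi_pairing y n k p) (\<phi> k)) \<le> n - 1"
    proof (rule degree_sum_le)
      fix k assume "k \<in> {..<n}"
      then show "degree (smult (Psi_pairing y n k p) (\<phi> k)) \<le> n - 1"
        using degree_smult_le[of "Psi_pairing y n k p" "\<phi> k"] \<phi>(1)[of k] by simp
    qed simp
    then show "degree (\<Sum>k<n. smult (Psi_pairing y n k p) (\<phi> k)) < n" using n by linarith
    show "Psi_pairing y n l p = Psi_pairing y n l (\<Sum>k<n. smult (Psi_pairing y n k p) (\<phi> k))" if "l < n" for l
    proof -
      have "Psi_pairing y n l (\<Sum>k<n. smult (Psi_pairing y n k p) (\<phi> k)) = (\<Sum>k<n. Psi_pairing y n k p * Psi_pairing y n l (\<phi> k))"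
        using that by (simp add: S_sum S_smult)
      also have "\<dots> = (\<Sum>k<n. if l = k then Psi_pairing y n k p else 0)"
        by (intro sum.cong refl) (use that \<phi>(2) in auto)
      finally show ?thesis using that by simp
    qed
  qed (rule p)
  then have "weighted_poly p x = (\<Sum>k<n. Psi_pairing y n k p * weighted_poly (\<phi> k) x)"
    using weighted_poly_sum[of "\<lambda>k. smult (Psi_pairing y n k p) (\<phi> k)" "{..<n}" x]
    by (simp add: weighted_poly_smult)
  then have "Sbar_ker \<theta> q a \<psi> r n z x = (\<Sum>l<n.
      pker (n - l) (\<lambda>w. sym_A w ^ (n - l - 1)) z (y (n - l)) * Phi \<theta> q a \<psi> r y n l x)"
    unfolding Sbar_ker_eq[OF n] p(2) using \<phi>(3) by (simp add: Sp)
  also have "\<dots> = (\<Sum>k=1..n. pker k (\<lambda>w. sym_A w ^ (k - 1)) z (y k) * Phi \<theta> q a \<psi> r y n (n - k) x)"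
    by (rule sum.reindex_bij_witness[of _ "\<lambda>k. n - k" "\<lambda>l. n - l"]) auto
  finally show ?thesis .
qed

section \<open>The stopped expectation in the basis \<open>Phi\<close>\<close>

lemma Sbar_bounded:
  assumes "0 < k"
  shows "\<exists>C. \<forall>b\<ge>d. cmod (Sbar_ker \<theta> q a \<psi> r k b x) \<le> C"
proof -
  obtain C where C: "\<forall>b\<ge>d - x. cmod (of_real \<theta> powi b * pole_coeff \<delta> k (sym_Sbar k) b) \<le> C"
    using pole_coeff_bounded[OF sym_Sbar_analytic theta(1) theta_le] by blast
  then have "\<forall>b\<ge>d. cmod (Sbar_ker \<theta> q a \<psi> r k b x) \<le> C"
    unfolding Sbar_ker_eq[OF assms] pker_def by simp
  then show ?thesis by blast
qed

lemma gaps_sum: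
  fixes y :: "nat \<Rightarrow> int"
  assumes "\<And>j. 1 \<le> j \<Longrightarrow> j < n \<Longrightarrow> y j - y (j + 1) \<ge> int \<kappa>" "1 \<le> k" "k \<le> n"
  shows "y 1 - y k \<ge> int (k - 1) * int \<kappa>"
  using assms(2,3)
proof (induction k rule: dec_induct)
  case (step k)
  have "y k - y (k + 1) \<ge> int \<kappa>" using assms(1)[of k] step by simp
  moreover have "y 1 - y k \<ge> int (k - 1) * int \<kappa>" using step by simp
  moreover have "int (Suc k - 1) * int \<kappa> = int (k - 1) * int \<kappa> + int \<kappa>"
    using step(1) by (cases k) (auto simp: algebra_simps)
  ultimately show ?case by simp
qed simp

theorem epi_expansion:
  assumes walk: "\<And>z. random_walk_from (Q_ker \<theta> q) z (P z) B"
    and gaps: "\<And>j. 1 \<le> j \<Longrightarrow> j < n \<Longrightarrow> y j - y (j + 1) \<ge> int \<kappa>"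
  shows "epi_ker P B (Sbar_ker \<theta> q a \<psi> r) y n z x =
    (\<Sum>k=1..n. ker_AQ k z (y k) * Phi \<theta> q a \<psi> r y n (n - k) x)"
  using gaps
\<comment> \<open>The boundary has to vary in the induction, since a step of the walk consumes its
  first point.\<close>
proof (induction n arbitrary: y z)
  case 0
  then show ?case by (simp add: epi_ker_def stopped_value_0)
next
  case (Suc n)
  obtain K where K: "\<And>x y. Q_ker \<theta> q x y = pmf (K x) y" using Q_ker_pmf by blast
  have bd: "\<exists>C. \<forall>b\<ge>d. cmod (Sbar_ker \<theta> q a \<psi> r k b x) \<le> C" if "0 < k" "k \<le> Suc n" for k d
    using that(1) by (rule Sbar_bounded)
  note epi = epi_ker_Suc[where P = P and B = B and S = "Sbar_ker \<theta> q a \<psi> r" and n = n and y = y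
      and z = z and x = x and Q = "Q_ker \<theta> q" and K = K]
  show ?case
  proof (cases "z > y 1")
    case True
    \<comment> \<open>Here the walk stops at time 0. The gaps add up to
      \<open>z - y k > (k - 1) \<kappa>\<close>, which turns the terms of
      \<open>Sbar_expansion\<close> into \<open>ker_AQ\<close>.\<close>
    have "ker_AQ k z (y k) = pker k (\<lambda>w. sym_A w ^ (k - 1)) z (y k)" if "k \<in> {1..Suc n}" for k
    proof (rule ker_AQ_eq_pker)
      have "y 1 - y k \<ge> int (k - 1) * int \<kappa>"
        using gaps_sum[of "Suc n" y k] Suc.prems that by simp
      then show "z - y k > int (k - 1) * int \<kappa>" using True by simp
    qed (use that in auto)
    then show ?thesis
      using epi(1) walk K bd True Sbar_expansion[of "Suc n" z x y] by simp
  next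
    case False
    let ?y = "\<lambda>j. y (Suc j)"
    have IH: "epi_ker P B (Sbar_ker \<theta> q a \<psi> r) ?y n b x =
        (\<Sum>k=1..n. ker_AQ k b (y (Suc k)) * Phi \<theta> q a \<psi> r y (Suc n) (n - k) x)" for b
    proof -
      have "epi_ker P B (Sbar_ker \<theta> q a \<psi> r) ?y n b x =
          (\<Sum>k=1..n. ker_AQ k b (?y k) * Phi \<theta> q a \<psi> r ?y n (n - k) x)"
        by (rule Suc.IH) (use Suc.prems in auto)
      then show ?thesis by (auto simp: Phi_shift)
    qed
    \<comment> \<open>The finite sum is composed with \<open>Q\<close> term by term:
      \<open>A^(-1) Q^k\<close> at the shifted boundary point becomes
      \<open>A^(-1) Q^(k + 1)\<close> at \<open>y (k + 1)\<close>.\<close>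
    have "((\<lambda>b. \<Sum>k=1..n. (of_real (Q_ker \<theta> q z b) * ker_AQ k b (y (Suc k))) * Phi \<theta> q a \<psi> r y (Suc n) (n - k) x)
        has_sum (\<Sum>k=1..n. ker_AQ (Suc k) z (y (Suc k)) * Phi \<theta> q a \<psi> r y (Suc n) (n - k) x)) UNIV"
      by (intro has_sum_finite_sum has_sum_cmult_left has_sum_Q_ker_AQ) auto
    moreover have "((\<lambda>b. \<Sum>k=1..n. (of_real (Q_ker \<theta> q z b) * ker_AQ k b (y (Suc k))) * Phi \<theta> q a \<psi> r y (Suc n) (n - k) x)
        has_sum epi_ker P B (Sbar_ker \<theta> q a \<psi> r) y (Suc n) z x) UNIV"
      using epi(2) walk K bd False unfolding IH by (simp add: sum_distrib_left mult.assoc)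
    ultimately have "epi_ker P B (Sbar_ker \<theta> q a \<psi> r) y (Suc n) z x =
        (\<Sum>k=1..n. ker_AQ (Suc k) z (y (Suc k)) * Phi \<theta> q a \<psi> r y (Suc n) (Suc n - Suc k) x)"
      using has_sum_unique by fastforce
    also have "\<dots> = (\<Sum>k=2..Suc n. ker_AQ k z (y k) * Phi \<theta> q a \<psi> r y (Suc n) (Suc n - k) x)"
      using sum.shift_bounds_cl_Suc_ivl[of "\<lambda>k. ker_AQ k z (y k) * Phi \<theta> q a \<psi> r y (Suc n) (Suc n - k) x" 1 n]
      by (simp add: numeral_2_eq_2)
    also have "\<dots> = (\<Sum>k=1..Suc n. ker_AQ k z (y k) * Phi \<theta> q a \<psi> r y (Suc n) (Suc n - k) x)"
    proof -
      have "(\<Sum>k=1..Suc n. ker_AQ k z (y k) * Phi \<theta> q a \<psi> r y (Suc n) (Suc n - k) x) =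
          ker_AQ 1 z (y 1) * Phi \<theta> q a \<psi> r y (Suc n) (Suc n - 1) x +
          (\<Sum>k=Suc 1..Suc n. ker_AQ k z (y k) * Phi \<theta> q a \<psi> r y (Suc n) (Suc n - k) x)"
        by (rule sum.atLeast_Suc_atMost) simp
      \<comment> \<open>From a start at or below \<open>y 1\<close> this entry vanishes, so the term
        missing after the index shift may be added.\<close>
      moreover have "ker_AQ 1 z (y 1) = 0" using ker_AQ_one False by simp
      ultimately show ?thesis by (simp only: Suc_1 mult_zero_left add_0)
    qed
    finally show ?thesis .
  qed
qed

text \<open>\<open>A\<close> meets \<open>A^(-1)\<close>, leaving \<open>R Q^(k - n)\<close>. The
  exponent can have either sign, since \<open>k\<close> may exceed \<open>n\<close>, whence the
  integer powers in \<open>Psi\<close>.\<close>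

lemma has_sum_S_ker_AQ:
  assumes k: "1 \<le> k"
  shows "((\<lambda>z. adjoint_ker (S_ker \<theta> q a \<psi> r n) x z * ker_AQ k z (y k)) has_sum
    Psi \<theta> q a \<psi> r y n (int n - int k) x) UNIV"
proof -
  have "((\<lambda>z. ker (\<lambda>w. \<psi> w * sym_Q w powi (- int n) * sym_A w) x z * ker_AQ k z (y k)) has_sum
      ker (\<lambda>w. \<psi> w * sym_Q w powi (- int n) * sym_A w * (sym_A w ^ (k - 1) * (w / (1 - w)) ^ k)) x (y k)) UNIV"
    unfolding ker_AQ_def using nonzero_ann
    by (intro has_sum_ker_ker ker_AQ_analytic) (auto intro!: analytic_intros analytic_ann)
  moreover have "ker (\<lambda>w. \<psi> w * sym_Q w powi (- int n) * sym_A w * (sym_A w ^ (k - 1) * (w / (1 - w)) ^ k)) x (y k) =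
      ker (\<lambda>w. \<psi> w * sym_Q w powi (- (int n - int k))) x (y k)"
  proof (rule ker_cong)
    fix w assume "w \<in> closed_annulus r \<theta>"
    note nz = nonzero_ann[OF this]
    have "sym_A w * (sym_A w ^ (k - 1) * (w / (1 - w)) ^ k) = sym_Q w ^ k"
      unfolding sym_Q_def power_mult_distrib using k by (cases k) (simp_all only: diff_Suc_1 power_Suc mult.assoc)
    moreover have "sym_Q w powi (- (int n - int k)) = sym_Q w powi (- int n) * sym_Q w ^ k"
      using nz power_int_add[of "sym_Q w" "- int n" "int k"] by (simp add: algebra_simps)
    ultimately show "\<psi> w * sym_Q w powi (- int n) * sym_A w * (sym_A w ^ (k - 1) * (w / (1 - w)) ^ k) =
        \<psi> w * sym_Q w powi (- (int n - int k))"
      by (simp only: mult.assoc)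
  qed
  ultimately show ?thesis
    unfolding S_ker_eq Psi_eq by (simp add: adjoint_ker_def)
qed

end

text \<open>Integrals of non-integrable functions and divergent unordered sums take the default
  value 0. Integrability of the stopped value and summability of the final composition are therefore
  part of the claim, so that its formula cannot rest on such a default. The walk enters through any
  family of laws \<open>P z\<close> under which \<open>B\<close> is the chain started at
  \<open>z\<close>.\<close>

theorem theorem5p15:
  fixes \<kappa> nbar :: nat and \<theta> r rbar :: real and q :: "int \<Rightarrow> real"
    and a \<psi> :: "complex \<Rightarrow> complex" and y :: "nat \<Rightarrow> int"
    and P :: "int \<Rightarrow> 'w measure" and B :: "nat \<Rightarrow> 'w \<Rightarrow> int"
  assumes theta: "0 < \<theta>" "\<theta> < 1"
    and q_nonneg: "\<And>i. q i \<ge> 0"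
    and q_one: "\<And>i. i > int \<kappa> \<Longrightarrow> q i = 1"
    and q_sum: "(\<lambda>i. q i * \<theta> powi i) summable_on UNIV"
    and radii: "0 < r" "r < \<theta>" "1 < rbar"
    and a_series: "\<And>w. \<theta> \<le> cmod w \<Longrightarrow>
        ((\<lambda>i. complex_of_real (q (i + 1) - q i) * w powi i) has_sum a w) {..int \<kappa>}"
    and a_analytic: "a analytic_on {w. r \<le> cmod w}"
    and inv_a_analytic: "(\<lambda>w. 1 / a w) analytic_on {w. r \<le> cmod w \<and> cmod w \<le> rbar}"
    and psi_analytic: "\<psi> analytic_on {w. r \<le> cmod w \<and> cmod w \<le> rbar}"
    and inv_psi_analytic: "(\<lambda>w. 1 / \<psi> w) analytic_on {w. r \<le> cmod w \<and> cmod w \<le> rbar}"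
    and nonzero: "\<And>w. r \<le> cmod w \<Longrightarrow> cmod w \<le> rbar \<Longrightarrow> a w \<noteq> 0 \<and> \<psi> w \<noteq> 0"
    and y_gaps: "\<And>j. 1 \<le> j \<Longrightarrow> j < nbar \<Longrightarrow> y j - y (j + 1) \<ge> int \<kappa>"
    and walk: "\<And>z. random_walk_from (Q_ker \<theta> q) z (P z) B"
  shows
    "(\<forall>n\<in>{1..nbar}. \<forall>z1 z2.
        S_ker \<theta> q a \<psi> r n z1 z2 = S_contour \<theta> q a \<psi> r n z1 z2)
   \<and> (\<forall>n\<in>{1..nbar}. \<forall>z1 z2. \<forall>\<delta>\<in>{0<..<1}.
        (\<lambda>w. a (1 - w)) analytic_on cball 0 \<delta> \<longrightarrow>
        (\<lambda>w. 1 / \<psi> (1 - w)) analytic_on cball 0 \<delta> \<longrightarrow>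
        Sbar_ker \<theta> q a \<psi> r n z1 z2 = Sbar_contour \<theta> q a \<psi> \<delta> n z1 z2)
   \<and> (\<forall>n\<in>{1..nbar}. \<forall>z1 z2.
        integrable (P z1) (\<lambda>\<omega>. stopped_value (Sbar_ker \<theta> q a \<psi> r) y n z2 (\<lambda>m. B m \<omega>)))
   \<and> (\<forall>ni\<in>{1..nbar}. \<forall>nj\<in>{1..nbar}. \<forall>xi xj.
        (\<lambda>z. adjoint_ker (S_ker \<theta> q a \<psi> r ni) xi z *
              epi_ker P B (Sbar_ker \<theta> q a \<psi> r) y nj z xj) summable_on UNIV \<and>
        K_ker \<theta> q a \<psi> r y ni xi nj xj =
          - (if ni < nj then Q_pow \<theta> q a r (int nj - int ni) xi xj else 0) +
          (adjoint_ker (S_ker \<theta> q a \<psi> r ni) \<circ>\<^sub>K epi_ker P B (Sbar_ker \<theta> q a \<psi> r) y nj) xi xj)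
   \<and> (\<forall>n\<in>{1..nbar}. \<forall>z1 z2. \<forall>r'\<in>{r..<1}.
        S_contour \<theta> q a \<psi> r n z1 z2 = S_contour \<theta> q a \<psi> r' n z1 z2)"
proof -
  interpret kernel_setup \<kappa> \<theta> r rbar q a \<psi>
    by unfold_locales fact+
  have epi: "epi_ker P B (Sbar_ker \<theta> q a \<psi> r) y n z x =
      (\<Sum>k=1..n. ker_AQ k z (y k) * Phi \<theta> q a \<psi> r y n (n - k) x)" if "n \<in> {1..nbar}" for n z x
    using that y_gaps by (intro epi_expansion walk) auto
  have S: "S_ker \<theta> q a \<psi> r n z1 z2 = S_contour \<theta> q a \<psi> r n z1 z2" if "n \<in> {1..nbar}" for n z1 z2
    using that by (simp add: S_ker_eq S_contour_eq adjoint_ker_def)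
  have int: "integrable (P z1) (\<lambda>\<omega>. stopped_value (Sbar_ker \<theta> q a \<psi> r) y n z2 (\<lambda>m. B m \<omega>))" for n z1 z2
  proof -
    obtain C where "\<forall>b. cmod (stopped_value (Sbar_ker \<theta> q a \<psi> r) y n z2 b) \<le> C"
      using stopped_value_bounded[of n "Sbar_ker \<theta> q a \<psi> r" z2 y] Sbar_bounded by blast
    then show ?thesis by (intro integrable_stopped_value[OF walk]) auto
  qed
  have hs: "((\<lambda>z. adjoint_ker (S_ker \<theta> q a \<psi> r ni) xi z *
        epi_ker P B (Sbar_ker \<theta> q a \<psi> r) y nj z xj) has_sum
      (\<Sum>k=1..nj. Psi \<theta> q a \<psi> r y ni (int ni - int k) xi * Phi \<theta> q a \<psi> r y nj (nj - k) xj)) UNIV"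
    if "nj \<in> {1..nbar}" for ni nj xi xj
  proof -
    \<comment> \<open>Since the expansion of the stopped expectation is a finite sum valid for every
      \<open>z\<close>, composing with \<open>S\<close> reduces to finitely many compositions of
      symbol kernels.\<close>
    have "((\<lambda>z. \<Sum>k=1..nj. (adjoint_ker (S_ker \<theta> q a \<psi> r ni) xi z * ker_AQ k z (y k)) *
          Phi \<theta> q a \<psi> r y nj (nj - k) xj) has_sum
        (\<Sum>k=1..nj. Psi \<theta> q a \<psi> r y ni (int ni - int k) xi * Phi \<theta> q a \<psi> r y nj (nj - k) xj)) UNIV"
      by (intro has_sum_finite_sum has_sum_cmult_left has_sum_S_ker_AQ) auto
    then show ?thesis unfolding epi[OF that] by (simp add: sum_distrib_left mult.assoc)
  qed
  show ?thesis
  proof (intro conjI ballI allI impI)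
    fix ni nj :: nat and xi xj :: int assume "ni \<in> {1..nbar}" and nj: "nj \<in> {1..nbar}"
    show "(\<lambda>z. adjoint_ker (S_ker \<theta> q a \<psi> r ni) xi z *
              epi_ker P B (Sbar_ker \<theta> q a \<psi> r) y nj z xj) summable_on UNIV"
      using hs[OF nj] by (rule has_sum_imp_summable)
    show "K_ker \<theta> q a \<psi> r y ni xi nj xj =
          - (if ni < nj then Q_pow \<theta> q a r (int nj - int ni) xi xj else 0) +
          (adjoint_ker (S_ker \<theta> q a \<psi> r ni) \<circ>\<^sub>K epi_ker P B (Sbar_ker \<theta> q a \<psi> r) y nj) xi xj"
      unfolding kcomp_def infsumI[OF hs[OF nj]] K_ker_def ..
  next
    fix n :: nat and z1 z2 :: int and d :: real
    assume "n \<in> {1..nbar}" "d \<in> {0<..<1}" "(\<lambda>w. a (1 - w)) analytic_on cball 0 d"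
      "(\<lambda>w. 1 / \<psi> (1 - w)) analytic_on cball 0 d"
    then show "Sbar_ker \<theta> q a \<psi> r n z1 z2 = Sbar_contour \<theta> q a \<psi> d n z1 z2"
      by (simp add: Sbar_ker_eq Sbar_contour_eq)
  qed (use S int S_contour_radius in auto)
qed

end
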